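(* Under the standing assumptions (a)--(e) of the context, let $\vec u=(u^{ij})_{(i,j)\in\Gamma^1\times\Gamma^2}$ be an usc viscosity subsolution and $\vec w=(w^{ij})_{(i,j)\in\Gamma^1\times\Gamma^2}$ an lsc viscosity supersolution of the system (S) such that all $u^{ij}$ and $w^{ij}$ belong to $\Pi_g$, i.e. there exist constants $\gamma$ and $C$ such that for all $(i,j)\in\Gamma^1\times\Gamma^2$ and all $(t,x)\in[0,T]\times\mathbb{R}^k$, $$|u^{ij}(t,x)|+|w^{ij}(t,x)|\le C(1+|x|^\gamma).$$ Then for every $(i,j)\in\Gamma^1\times\Gamma^2$, $u^{ij}(t,x)\le w^{ij}(t,x)$ for all $(t,x)\in[0,T]\times\mathbb{R}^k$.
   Context: **Data.** Fix $T>0$, positive integers $k,d$, and nonempty finite sets $\Gamma^1,\Gamma^2$. $\Lambda$ is the cardinality of $\Gamma^1\times\Gamma^2$; $(\Gamma^1)^{-i}=\Gamma^1\setminus\{i\}$, $(\Gamma^2)^{-j}=\Gamma^2\setminus\{j\}$. $\Pi_g$ is the class of functions $\Phi$ on $[0,T]\times\mathbb{R}^k$ with $|\Phi(t,x)|\le C(1+|x|^\gamma)$ for some constants $C,\gamma\ge 0$ (similarly for functions of $x$ only; a family is in $\Pi_g$ if each component is). Data, for $i,i'\in\Gamma^1$, $j,l\in\Gamma^2$: $b:[0,T]\times\mathbb{R}^k\to\mathbb{R}^k$, $\sigma:[0,T]\times\mathbb{R}^k\to\mathbb{R}^{k\times d}$, $f^{ij}:[0,T]\times\mathbb{R}^k\times\mathbb{R}^\Lambda\times\mathbb{R}^d\to\mathbb{R}$,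 $\underline g_{ii'}:[0,T]\times\mathbb{R}^k\to\mathbb{R}$, $\bar g_{jl}:[0,T]\times\mathbb{R}^k\to\mathbb{R}$ (with $\underline g_{ii}=\bar g_{jj}=0$), $h^{ij}:\mathbb{R}^k\to\mathbb{R}$. **Standing assumptions.** (a) $b,\sigma$ are jointly continuous and there is $C\ge0$ with $|b(t,x)|+|\sigma(t,x)|\le C(1+|x|)$ and $|\sigma(t,x)-\sigma(t,x')|+|b(t,x)-b(t,x')|\le C|x-x'|$. (b) Each $f^{ij}$ is continuous in $(t,x)$ uniformly with respect to $(\vec y,z)$, $(t,x)\mapsto f^{ij}(t,x,0,0)$ is of polynomial growth, and $|f^{ij}(t,x,\vec y_1,z_1)-f^{ij}(t,x,\vec y_2,z_2)|\le C(|\vec y_1-\vec y_2|+|z_1-z_2|)$. (c) For $(k',l')\ne(i,j)$, $f^{ij}(t,x,\vec y,z)$ is non-decreasing in the component $y^{k'l'}$ of $\vec y$. (d) Each $h^{ij}$ is continuous, in $\Pi_g$, and $\max_{k'\in(\Gamma^1)^{-i}}(h^{k'j}(x)-\underline g_{ik'}(T,x))\le h^{ij}(x)\le\min_{l\in(\Gamma^2)^{-j}}(h^{il}(x)+\bar g_{jl}(T,x))$ for all $x$. (e) $\underline g_{ii'},\bar g_{jl}$ are non-negative, jointly continuous, in $\Pi_g$, and satisfy the no free loop property: for every $N\ge3$ and every sequence $(i_1,j_1),\dots,(i_N,j_N)$ in $\Gamma^1\times\Gamma^2$ with $(i_N,j_N)=(i_1,j_1)$, exactly $N-1$ distinct elements,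 and for each $q=1,\dots,N-1$ either $i_{q+1}=i_q$ or $j_{q+1}=j_q$, one has for all $(t,x)$: $\sum_{q=1}^{N-1}\big(-\underline g_{i_qi_{q+1}}(t,x)1_{i_q\ne i_{q+1}}+\bar g_{j_qj_{q+1}}(t,x)1_{j_q\ne j_{q+1}}\big)\ne0$. **System (S).** $\mathcal L\varphi=b^\top D_x\varphi+\frac12\mathrm{Tr}[\sigma\sigma^\top D^2_{xx}\varphi]$; for $\vec v=(v^{k'l'})$, $L^{ij}[\vec v](t,x)=\max_{k'\in(\Gamma^1)^{-i}}(v^{k'j}-\underline g_{ik'})(t,x)$, $U^{ij}[\vec v](t,x)=\min_{l\in(\Gamma^2)^{-j}}(v^{il}+\bar g_{jl})(t,x)$. System (S): for all $(i,j)$, $$\min\{v^{ij}-L^{ij}[\vec v],\ \max\{v^{ij}-U^{ij}[\vec v],\ -\partial_tv^{ij}-\mathcal Lv^{ij}-f^{ij}(t,x,\vec v(t,x),\sigma^\top(t,x) D_xv^{ij}(t,x))\}\}=0,\quad v^{ij}(T,x)=h^{ij}(x).$$ **Viscosity sub/supersolutions.** For $u$ lsc (resp. usc) on $[0,T]\times\mathbb{R}^k$, $J^-u(t,x)$ (resp. $J^+u(t,x)$) is the set of $(p,q,M)\in\mathbb{R}\times\mathbb{R}^k\times\mathbb{S}^k$ ($\mathbb{S}^k$: symmetric matrices) with $u(t',x')\ge$ (resp. $\le$) $u(t,x)+p(t'-t)+q^\top(x'-x)+\frac12(x'-x)^\top M(x'-x)+o(|t'-t|+|x'-x|^2)$;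 $\bar J^\mp u(t,x)$ is the set of limits $(p,q,M)=\lim(p_n,q_n,M_n)$ with $(p_n,q_n,M_n)\in J^\mp u(t_n,x_n)$, $(t_n,x_n)\to(t,x)$, $u(t_n,x_n)\to u(t,x)$. A family $\vec v$ with lsc (resp. usc) components is a viscosity supersolution (resp. subsolution) of (S) if for all $(i,j)$, $v^{ij}(T,x)\ge h^{ij}(x)$ (resp. $\le$) for all $x$, and for all $(t,x)\in[0,T)\times\mathbb{R}^k$ and $(p,q,M)\in\bar J^-v^{ij}(t,x)$ (resp. $\bar J^+v^{ij}(t,x)$), $\min\{(v^{ij}-L^{ij}[\vec v])(t,x),\max\{-p-b(t,x)^\top q-\frac12\mathrm{Tr}[\sigma\sigma^\top(t,x)M]-f^{ij}(t,x,\vec v(t,x),\sigma^\top(t,x)q),(v^{ij}-U^{ij}[\vec v])(t,x)\}\}\ge0$ (resp. $\le0$). *)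

theory Defs
  imports "HOL-Analysis.Analysis" "HOL-Library.Landau_Symbols"
begin

text \<open>
  The finite nonempty index sets are finite types \<open>'i\<close>, \<open>'j\<close>; the spaces of dimension
  \<open>k\<close>, \<open>d\<close> and \<open>\<Lambda>\<close> are \<open>real ^ 'k\<close>, \<open>real ^ 'd\<close> and \<open>real ^ ('i \<times> 'j)\<close>.
  Functions on \<open>[0,T] \<times> \<real>\<^sup>k\<close> are total functions of type \<open>real \<Rightarrow> real ^ 'k \<Rightarrow> _\<close>; their values
  at times outside \<open>[0,T]\<close> never matter. Matrices carry the Euclidean (Frobenius) norm.
\<close>

abbreviation dom_T :: "real \<Rightarrow> (real \<times> (real ^ 'k)) set"
  where "dom_T T \<equiv> {0..T} \<times> UNIV"

definition lsc_on :: "'a::topological_space set \<Rightarrow> ('a \<Rightarrow> real) \<Rightarrow> bool"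
  where "lsc_on S u \<longleftrightarrow> (\<forall>a\<in>S. \<forall>c<u a. eventually (\<lambda>y. c < u y) (at a within S))"

definition usc_on :: "'a::topological_space set \<Rightarrow> ('a \<Rightarrow> real) \<Rightarrow> bool"
  where "usc_on S u \<longleftrightarrow> (\<forall>a\<in>S. \<forall>c>u a. eventually (\<lambda>y. u y < c) (at a within S))"

text \<open>
  The class \<open>\<Pi>\<^sub>g\<close>. Although \<open>0 powr 0 = 0\<close>, the class is the intended one, since for exponent
  \<open>0\<close> the discrepancy at \<open>x = 0\<close> is absorbed by the constant.
\<close>

definition poly_growth :: "real \<Rightarrow> (real \<Rightarrow> real ^ 'k \<Rightarrow> real) \<Rightarrow> bool"
  where "poly_growth T \<Phi> \<longleftrightarrow>
    (\<exists>C \<gamma>. 0 \<le> C \<and> 0 \<le> \<gamma> \<and> (\<forall>t\<in>{0..T}. \<forall>x. \<bar>\<Phi> t x\<bar> \<le> C * (1 + norm x powr \<gamma>)))"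

definition poly_growth_space :: "(real ^ 'k \<Rightarrow> real) \<Rightarrow> bool"
  where "poly_growth_space \<phi> \<longleftrightarrow>
    (\<exists>C \<gamma>. 0 \<le> C \<and> 0 \<le> \<gamma> \<and> (\<forall>x. \<bar>\<phi> x\<bar> \<le> C * (1 + norm x powr \<gamma>)))"

text \<open>Continuity in \<open>(t,x)\<close>, uniformly with respect to \<open>(y,z)\<close>: the modulus of continuity at
  each point \<open>(t,x)\<close> does not depend on \<open>(y,z)\<close>.\<close>

definition continuous_tx_uniformly_yz ::
  "real \<Rightarrow> (real \<Rightarrow> real ^ 'k \<Rightarrow> 'y \<Rightarrow> 'z \<Rightarrow> real) \<Rightarrow> bool"
  where "continuous_tx_uniformly_yz T F \<longleftrightarrow>
    (\<forall>t\<in>{0..T}. \<forall>x. \<forall>\<epsilon>>0. \<exists>\<delta>>0. \<forall>t'\<in>{0..T}. \<forall>x'. dist (t', x') (t, x) < \<delta> \<longrightarrow>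
      (\<forall>y z. \<bar>F t' x' y z - F t x y z\<bar> < \<epsilon>))"

definition no_free_loop ::
  "real \<Rightarrow> ('i \<Rightarrow> 'i \<Rightarrow> real \<Rightarrow> real ^ 'k \<Rightarrow> real)
    \<Rightarrow> ('j \<Rightarrow> 'j \<Rightarrow> real \<Rightarrow> real ^ 'k \<Rightarrow> real) \<Rightarrow> bool"
  where "no_free_loop T gl gu \<longleftrightarrow>
    (\<forall>N\<ge>3. \<forall>a :: nat \<Rightarrow> 'i. \<forall>b :: nat \<Rightarrow> 'j.
      (a N, b N) = (a 1, b 1) \<and>
      card ((\<lambda>q. (a q, b q)) ` {1..N}) = N - 1 \<and>
      (\<forall>q\<in>{1..N - 1}. a (q + 1) = a q \<or> b (q + 1) = b q) \<longrightarrow>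
      (\<forall>t\<in>{0..T}. \<forall>x.
        (\<Sum>q = 1..N - 1. - gl (a q) (a (q + 1)) t x * of_bool (a q \<noteq> a (q + 1))
                      + gu (b q) (b (q + 1)) t x * of_bool (b q \<noteq> b (q + 1))) \<noteq> 0))"

text \<open>
  Obstacles are extended-real valued, so that the maximum over the empty set is \<open>-\<infinity>\<close> and
  the minimum over the empty set is \<open>\<infinity>\<close> when an index type has a single element, i.e. the
  corresponding constraint is void. Over nonempty (finite) sets these are the usual max and min.
\<close>

definition lower_obstacle ::
  "('i::finite \<Rightarrow> 'i \<Rightarrow> real \<Rightarrow> real ^ 'k \<Rightarrow> real) \<Rightarrow> ('i \<Rightarrow> 'j \<Rightarrow> real \<Rightarrow> real ^ 'k \<Rightarrow> real)
    \<Rightarrow> 'i \<Rightarrow> 'j \<Rightarrow> real \<Rightarrow> real ^ 'k \<Rightarrow> ereal"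
  where "lower_obstacle gl v i j t x = (SUP k'\<in>UNIV - {i}. ereal (v k' j t x - gl i k' t x))"

definition upper_obstacle ::
  "('j::finite \<Rightarrow> 'j \<Rightarrow> real \<Rightarrow> real ^ 'k \<Rightarrow> real) \<Rightarrow> ('i \<Rightarrow> 'j \<Rightarrow> real \<Rightarrow> real ^ 'k \<Rightarrow> real)
    \<Rightarrow> 'i \<Rightarrow> 'j \<Rightarrow> real \<Rightarrow> real ^ 'k \<Rightarrow> ereal"
  where "upper_obstacle gu v i j t x = (INF l\<in>UNIV - {j}. ereal (v i l t x + gu j l t x))"

text \<open>Parabolic second-order jets relative to \<open>[0,T] \<times> \<real>\<^sup>k\<close> (hence one-sided in time at \<open>t = 0\<close>
  and \<open>t = T\<close>); \<open>r\<close> is the remainder term.\<close>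

definition subjet ::
  "real \<Rightarrow> (real \<Rightarrow> real ^ 'k \<Rightarrow> real) \<Rightarrow> real \<Rightarrow> real ^ 'k
    \<Rightarrow> (real \<times> (real ^ 'k) \<times> (real ^ 'k ^ 'k)) set"
  where "subjet T u t x = {(p, q, M). transpose M = M \<and>
    (\<exists>r \<in> o[at (t, x) within dom_T T](\<lambda>(t', x'). \<bar>t' - t\<bar> + (norm (x' - x))\<^sup>2).
      \<forall>t'\<in>{0..T}. \<forall>x'. u t' x' \<ge> u t x + p * (t' - t) + q \<bullet> (x' - x)
        + 1/2 * ((x' - x) \<bullet> (M *v (x' - x))) + r (t', x'))}"

definition superjet ::
  "real \<Rightarrow> (real \<Rightarrow> real ^ 'k \<Rightarrow> real) \<Rightarrow> real \<Rightarrow> real ^ 'k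
    \<Rightarrow> (real \<times> (real ^ 'k) \<times> (real ^ 'k ^ 'k)) set"
  where "superjet T u t x = {(p, q, M). transpose M = M \<and>
    (\<exists>r \<in> o[at (t, x) within dom_T T](\<lambda>(t', x'). \<bar>t' - t\<bar> + (norm (x' - x))\<^sup>2).
      \<forall>t'\<in>{0..T}. \<forall>x'. u t' x' \<le> u t x + p * (t' - t) + q \<bullet> (x' - x)
        + 1/2 * ((x' - x) \<bullet> (M *v (x' - x))) + r (t', x'))}"

text \<open>Limiting jets; \<open>J\<close> is meant to be \<open>subjet T u\<close> or \<open>superjet T u\<close>.\<close>

definition jet_closure ::
  "(real \<Rightarrow> real ^ 'k \<Rightarrow> (real \<times> (real ^ 'k) \<times> (real ^ 'k ^ 'k)) set)
    \<Rightarrow> real \<Rightarrow> (real \<Rightarrow> real ^ 'k \<Rightarrow> real) \<Rightarrow> real \<Rightarrow> real ^ 'k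
    \<Rightarrow> (real \<times> (real ^ 'k) \<times> (real ^ 'k ^ 'k)) set"
  where "jet_closure J T u t x = {(p, q, M).
    \<exists>tn xn pn qn Mn. (\<forall>n::nat. tn n \<in> {0..T} \<and> (pn n, qn n, Mn n) \<in> J (tn n) (xn n)) \<and>
      tn \<longlonglongrightarrow> t \<and> xn \<longlonglongrightarrow> x \<and> (\<lambda>n. u (tn n) (xn n)) \<longlonglongrightarrow> u t x \<and>
      pn \<longlonglongrightarrow> p \<and> qn \<longlonglongrightarrow> q \<and> Mn \<longlonglongrightarrow> M}"

definition subjet_closure ::
  "real \<Rightarrow> (real \<Rightarrow> real ^ 'k \<Rightarrow> real) \<Rightarrow> real \<Rightarrow> real ^ 'k
    \<Rightarrow> (real \<times> (real ^ 'k) \<times> (real ^ 'k ^ 'k)) set"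
  where "subjet_closure T u = jet_closure (subjet T u) T u"

definition superjet_closure ::
  "real \<Rightarrow> (real \<Rightarrow> real ^ 'k \<Rightarrow> real) \<Rightarrow> real \<Rightarrow> real ^ 'k
    \<Rightarrow> (real \<times> (real ^ 'k) \<times> (real ^ 'k ^ 'k)) set"
  where "superjet_closure T u = jet_closure (superjet T u) T u"

text \<open>Left-hand side of the \<open>(i,j)\<close>-th equation of the system, with \<open>(p,q,M)\<close> in place of the
  derivatives \<open>(\<partial>\<^sub>tv, D\<^sub>xv, D\<^sub>x\<^sub>xv)\<close> of the \<open>(i,j)\<close>-th component.\<close>

definition pde_term ::
  "(real \<Rightarrow> real ^ 'k \<Rightarrow> real ^ 'k) \<Rightarrow> (real \<Rightarrow> real ^ 'k \<Rightarrow> real ^ 'd ^ 'k)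
    \<Rightarrow> ('i::finite \<Rightarrow> 'j::finite \<Rightarrow> real \<Rightarrow> real ^ 'k \<Rightarrow> real ^ ('i \<times> 'j) \<Rightarrow> real ^ 'd \<Rightarrow> real)
    \<Rightarrow> ('i \<Rightarrow> 'j \<Rightarrow> real \<Rightarrow> real ^ 'k \<Rightarrow> real)
    \<Rightarrow> 'i \<Rightarrow> 'j \<Rightarrow> real \<Rightarrow> real ^ 'k \<Rightarrow> real \<Rightarrow> real ^ 'k \<Rightarrow> real ^ 'k ^ 'k \<Rightarrow> real"
  where "pde_term b \<sigma> f v i j t x p q M =
    - p - b t x \<bullet> q - 1/2 * trace (\<sigma> t x ** transpose (\<sigma> t x) ** M)
    - f i j t x (\<chi> m. v (fst m) (snd m) t x) (transpose (\<sigma> t x) *v q)"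

definition system_operator ::
  "(real \<Rightarrow> real ^ 'k \<Rightarrow> real ^ 'k) \<Rightarrow> (real \<Rightarrow> real ^ 'k \<Rightarrow> real ^ 'd ^ 'k)
    \<Rightarrow> ('i::finite \<Rightarrow> 'j::finite \<Rightarrow> real \<Rightarrow> real ^ 'k \<Rightarrow> real ^ ('i \<times> 'j) \<Rightarrow> real ^ 'd \<Rightarrow> real)
    \<Rightarrow> ('i \<Rightarrow> 'i \<Rightarrow> real \<Rightarrow> real ^ 'k \<Rightarrow> real) \<Rightarrow> ('j \<Rightarrow> 'j \<Rightarrow> real \<Rightarrow> real ^ 'k \<Rightarrow> real)
    \<Rightarrow> ('i \<Rightarrow> 'j \<Rightarrow> real \<Rightarrow> real ^ 'k \<Rightarrow> real)
    \<Rightarrow> 'i \<Rightarrow> 'j \<Rightarrow> real \<Rightarrow> real ^ 'k \<Rightarrow> real \<Rightarrow> real ^ 'k \<Rightarrow> real ^ 'k ^ 'k \<Rightarrow> ereal"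
  where "system_operator b \<sigma> f gl gu v i j t x p q M =
    min (ereal (v i j t x) - lower_obstacle gl v i j t x)
        (max (ereal (pde_term b \<sigma> f v i j t x p q M))
             (ereal (v i j t x) - upper_obstacle gu v i j t x))"

definition viscosity_supersolution ::
  "real \<Rightarrow> (real \<Rightarrow> real ^ 'k \<Rightarrow> real ^ 'k) \<Rightarrow> (real \<Rightarrow> real ^ 'k \<Rightarrow> real ^ 'd ^ 'k)
    \<Rightarrow> ('i::finite \<Rightarrow> 'j::finite \<Rightarrow> real \<Rightarrow> real ^ 'k \<Rightarrow> real ^ ('i \<times> 'j) \<Rightarrow> real ^ 'd \<Rightarrow> real)
    \<Rightarrow> ('i \<Rightarrow> 'i \<Rightarrow> real \<Rightarrow> real ^ 'k \<Rightarrow> real) \<Rightarrow> ('j \<Rightarrow> 'j \<Rightarrow> real \<Rightarrow> real ^ 'k \<Rightarrow> real)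
    \<Rightarrow> ('i \<Rightarrow> 'j \<Rightarrow> real ^ 'k \<Rightarrow> real) \<Rightarrow> ('i \<Rightarrow> 'j \<Rightarrow> real \<Rightarrow> real ^ 'k \<Rightarrow> real) \<Rightarrow> bool"
  where "viscosity_supersolution T b \<sigma> f gl gu h v \<longleftrightarrow>
    (\<forall>i j. lsc_on (dom_T T) (\<lambda>(t, x). v i j t x)) \<and>
    (\<forall>i j. (\<forall>x. v i j T x \<ge> h i j x) \<and>
      (\<forall>t\<in>{0..<T}. \<forall>x. \<forall>(p, q, M)\<in>subjet_closure T (v i j) t x.
        system_operator b \<sigma> f gl gu v i j t x p q M \<ge> 0))"

definition viscosity_subsolution ::
  "real \<Rightarrow> (real \<Rightarrow> real ^ 'k \<Rightarrow> real ^ 'k) \<Rightarrow> (real \<Rightarrow> real ^ 'k \<Rightarrow> real ^ 'd ^ 'k)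
    \<Rightarrow> ('i::finite \<Rightarrow> 'j::finite \<Rightarrow> real \<Rightarrow> real ^ 'k \<Rightarrow> real ^ ('i \<times> 'j) \<Rightarrow> real ^ 'd \<Rightarrow> real)
    \<Rightarrow> ('i \<Rightarrow> 'i \<Rightarrow> real \<Rightarrow> real ^ 'k \<Rightarrow> real) \<Rightarrow> ('j \<Rightarrow> 'j \<Rightarrow> real \<Rightarrow> real ^ 'k \<Rightarrow> real)
    \<Rightarrow> ('i \<Rightarrow> 'j \<Rightarrow> real ^ 'k \<Rightarrow> real) \<Rightarrow> ('i \<Rightarrow> 'j \<Rightarrow> real \<Rightarrow> real ^ 'k \<Rightarrow> real) \<Rightarrow> bool"
  where "viscosity_subsolution T b \<sigma> f gl gu h v \<longleftrightarrow>
    (\<forall>i j. usc_on (dom_T T) (\<lambda>(t, x). v i j t x)) \<and>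
    (\<forall>i j. (\<forall>x. v i j T x \<le> h i j x) \<and>
      (\<forall>t\<in>{0..<T}. \<forall>x. \<forall>(p, q, M)\<in>superjet_closure T (v i j) t x.
        system_operator b \<sigma> f gl gu v i j t x p q M \<le> 0))"

end

theory Submission
  imports Defs
begin

text \<open>
  Suppose that \<open>u i j > w i j\<close> somewhere. The function
  \<open>exp (- \<mu> * t) * (\<theta> * (1 + x \<bullet> x) ^ (n + 2) + \<Phi>)\<close> with large \<open>\<mu>\<close> and \<open>n\<close> and small \<open>\<theta>\<close> is a strict supersolution of the
  linearised system that outgrows \<open>u\<close> and \<open>w\<close> (\<open>barrier_strict_supersolution\<close>). For the least admissible \<open>\<Phi> > 0\<close> it
  touches the maximum of the differences \<open>u i j - w i j\<close> from above at some \<open>(ts, xs)\<close>, and \<open>ts < T\<close> because of the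
  terminal condition. By the no free loop property some maximising pair \<open>(i, j)\<close> has \<open>u i j\<close> strictly above its lower
  obstacle and \<open>w i j\<close> strictly below its upper obstacle (\<open>no_free_loop_selection\<close>). Near \<open>(ts, xs)\<close> these two
  components therefore satisfy the differential inequalities, and doubling the variables shows that the
  barrier cannot be a strict supersolution there (\<open>touching_inequality\<close>).

  The second order terms in the doubling of variables are commonly controlled by the theorem on
  sums of Crandall and Ishii, whose proof rests on Alexandrov's theorem on second derivatives of
  convex functions. Since the equations are linear in the second derivatives, a trace form of that theorem is
  enough (\<open>trace_theorem_on_sums\<close>), and this form has an elementary proof. Let \<open>u x + v y\<close> be bounded by a quadratic
  form of \<open>x - y\<close>, with equality at a base point, after subtraction of affine functions, and let
  \<open>(\<Sum>l. a l \<bullet> D\<^sup>2u (a l)) \<ge> \<alpha>\<close> and \<open>(\<Sum>l. b l \<bullet> D\<^sup>2v (b l)) \<ge> \<beta>\<close> in the viscosity sense at the base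
  point. After a blow-up these are inequalities with constant coefficients, and they imply that \<open>u\<close> and \<open>v\<close>
  lie below their means along the random walks with steps \<open>\<plusminus> a l\<close> and \<open>\<plusminus> b l\<close>, up to a drift of \<open>\<alpha> / 2\<close> and \<open>\<beta> / 2\<close>
  (\<open>walk_comparison\<close>). If both walks use the same random choices, the sum of the means is at most the mean
  of the quadratic form along the walk with steps \<open>\<plusminus> (a l - b l)\<close>, which is explicit
  (\<open>walk_coupled\<close>). Comparing the two bounds at the base point estimates \<open>\<alpha> + \<beta>\<close>.

  The comparison with the random walk is an induction over its steps with smooth touching functions. It needs
  a smooth function above \<open>u\<close> whose Taylor remainders are bounded independently of the scale of the blow-up
  and which keeps the coupled bound for \<open>u\<close> and \<open>v\<close>. The sup-convolution followed by a
  mollification has these properties; its semiconvexity keeps the mollification above it, up to a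
  small constant.
\<close>

section \<open>Semicontinuous functions\<close>

lemma usc_on_attains_max:
  fixes u :: "'a::topological_space \<Rightarrow> real"
  assumes K: "compact K" "K \<noteq> {}" and u: "usc_on K u"
  shows "\<exists>x\<in>K. \<forall>y\<in>K. u y \<le> u x"
proof (rule ccontr)
  assume "\<not> ?thesis"
  then have "\<forall>x\<in>K. \<exists>y\<in>K. u x < u y" by (meson not_le)
  then obtain f where f: "\<And>x. x \<in> K \<Longrightarrow> f x \<in> K \<and> u x < u (f x)" by metis
  have "\<exists>S. open S \<and> x \<in> S \<and> (\<forall>y\<in>S \<inter> K. u y < u (f x))" if x: "x \<in> K" for x
  proof -
    have "eventually (\<lambda>y. u y < u (f x)) (at x within K)" using u x f[OF x] by (auto simp: usc_on_def)
    then show ?thesis using f[OF x] unfolding eventually_at_topological by (metis IntD1 IntD2)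
  qed
  then obtain S where S: "\<And>x. x \<in> K \<Longrightarrow> open (S x) \<and> x \<in> S x \<and> (\<forall>y\<in>S x \<inter> K. u y < u (f x))" by metis
  obtain C where C: "C \<subseteq> K" "finite C" "K \<subseteq> (\<Union>c\<in>C. S c)"
    using compactE_image[OF K(1), of K S] S by blast
  have "C \<noteq> {}" using C K by auto
  define m where "m = Max ((\<lambda>c. u (f c)) ` C)"
  have "m \<in> (\<lambda>c. u (f c)) ` C" unfolding m_def using C \<open>C \<noteq> {}\<close> by (intro Max_in) auto
  then obtain c where c: "c \<in> C" "u (f c) = m" by auto
  obtain c' where "c' \<in> C" "f c \<in> S c'" using C c f by blast
  then have "u (f c) < u (f c')" using S C f c by blast
  moreover have "u (f c') \<le> m" unfolding m_def using C \<open>c' \<in> C\<close> by (intro Max_ge) auto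
  ultimately show False using c by simp
qed

lemma usc_on_subset: "usc_on S u \<Longrightarrow> S' \<subseteq> S \<Longrightarrow> usc_on S' u"
  unfolding usc_on_def by (meson at_le filter_leD subsetD)

lemma usc_on_add:
  fixes u v :: "'a::topological_space \<Rightarrow> real"
  assumes u: "usc_on S u" and v: "usc_on S v"
  shows "usc_on S (\<lambda>x. u x + v x)"
  unfolding usc_on_def
proof (intro ballI allI impI)
  fix a c assume a: "a \<in> S" and c: "u a + v a < c"
  define e where "e = (c - u a - v a) / 2"
  have "eventually (\<lambda>y. u y < u a + e) (at a within S)" "eventually (\<lambda>y. v y < v a + e) (at a within S)"
    using u v a c by (auto simp: usc_on_def e_def)
  then show "eventually (\<lambda>y. u y + v y < c) (at a within S)"
    by eventually_elim (simp add: e_def field_simps)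
qed

lemma usc_on_continuous:
  fixes u :: "'a::topological_space \<Rightarrow> real"
  assumes "continuous_on S u" shows "usc_on S u"
  unfolding usc_on_def
proof (intro ballI allI impI)
  fix a c assume a: "a \<in> S" and c: "u a < c"
  then have "(u \<longlongrightarrow> u a) (at a within S)" using assms by (auto simp: continuous_on_def)
  then show "eventually (\<lambda>y. u y < c) (at a within S)" using c by (rule order_tendstoD(2))
qed

lemma usc_on_diff_continuous:
  fixes u v :: "'a::topological_space \<Rightarrow> real"
  assumes u: "usc_on S u" and v: "continuous_on S v"
  shows "usc_on S (\<lambda>x. u x - v x)"
  using usc_on_add[OF u usc_on_continuous[OF continuous_on_minus[OF v]]] by simp

lemma usc_on_compose:
  fixes u :: "'b::topological_space \<Rightarrow> real" and f :: "'a::topological_space \<Rightarrow> 'b"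
  assumes u: "usc_on S u" and f: "continuous_on S' f" "f ` S' \<subseteq> S"
  shows "usc_on S' (\<lambda>x. u (f x))"
  unfolding usc_on_def
proof (intro ballI allI impI)
  fix a c assume a: "a \<in> S'" and c: "u (f a) < c"
  then have "eventually (\<lambda>y. u y < c) (at (f a) within S)" using u f(2) by (auto simp: usc_on_def)
  then obtain T where T: "open T" "f a \<in> T" "\<And>y. y \<in> T \<Longrightarrow> y \<in> S \<Longrightarrow> u y < c"
    using c unfolding eventually_at_topological by metis
  have "eventually (\<lambda>x. f x \<in> T) (at a within S')"
    using f(1) a T topological_tendstoD[of f "f a" "at a within S'" T] unfolding continuous_on_def by blast
  moreover have "eventually (\<lambda>x. x \<in> S') (at a within S')" by (simp add: eventually_at_filter)
  ultimately show "eventually (\<lambda>x. u (f x) < c) (at a within S')"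
    by eventually_elim (use T f(2) in auto)
qed

lemma usc_on_scale:
  fixes u :: "'a::topological_space \<Rightarrow> real"
  assumes "usc_on S u" "0 < c" shows "usc_on S (\<lambda>x. u x / c)"
  using assms unfolding usc_on_def by (simp add: divide_less_eq less_divide_eq mult.commute)

lemma usc_on_mult_positive:
  fixes u c :: "'a::topological_space \<Rightarrow> real"
  assumes u: "usc_on S u" and c: "continuous_on S c" "\<And>x. x \<in> S \<Longrightarrow> 0 < c x"
  shows "usc_on S (\<lambda>x. c x * u x)"
  unfolding usc_on_def
proof (intro ballI allI impI)
  fix a k assume a: "a \<in> S" and k: "c a * u a < k"
  have ca: "0 < c a" by (rule c(2)[OF a])
  then have "u a < k / c a" using k by (simp add: pos_less_divide_eq mult.commute)
  then obtain k' where k': "u a < k'" "k' < k / c a" using dense by blast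
  then have ck: "c a * k' < k" using ca by (simp add: pos_less_divide_eq mult.commute)
  have "eventually (\<lambda>x. u x < k') (at a within S)" using u a k' by (auto simp: usc_on_def)
  moreover have "((\<lambda>x. c x * k') \<longlongrightarrow> c a * k') (at a within S)"
    using c(1) a by (intro tendsto_mult_right) (auto simp: continuous_on_def)
  then have "eventually (\<lambda>x. c x * k' < k) (at a within S)" using ck by (rule order_tendstoD(2))
  moreover have "eventually (\<lambda>x. x \<in> S) (at a within S)" by (simp add: eventually_at_filter)
  ultimately show "eventually (\<lambda>x. c x * u x < k) (at a within S)"
  proof eventually_elim
    case (elim x)
    have "c x * u x < c x * k'" using elim c(2) by simp
    then show ?case using elim by linarith
  qed
qed

lemma usc_on_eventually_less:
  assumes u: "usc_on S u" and X: "\<And>n. X n \<in> S" "X \<longlonglongrightarrow> a" and a: "a \<in> S" "u a < c"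
  shows "\<forall>\<^sub>F n in sequentially. u (X n) < c"
proof -
  have "eventually (\<lambda>y. u y < c) (at a within S)" using u a by (auto simp: usc_on_def)
  then obtain V where V: "open V" "a \<in> V" "\<And>y. y \<in> V \<Longrightarrow> y \<in> S \<Longrightarrow> u y < c"
    using a(2) unfolding eventually_at_topological by metis
  have "\<forall>\<^sub>F n in sequentially. X n \<in> V" using X(2) V by (metis topological_tendstoD)
  then show ?thesis by eventually_elim (use V X in auto)
qed

lemma usc_on_uminus_lsc: "lsc_on S w \<Longrightarrow> usc_on S (\<lambda>x. - w x)"
  unfolding usc_on_def
proof (intro ballI allI impI)
  fix a c assume "lsc_on S w" "a \<in> S" "- w a < c"
  then have "eventually (\<lambda>y. - c < w y) (at a within S)" unfolding lsc_on_def by (simp add: minus_less_iff)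
  then show "eventually (\<lambda>y. - w y < c) (at a within S)" by eventually_elim simp
qed

section \<open>Random walks and Taylor expansions\<close>

text \<open>
  The average of \<open>f\<close> after one step of the symmetric random walk started in \<open>h\<close> that moves by one of the
  vectors \<open>\<plusminus> e l\<close>, all of them with the same probability. The \<open>n\<close>-th power of this operator is the
  average after \<open>n\<close> independent steps.
\<close>

definition walk :: "('l::finite \<Rightarrow> 'a::real_vector) \<Rightarrow> ('a \<Rightarrow> real) \<Rightarrow> 'a \<Rightarrow> real"
  where "walk e f h = (\<Sum>l\<in>UNIV. f (h + e l) + f (h - e l)) / (2 * real CARD('l))"

definition second_difference :: "'a::real_vector \<Rightarrow> ('a \<Rightarrow> real) \<Rightarrow> 'a \<Rightarrow> real"
  where "second_difference e f h = f (h + e) + f (h - e) - 2 * f h"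

definition symmetric_op :: "('a::real_inner \<Rightarrow> 'a) \<Rightarrow> bool"
  where "symmetric_op X \<longleftrightarrow> linear X \<and> (\<forall>x y. x \<bullet> X y = X x \<bullet> y)"

text \<open>
  One constant bounds the gradient, the Hessian and the cubic remainder. Then averaging \<open>f\<close> over
  translations averages the constants as well (\<open>taylor2_walk\<close>), whatever the expansions at the
  translated points are.
\<close>

definition taylor2 :: "('a::real_inner \<Rightarrow> real) \<Rightarrow> 'a \<Rightarrow> 'a \<Rightarrow> ('a \<Rightarrow> 'a) \<Rightarrow> real \<Rightarrow> bool"
  where "taylor2 f h g X K \<longleftrightarrow> symmetric_op X \<and> norm g \<le> K \<and> (\<forall>d. norm (X d) \<le> K * norm d) \<and>
    (\<forall>d. norm d \<le> 1 \<longrightarrow> \<bar>f (h + d) - f h - g \<bullet> d - (d \<bullet> X d) / 2\<bar> \<le> K * norm d ^ 3)"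

lemma symmetric_op_add: "symmetric_op X \<Longrightarrow> symmetric_op Y \<Longrightarrow> symmetric_op (\<lambda>d. X d + Y d)"
  by (auto simp: symmetric_op_def inner_add_left inner_add_right intro!: linear_compose_add)

lemma symmetric_op_scale: "symmetric_op X \<Longrightarrow> symmetric_op (\<lambda>d. c *\<^sub>R X d)"
  by (auto simp: symmetric_op_def intro!: linear_compose_scale_right)

lemma symmetric_op_id: "symmetric_op (\<lambda>d. d)"
  by (auto simp: symmetric_op_def linear_iff)

lemma taylor2_add:
  assumes "taylor2 f h g X K" "taylor2 f' h g' X' K'"
  shows "taylor2 (\<lambda>x. f x + f' x) h (g + g') (\<lambda>d. X d + X' d) (K + K')"
  unfolding taylor2_def
proof (intro conjI allI impI)
  show "symmetric_op (\<lambda>d. X d + X' d)" using assms symmetric_op_add by (auto simp: taylor2_def)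
  show "norm (g + g') \<le> K + K'"
    using assms norm_triangle_mono by (auto simp: taylor2_def)
  show "norm (X d + X' d) \<le> (K + K') * norm d" for d
    using assms by (auto simp: taylor2_def distrib_right intro!: norm_triangle_mono)
  fix d :: 'a assume d: "norm d \<le> 1"
  have "\<bar>f (h + d) - f h - g \<bullet> d - (d \<bullet> X d) / 2\<bar> \<le> K * norm d ^ 3"
    "\<bar>f' (h + d) - f' h - g' \<bullet> d - (d \<bullet> X' d) / 2\<bar> \<le> K' * norm d ^ 3"
    using assms d by (auto simp: taylor2_def)
  then show "\<bar>f (h + d) + f' (h + d) - (f h + f' h) - (g + g') \<bullet> d - d \<bullet> (X d + X' d) / 2\<bar>
      \<le> (K + K') * norm d ^ 3"
    by (simp add: inner_add_left inner_add_right distrib_right add_divide_distrib)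
qed

lemma taylor2_scale:
  assumes "taylor2 f h g X K" "0 \<le> c"
  shows "taylor2 (\<lambda>x. c * f x) h (c *\<^sub>R g) (\<lambda>d. c *\<^sub>R X d) (c * K)"
  unfolding taylor2_def
proof (intro conjI allI impI)
  show "symmetric_op (\<lambda>d. c *\<^sub>R X d)" using assms symmetric_op_scale by (auto simp: taylor2_def)
  show "norm (c *\<^sub>R g) \<le> c * K"
    using assms by (auto simp: taylor2_def intro!: mult_left_mono)
  show "norm (c *\<^sub>R X d) \<le> (c * K) * norm d" for d
    using assms by (auto simp: taylor2_def mult.assoc intro!: mult_left_mono)
  fix d :: 'a assume d: "norm d \<le> 1"
  have *: "c * \<bar>f (h + d) - f h - g \<bullet> d - (d \<bullet> X d) / 2\<bar> \<le> c * (K * norm d ^ 3)"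
    using assms d by (auto simp: taylor2_def intro!: mult_left_mono)
  have "\<bar>c * f (h + d) - c * f h - (c *\<^sub>R g) \<bullet> d - d \<bullet> (c *\<^sub>R X d) / 2\<bar>
      = \<bar>c * (f (h + d) - f h - g \<bullet> d - (d \<bullet> X d) / 2)\<bar>"
    by (simp add: algebra_simps)
  also have "\<dots> = c * \<bar>f (h + d) - f h - g \<bullet> d - (d \<bullet> X d) / 2\<bar>"
    using assms(2) by (simp add: abs_mult)
  finally show "\<bar>c * f (h + d) - c * f h - (c *\<^sub>R g) \<bullet> d - d \<bullet> (c *\<^sub>R X d) / 2\<bar> \<le> c * K * norm d ^ 3"
    using * by simp
qed

lemma taylor2_zero: "taylor2 (\<lambda>x. 0) h 0 (\<lambda>d. 0) 0"
  by (auto simp: taylor2_def symmetric_op_def linear_iff)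

lemma taylor2_mono: "taylor2 f h g X K \<Longrightarrow> K \<le> K' \<Longrightarrow> taylor2 f h g X K'"
  unfolding taylor2_def by (meson mult_right_mono norm_ge_zero order_trans zero_le_power)

lemma taylor2_translate: "taylor2 f (h + e) g X K \<Longrightarrow> taylor2 (\<lambda>x. f (x + e)) h g X K"
  by (simp add: taylor2_def algebra_simps)

lemma taylor2_sum:
  assumes "finite I" "\<And>i. i \<in> I \<Longrightarrow> \<exists>g X. taylor2 (f i) h g X (K i)"
  shows "\<exists>g X. taylor2 (\<lambda>x. \<Sum>i\<in>I. f i x) h g X (\<Sum>i\<in>I. K i)"
  using assms
proof (induction I rule: finite_induct)
  case empty then show ?case using taylor2_zero by (auto intro!: exI)
next
  case (insert i I)
  then obtain g X g' X' where "taylor2 (f i) h g X (K i)"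
    "taylor2 (\<lambda>x. \<Sum>i\<in>I. f i x) h g' X' (\<Sum>i\<in>I. K i)" by (metis insertCI)
  from taylor2_add[OF this] show ?case using insert.hyps by auto
qed

lemma taylor2_walk:
  fixes e :: "'l::finite \<Rightarrow> 'a::real_inner"
  assumes "\<And>h. \<exists>g X. taylor2 f h g X (K h)"
  shows "\<exists>g X. taylor2 (walk e f) h g X (walk e K h)"
proof -
  have *: "\<exists>g X. taylor2 (\<lambda>x. f (x + e l) + f (x - e l)) h g X (K (h + e l) + K (h - e l))" for l
  proof -
    obtain g X g' X' where "taylor2 f (h + e l) g X (K (h + e l))" 
      and "taylor2 f (h + - e l) g' X' (K (h + - e l))"
      using assms by metis
    from taylor2_add[OF this[THEN taylor2_translate]] show ?thesis by auto
  qed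
  obtain g X where "taylor2 (\<lambda>x. \<Sum>l\<in>UNIV. f (x + e l) + f (x - e l)) h g X 
     (\<Sum>l\<in>UNIV. K (h + e l) + K (h - e l))"
    using taylor2_sum[OF finite[of UNIV], of "\<lambda>l x. f (x + e l) + f (x - e l)" h "\<lambda>l. K (h + e l) + K (h - e l)"] * by blast
  from taylor2_scale[OF this, of "1 / (2 * real CARD('l))"]
  show ?thesis unfolding walk_def[abs_def] by auto
qed

lemma walk_mono: "(\<And>h. f h \<le> g h) \<Longrightarrow> walk e f h \<le> walk e g h"
  by (auto simp: walk_def intro!: divide_right_mono sum_mono add_mono)

lemma walk_add: "walk e (\<lambda>h. f h + g h) h = walk e f h + walk e g h"
  by (simp add: walk_def sum.distrib add_divide_distrib)

lemma walk_scale: "walk e (\<lambda>h. c * f h) h = c * walk e f h"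
proof -
  have "(\<Sum>l\<in>UNIV. c * f (h + e l) + c * f (h - e l)) = c * (\<Sum>l\<in>UNIV. f (h + e l) + f (h - e l))"
    by (simp add: sum_distrib_left distrib_left)
  then show ?thesis by (simp add: walk_def)
qed

lemma walk_const [simp]:
  fixes e :: "'l::finite \<Rightarrow> 'a::real_vector" shows "walk e (\<lambda>h. c) h = c"
  by (simp add: walk_def)

lemma walk_norm_sq:
  fixes e :: "'l::finite \<Rightarrow> 'a::real_inner"
  shows "walk e (\<lambda>h. (norm h)\<^sup>2) h = (norm h)\<^sup>2 + (\<Sum>l\<in>UNIV. (norm (e l))\<^sup>2) / real CARD('l)"
proof -
  have "(\<Sum>l\<in>UNIV. (norm (h + e l))\<^sup>2 + (norm (h - e l))\<^sup>2) = (\<Sum>l\<in>UNIV. 2 * (norm h)\<^sup>2 + 2 * (norm (e l))\<^sup>2)"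
    by (intro sum.cong refl)
      (simp add: power2_norm_eq_inner inner_add_left inner_add_right inner_diff_left inner_diff_right inner_commute)
  also have "\<dots> = 2 * real CARD('l) * (norm h)\<^sup>2 + 2 * (\<Sum>l\<in>UNIV. (norm (e l))\<^sup>2)"
    by (simp add: sum.distrib sum_distrib_left)
  finally show ?thesis by (simp add: walk_def add_divide_distrib)
qed

lemma walk_minus_self:
  fixes e :: "'l::finite \<Rightarrow> 'a::real_vector"
  shows "walk e f h - f h = (\<Sum>l\<in>UNIV. second_difference (e l) f h) / (2 * real CARD('l))"
  by (simp add: walk_def second_difference_def sum.distrib sum_subtractf field_simps)

lemma second_difference_walk:
  fixes e :: "'l::finite \<Rightarrow> 'a::real_vector"
  shows "second_difference z (walk e f) h = walk e (second_difference z f) h"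
proof -
  have "second_difference z (walk e f) h = (\<Sum>l\<in>UNIV. (f (h + z + e l) + f (h + z - e l))
    + (f (h - z + e l) + f (h - z - e l)) - 2 * (f (h + e l) + f (h - e l))) / (2 * real CARD('l))"
    by (simp add: second_difference_def walk_def sum.distrib sum_subtractf 
      flip: add_divide_distrib diff_divide_distrib sum_distrib_left)
  also have "\<dots> = walk e (second_difference z f) h"
    unfolding second_difference_def walk_def
    by (intro arg_cong2[where f="(/)"] sum.cong refl) (simp add: algebra_simps)
  finally show ?thesis .
qed

lemma second_difference_taylor2:
  assumes "taylor2 f h g X K" "norm e \<le> 1"
  shows "\<bar>second_difference e f h - e \<bullet> X e\<bar> \<le> 2 * K * norm e ^ 3"
proof -
  have "X (- e) = - X e" using assms by (auto simp: taylor2_def symmetric_op_def linear_neg)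
  moreover have "\<bar>f (h + e) - f h - g \<bullet> e - (e \<bullet> X e) / 2\<bar> \<le> K * norm e ^ 3"
    "\<bar>f (h + - e) - f h - g \<bullet> (- e) - (- e \<bullet> X (- e)) / 2\<bar> \<le> K * norm (- e) ^ 3"
    using assms unfolding taylor2_def by (blast, metis norm_minus_cancel)
  ultimately show ?thesis by (simp add: second_difference_def)
qed

text \<open>
  A double second difference annihilates polynomials of degree two. What is left of the nine function
  values are their Taylor remainders, and the absolute values of the weights add up to 16.
\<close>

lemma second_difference_second_difference_taylor2:
  assumes T: "taylor2 f h g X K" and e: "norm e + norm e' \<le> 1"
  shows "\<bar>second_difference e (second_difference e' f) h\<bar> \<le> 16 * K * (norm e + norm e') ^ 3"
proof -
  define R where "R d = f (h + d) - f h - g \<bullet> d - (d \<bullet> X d) / 2" for d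
  define S where "S = K * (norm e + norm e') ^ 3"
  have K: "0 \<le> K" using T norm_ge_zero order_trans unfolding taylor2_def by blast
  have R: "\<bar>R d\<bar> \<le> S" if "norm d \<le> norm e + norm e'" for d
  proof -
    have "\<bar>R d\<bar> \<le> K * norm d ^ 3" using T that e unfolding R_def taylor2_def by auto
    also have "\<dots> \<le> S" unfolding S_def using K that by (intro mult_left_mono power_mono) auto
    finally show ?thesis .
  qed
  have lin: "linear X" and sym: "e' \<bullet> X e = e \<bullet> X e'" using T by (auto simp: taylor2_def symmetric_op_def inner_commute)
  have f: "f (h + d) = f h + g \<bullet> d + (d \<bullet> X d) / 2 + R d" for d by (simp add: R_def)
  have eq: "second_difference e (second_difference e' f) h = 
     (f (h + (e + e')) + f (h + (e - e')) - 2 * f (h + e)) 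
   + (f (h + (- e + e')) + f (h + (- e - e')) - 2 * f (h + (- e)))
   - 2 * (f (h + e') + f (h + (- e')) - 2 * f h)"
    by (simp add: second_difference_def algebra_simps)
  have eq2: "\<dots> = (R (e + e') + R (e - e') - 2 * R e) + (R (- e + e') + R (- e - e') - 2 * R (- e)) 
     - 2 * (R e' + R (- e') - 2 * R 0)"
    unfolding f[of "e + e'"] f[of "e - e'"] f[of e] f[of "- e + e'"] f[of "- e - e'"] f[of "-e"] f[of e'] f[of "-e'"]
    using f[of 0] sym
    by (simp add: linear_add[OF lin] linear_diff[OF lin] linear_neg[OF lin] linear_0[OF lin] inner_add_left inner_add_right inner_diff_left inner_diff_right 
       field_simps)
  have "norm (e + e') \<le> norm e + norm e'" "norm (e - e') \<le> norm e + norm e'" 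
    "norm (- e + e') \<le> norm e + norm e'" "norm (- e - e') \<le> norm e + norm e'"
    using norm_triangle_ineq[of e e'] norm_triangle_ineq4[of e e'] norm_triangle_ineq[of "-e" e'] norm_triangle_ineq4[of "-e" e'] by auto
  then have r: "\<bar>R (e + e')\<bar> \<le> S" "\<bar>R (e - e')\<bar> \<le> S" "\<bar>R (- e + e')\<bar> \<le> S" "\<bar>R (- e - e')\<bar> \<le> S"
    "\<bar>R e\<bar> \<le> S" "\<bar>R (-e)\<bar> \<le> S" "\<bar>R e'\<bar> \<le> S" "\<bar>R (-e')\<bar> \<le> S" "\<bar>R 0\<bar> \<le> S"
    by (auto intro!: R)
  have three: "\<bar>x + y - 2 * z\<bar> \<le> 4 * c" if "\<bar>x\<bar> \<le> c" "\<bar>y\<bar> \<le> c" "\<bar>z\<bar> \<le> c" for x y z c :: real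
    using that by linarith
  have "\<bar>second_difference e (second_difference e' f) h\<bar> \<le> 4 * (4 * S)" 
    unfolding eq eq2 by (intro three r)
  then show ?thesis by (simp add: S_def)
qed

lemma taylor2_isCont:
  assumes "taylor2 f h g X K" shows "isCont f h"
proof -
  have K: "0 \<le> K" using assms norm_ge_zero order_trans unfolding taylor2_def by blast
  have b: "\<bar>f (h + d) - f h\<bar> \<le> 3 * K * norm d" if d: "norm d \<le> 1" for d
  proof -
    have 1: "\<bar>f (h + d) - f h - g \<bullet> d - (d \<bullet> X d) / 2\<bar> \<le> K * norm d ^ 3"
      using assms d by (auto simp: taylor2_def)
    have "norm d ^ 3 \<le> norm d" using d power_decreasing[of 1 3 "norm d"] by simp
    then have 2: "K * norm d ^ 3 \<le> K * norm d" using K by (rule mult_left_mono)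
    have "\<bar>g \<bullet> d\<bar> \<le> norm g * norm d" by (rule Cauchy_Schwarz_ineq2)
    then have 3: "\<bar>g \<bullet> d\<bar> \<le> K * norm d" using assms unfolding taylor2_def 
      by (meson mult_right_mono norm_ge_zero order_trans)
    have "\<bar>d \<bullet> X d\<bar> \<le> norm d * norm (X d)" by (rule Cauchy_Schwarz_ineq2)
    also have "\<dots> \<le> 1 * (K * norm d)" using assms d unfolding taylor2_def by (intro mult_mono) auto
    finally show ?thesis using 1 2 3 by linarith
  qed
  show ?thesis unfolding isCont_iff LIM_def
  proof (intro allI impI)
    fix r :: real assume r: "0 < r"
    show "\<exists>s>0. \<forall>x. x \<noteq> 0 \<and> dist x 0 < s \<longrightarrow> dist (f (h + x)) (f h) < r"
    proof (intro exI[of _ "min 1 (r / (3 * K + 1))"] conjI allI impI)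
      show "0 < min 1 (r / (3 * K + 1))" using r K by simp
      fix x :: 'a assume x: "x \<noteq> 0 \<and> dist x 0 < min 1 (r / (3 * K + 1))"
      then have "\<bar>f (h + x) - f h\<bar> \<le> 3 * K * norm x" using b by simp
      also have "\<dots> \<le> (3 * K + 1) * norm x" by (simp add: mult_right_mono)
      also have "\<dots> < r" using x K r by (simp add: field_simps)
      finally show "dist (f (h + x)) (f h) < r" by (simp add: dist_real_def)
    qed
  qed
qed

text \<open>
  The natural weight \<open>1 + (norm h)\<^sup>2\<close> for functions of quadratic growth grows only by the variance of
  the walk, so error bounds with this weight survive any number of steps of fixed total variance.
\<close>

lemma walk_power_weight:
  fixes e :: "'l::finite \<Rightarrow> 'a::real_inner"
  shows "(walk e ^^ n) (\<lambda>h. K * (1 + (norm h)\<^sup>2)) h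
    = K * (1 + (norm h)\<^sup>2 + real n * ((\<Sum>l\<in>UNIV. (norm (e l))\<^sup>2) / real CARD('l)))"
proof (induction n arbitrary: h)
  case (Suc n)
  define c where "c = (\<Sum>l\<in>UNIV. (norm (e l))\<^sup>2) / real CARD('l)"
  have "(walk e ^^ n) (\<lambda>h. K * (1 + (norm h)\<^sup>2)) = (\<lambda>h. K * ((norm h)\<^sup>2 + (1 + real n * c)))"
    using Suc.IH by (simp add: fun_eq_iff c_def add_ac)
  then have "(walk e ^^ Suc n) (\<lambda>h. K * (1 + (norm h)\<^sup>2)) h = walk e (\<lambda>h. K * ((norm h)\<^sup>2 + (1 + real n * c))) h"
    by simp
  also have "\<dots> = K * ((norm h)\<^sup>2 + c + (1 + real n * c))"
    by (simp only: walk_scale walk_add walk_const walk_norm_sq c_def)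
  also have "\<dots> = K * (1 + (norm h)\<^sup>2 + real (Suc n) * c)" by (simp add: algebra_simps)
  finally show ?case by (simp only: c_def)
qed simp

lemma taylor2_walk_power:
  assumes "\<And>h. \<exists>g X. taylor2 f h g X (K h)"
  shows "\<exists>g X. taylor2 ((walk e ^^ n) f) h g X ((walk e ^^ n) K h)"
  using assms
proof (induction n arbitrary: h)
  case (Suc n) then show ?case using taylor2_walk[of "(walk e ^^ n) f" "(walk e ^^ n) K" e h] by auto
qed simp

lemma walk_power_abs_le:
  assumes "\<And>h. \<bar>f h\<bar> \<le> K h"
  shows "\<bar>(walk e ^^ n) f h\<bar> \<le> (walk e ^^ n) K h"
  using assms
proof (induction n arbitrary: h)
  case (Suc n)
  have 1: "\<bar>(walk e ^^ n) f h\<bar> \<le> (walk e ^^ n) K h" for h using Suc by blast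
  have "walk e ((walk e ^^ n) f) h \<le> walk e ((walk e ^^ n) K) h"
    using 1 by (intro walk_mono) (auto simp: abs_le_iff)
  moreover have "walk e (\<lambda>h. (-1) * (walk e ^^ n) f h) h \<le> walk e ((walk e ^^ n) K) h"
    using 1 by (intro walk_mono) (auto simp: abs_le_iff)
  ultimately show ?case unfolding walk_scale by (simp add: abs_le_iff)
qed simp

lemma walk_power_semiconvex:
  fixes e :: "'l::finite \<Rightarrow> 'a::real_inner"
  assumes "\<And>z h. - B * (norm z)\<^sup>2 \<le> second_difference z f h"
  shows "- B * (norm z)\<^sup>2 \<le> second_difference z ((walk e ^^ n) f) h"
  using assms
proof (induction n arbitrary: h)
  case (Suc n)
  have "walk e (\<lambda>h. - B * (norm z)\<^sup>2) h \<le> walk e (second_difference z ((walk e ^^ n) f)) h"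
    using Suc by (intro walk_mono) auto
  then show ?case by (simp add: second_difference_walk)
qed simp

lemma walk_power_ge_self:
  fixes e :: "'l::finite \<Rightarrow> 'a::real_inner"
  assumes "\<And>z h. - B * (norm z)\<^sup>2 \<le> second_difference z f h"
  shows "f h - real n * (B * (\<Sum>l\<in>UNIV. (norm (e l))\<^sup>2) / (2 * real CARD('l))) \<le> (walk e ^^ n) f h"
proof (induction n arbitrary: h)
  case (Suc n)
  have "- B * (\<Sum>l\<in>UNIV. (norm (e l))\<^sup>2) \<le> (\<Sum>l\<in>UNIV. second_difference (e l) ((walk e ^^ n) f) h)"
    unfolding sum_distrib_left by (intro sum_mono walk_power_semiconvex assms)
  then have "- B * (\<Sum>l\<in>UNIV. (norm (e l))\<^sup>2) / (2 * real CARD('l)) \<le> (walk e ^^ Suc n) f h - (walk e ^^ n) f h"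
    unfolding funpow.simps comp_def walk_minus_self by (rule divide_right_mono) simp
  with Suc.IH[of h] show ?case by (simp add: algebra_simps add_divide_distrib)
qed simp

lemma abs_average_le:
  fixes x :: "'l::finite \<Rightarrow> real"
  assumes "\<And>l. \<bar>x l\<bar> \<le> S"
  shows "\<bar>(\<Sum>l\<in>UNIV. x l) / (2 * real CARD('l))\<bar> \<le> S / 2"
proof -
  have "\<bar>\<Sum>l\<in>UNIV. x l\<bar> \<le> (\<Sum>l\<in>(UNIV::'l set). S)"
    using assms by (intro order_trans[OF sum_abs] sum_mono) auto
  then have "\<bar>\<Sum>l\<in>UNIV. x l\<bar> / (2 * real CARD('l)) \<le> real CARD('l) * S / (2 * real CARD('l))"
    by (intro divide_right_mono) auto
  then show ?thesis by simp
qed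

text \<open>
  The increments of two consecutive steps agree up to third order. A touching argument yields the
  second derivative of the later function of the sequence \<open>f, walk e f, \<dots>\<close> only; because of this
  lemma it determines the preceding increment (\<open>walk_increment_ge\<close>).
\<close>

lemma walk_walk_remainder:
  fixes e :: "'l::finite \<Rightarrow> 'a::real_inner"
  assumes T: "taylor2 f h g X K" and E: "\<And>l. norm (e l) \<le> E" "2 * E \<le> 1"
  shows "\<bar>(walk e (walk e f) h - walk e f h) - (walk e f h - f h)\<bar> \<le> 32 * K * E ^ 3"
proof -
  let ?m = "2 * real CARD('l)"
  have K: "0 \<le> K" using T norm_ge_zero order_trans unfolding taylor2_def by blast
  have "\<bar>second_difference (e l) (second_difference (e l') f) h\<bar> \<le> 128 * K * E ^ 3" for l l'
  proof -
    have "norm (e l) + norm (e l') \<le> 2 * E" using E(1)[of l] E(1)[of l'] by simp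
    then have "(norm (e l) + norm (e l')) ^ 3 \<le> (2 * E) ^ 3" "norm (e l) + norm (e l') \<le> 1"
      using E(2) by (blast intro: power_mono add_nonneg_nonneg norm_ge_zero, linarith)
    then show ?thesis using second_difference_second_difference_taylor2[OF T, of "e l" "e l'"] K
        mult_left_mono[of "(norm (e l) + norm (e l')) ^ 3" "(2 * E) ^ 3" "16 * K"] by simp
  qed
  then have 1: "\<bar>(\<Sum>l'\<in>UNIV. second_difference (e l) (second_difference (e l') f) h) / ?m\<bar> \<le> (128 * K * E ^ 3) / 2" for l
    by (intro abs_average_le)
  have eq: "second_difference (e l) (walk e f) h - second_difference (e l) f h
     = (\<Sum>l'\<in>UNIV. second_difference (e l) (second_difference (e l') f) h) / ?m" for l
  proof -
    have "(\<Sum>l'\<in>UNIV. second_difference (e l) (second_difference (e l') f) h) / ?m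
      = (walk e f (h + e l) - f (h + e l)) + (walk e f (h - e l) - f (h - e l)) - 2 * (walk e f h - f h)"
      unfolding walk_minus_self second_difference_def[of "e l" "second_difference (e l') f" for l']
      by (simp add: sum.distrib sum_subtractf add_divide_distrib diff_divide_distrib flip: sum_distrib_left)
    then show ?thesis by (simp add: second_difference_def)
  qed
  have "(walk e (walk e f) h - walk e f h) - (walk e f h - f h)
     = (\<Sum>l\<in>UNIV. second_difference (e l) (walk e f) h - second_difference (e l) f h) / ?m"
    unfolding walk_minus_self by (simp add: sum_subtractf diff_divide_distrib)
  also have "\<bar>\<dots>\<bar> \<le> ((128 * K * E ^ 3) / 2) / 2"
    unfolding eq by (rule abs_average_le) (rule 1)
  finally show ?thesis by simp
qed

lemma walk_increment_ge:
  fixes e :: "'l::finite \<Rightarrow> 'a::real_inner"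
  assumes T: "taylor2 f h g' X' K" and T': "taylor2 (walk e f) h g X K" 
    and E: "\<And>l. norm (e l) \<le> E" "2 * E \<le> 1"
  shows "(\<Sum>l\<in>UNIV. e l \<bullet> X (e l)) / (2 * real CARD('l)) - 33 * K * E ^ 3 \<le> walk e f h - f h"
proof -
  let ?m = "2 * real CARD('l)"
  have K: "0 \<le> K" using T norm_ge_zero order_trans unfolding taylor2_def by blast
  have E0: "0 \<le> E" using E(1) norm_ge_zero order_trans by blast
  have "\<bar>second_difference (e l) (walk e f) h - e l \<bullet> X (e l)\<bar> \<le> 2 * K * E ^ 3" for l
  proof -
    have "norm (e l) ^ 3 \<le> E ^ 3" using E(1) by (intro power_mono) auto
    then show ?thesis using second_difference_taylor2[OF T', of "e l"] E(1)[of l] E(2) K E0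
        mult_left_mono[of "norm (e l) ^ 3" "E ^ 3" "2 * K"] by simp
  qed
  then have "\<bar>(\<Sum>l\<in>UNIV. second_difference (e l) (walk e f) h - e l \<bullet> X (e l)) / ?m\<bar> \<le> (2 * K * E ^ 3) / 2"
    by (intro abs_average_le)
  then have "\<bar>(walk e (walk e f) h - walk e f h) - (\<Sum>l\<in>UNIV. e l \<bullet> X (e l)) / ?m\<bar> \<le> (2 * K * E ^ 3) / 2"
    unfolding walk_minus_self by (simp add: sum_subtractf diff_divide_distrib)
  with walk_walk_remainder[where e=e and E=E, OF T E(1) E(2)] show ?thesis by linarith
qed

section \<open>Viscosity subsolutions lie below their means along random walks\<close>

text \<open>
  The viscosity form of the inequality \<open>(\<Sum>l. a l \<bullet> D\<^sup>2u (a l)) \<ge> \<alpha>\<close> on \<open>D\<close>, tested only with touching functions whose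
  data are bounded by \<open>M\<close>. Because of this bound the blow-up of a function around a point inherits the inequality
  from the limiting superjets of the function at that point (\<open>blow_up_superjets_bound\<close>).
\<close>

definition superjets_bound ::
  "('l::finite \<Rightarrow> 'a::real_inner) \<Rightarrow> 'a set \<Rightarrow> ('a \<Rightarrow> real) \<Rightarrow> real \<Rightarrow> real \<Rightarrow> bool"
  where "superjets_bound a D u M \<alpha> \<longleftrightarrow>
    (\<forall>h\<in>D. \<forall>p X. norm h \<le> M \<longrightarrow> \<bar>u h\<bar> \<le> M \<longrightarrow> norm p \<le> M \<longrightarrow> symmetric_op X \<longrightarrow>
      (\<forall>d. norm (X d) \<le> M * norm d) \<longrightarrow>
      (\<forall>d. norm d \<le> 1 \<longrightarrow> h + d \<in> D \<longrightarrow> u (h + d) \<le> u h + p \<bullet> d + (d \<bullet> X d) / 2 + M * norm d ^ 3) \<longrightarrow>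
      \<alpha> \<le> (\<Sum>l\<in>UNIV. a l \<bullet> X (a l)))"

text \<open>
  A viscosity subsolution of the constant coefficient equation \<open>(\<Sum>l. a l \<bullet> D\<^sup>2u (a l)) = \<alpha>\<close> lies below
  its mean along the random walk with steps \<open>\<plusminus> \<rho> *\<^sub>R a l\<close> minus \<open>\<alpha> / 2\<close>; here the mean is taken of a smooth
  function \<open>G \<ge> u - \<epsilon>\<close>. With \<open>W n\<close> the mean of \<open>G\<close> after \<open>n\<close> steps of length \<open>\<rho>\<close>, the inequality
  \<open>u \<le> W n + \<theta>n n * (norm h)\<^sup>2 + c n\<close> is propagated from \<open>n\<close> to \<open>n + 1\<close>. The right-hand side for
  \<open>n + 1\<close> touches \<open>u\<close>, up to a constant, at a maximum point of the difference. There the hypothesis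
  bounds the second derivative of \<open>W (n + 1)\<close> from below, hence also the increment of \<open>W\<close>. The
  coefficient of the quadratic penalty increases in every step in order to absorb the third order error,
  which has quadratic growth; since \<open>N * \<rho>\<^sup>2\<close> is fixed, the errors add up to a multiple of \<open>\<rho>\<close>.
  No constant depends on \<open>G\<close>, \<open>D\<close>, \<open>u\<close> or \<open>\<alpha>\<close>.
\<close>

lemma walk_comparison:
  fixes a :: "'l::finite \<Rightarrow> 'a::euclidean_space" and G u :: "'a \<Rightarrow> real"
  assumes K: "0 \<le> K" and B: "0 \<le> B" and \<theta>: "0 < \<theta>" and \<epsilon>: "0 \<le> \<epsilon>" and \<rho>: "0 \<le> \<rho>" and N: "real N * \<rho>\<^sup>2 = real CARD('l)"
    and A: "\<And>l. norm (a l) \<le> A" "2 * (\<rho> * A) \<le> 1"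
    and s_def: "s = (\<Sum>l\<in>UNIV. (norm (a l))\<^sup>2)" and L_def: "L = 33 * (K * (1 + s)) * A ^ 3"
    and R_def: "R = (s * B / 2 + \<epsilon> + K * (1 + s)) / \<theta>"
    and \<theta>'_def: "\<theta>' = \<theta> + L * real CARD('l) * \<rho>"
    and M_def: "M = 1 + R + 2 * (K * (1 + s)) * (1 + R) + \<epsilon> + 2 * \<theta>' * (1 + R)"
    and G: "\<And>h. \<exists>g X. taylor2 G h g X (K * (1 + (norm h)\<^sup>2))"
      "\<And>h. \<bar>G h\<bar> \<le> K * (1 + (norm h)\<^sup>2)"
      "\<And>z h. - B * (norm z)\<^sup>2 \<le> second_difference z G h"
    and D: "closed D" "0 \<in> D" and u: "usc_on D u" "u 0 = 0" "\<And>h. h \<in> D \<Longrightarrow> u h \<le> G h + \<epsilon>"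
    and jets: "superjets_bound a D u M \<alpha>"
  shows "\<alpha> / 2 \<le> (walk (\<lambda>l. \<rho> *\<^sub>R a l) ^^ N) G 0 + \<epsilon> + \<theta>' * s + L * real CARD('l) * \<rho>"
proof -
  define m where "m = real CARD('l)"
  define e where "e = (\<lambda>l. \<rho> *\<^sub>R a l)"
  define W where "W n = (walk e ^^ n) G" for n
  define Ks where "Ks = K * (1 + s)"
  have m0: "0 < m" by (simp add: m_def)
  have s0: "0 \<le> s" unfolding s_def by (intro sum_nonneg) auto
  have A0: "0 \<le> A" using A(1) norm_ge_zero order_trans by blast
  have Ks0: "0 \<le> Ks" using K s0 by (simp add: Ks_def)
  have L0: "0 \<le> L" using K s0 A0 by (simp add: L_def)
  have sume: "(\<Sum>l\<in>UNIV. (norm (e l))\<^sup>2) = \<rho>\<^sup>2 * s"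
    by (simp add: e_def s_def power_mult_distrib sum_distrib_left)
  have n\<rho>: "real n * \<rho>\<^sup>2 / m \<le> 1" if "n \<le> N" for n
  proof -
    have "real n * \<rho>\<^sup>2 \<le> real N * \<rho>\<^sup>2" using that by (intro mult_right_mono) auto
    then show ?thesis using m0 N by (simp add: m_def)
  qed
  have weight: "(walk e ^^ n) (\<lambda>h. K * (1 + (norm h)\<^sup>2)) h \<le> Ks * (1 + (norm h)\<^sup>2)" if "n \<le> N" for n h
  proof -
    have "real n * (\<rho>\<^sup>2 * s / m) = (real n * \<rho>\<^sup>2 / m) * s" by simp
    also have "\<dots> \<le> 1 * s" using n\<rho>[OF that] s0 by (rule mult_right_mono)
    also have "\<dots> \<le> s * (1 + (norm h)\<^sup>2)" using s0 by (simp add: algebra_simps)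
    finally have "1 + (norm h)\<^sup>2 + real n * (\<rho>\<^sup>2 * s / m) \<le> (1 + s) * (1 + (norm h)\<^sup>2)"
      by (simp add: algebra_simps)
    then show ?thesis unfolding walk_power_weight sume Ks_def using K m_def
      by (metis mult.assoc mult_left_mono)
  qed
  have TW: "\<exists>g X. taylor2 (W n) h g X (Ks * (1 + (norm h)\<^sup>2))" if "n \<le> N" for n h
    using taylor2_walk_power[where f=G and K="\<lambda>h. K * (1 + (norm h)\<^sup>2)" and e=e and n=n and h=h, OF G(1)] weight[OF that, of h] taylor2_mono
    unfolding W_def by blast
  have absW: "\<bar>W n h\<bar> \<le> Ks * (1 + (norm h)\<^sup>2)" if "n \<le> N" for n h
    using walk_power_abs_le[where f=G and K="\<lambda>h. K * (1 + (norm h)\<^sup>2)" and e=e and n=n and h=h, OF G(2)] weight[OF that, of h]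
    unfolding W_def by linarith
  have contW: "continuous_on UNIV (W n)" if "n \<le> N" for n
    using TW[OF that] taylor2_isCont by (metis continuous_at_imp_continuous_on)
  have W_ge: "G h - s * B / 2 \<le> W n h" if "n \<le> N" for n h
  proof -
    have "real n * (B * (\<Sum>l\<in>UNIV. (norm (e l))\<^sup>2) / (2 * real CARD('l))) = (real n * \<rho>\<^sup>2 / m) * (s * B / 2)"
      unfolding sume by (simp add: m_def mult_ac)
    also have "\<dots> \<le> 1 * (s * B / 2)" using n\<rho>[OF that] s0 B by (intro mult_right_mono) auto
    finally show ?thesis using walk_power_ge_self[where B=B and f=G and h=h and n=n and e=e, OF G(3)] unfolding W_def by linarith
  qed
  have nm: "real n * \<rho>^3 \<le> m * \<rho>" if "n \<le> N" for n
  proof -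
    have "real n * \<rho>^3 = (real n * \<rho>\<^sup>2) * \<rho>" by (simp add: power3_eq_cube power2_eq_square)
    also have "\<dots> \<le> m * \<rho>" using n\<rho>[OF that] m0 \<rho> by (intro mult_right_mono) (auto simp: field_simps)
    finally show ?thesis .
  qed
  define \<theta>n where "\<theta>n n = \<theta> + real n * \<rho>^3 * L" for n
  have \<theta>n: "\<theta> \<le> \<theta>n n" "\<theta>n n \<le> \<theta>'" if "n \<le> N" for n
    using L0 \<rho> mult_right_mono[OF nm[OF that] L0] by (auto simp: \<theta>n_def \<theta>'_def m_def mult_ac)
  define c where "c n = \<epsilon> - real n * (\<rho>\<^sup>2 / (2 * m)) * (\<alpha> - 2 * \<theta>' * s) + real n * \<rho>^3 * L" for n
  have main: "\<forall>h\<in>D. u h \<le> W n h + \<theta>n n * (norm h)\<^sup>2 + c n" if "n \<le> N" for n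
    using that
  proof (induction n)
    case 0
    show ?case
    proof
      fix h assume "h \<in> D"
      then have "u h \<le> G h + \<epsilon>" by (rule u)
      also have "\<dots> \<le> G h + \<theta> * (norm h)\<^sup>2 + \<epsilon>" using \<theta> by simp
      finally show "u h \<le> W 0 h + \<theta>n 0 * (norm h)\<^sup>2 + c 0" by (simp add: W_def \<theta>n_def c_def)
    qed
  next
    case (Suc n)
    define F where "F h = u h - (W (Suc n) h + \<theta>n (Suc n) * (norm h)\<^sup>2)" for h
    have th: "\<theta> \<le> \<theta>n (Suc n)" "\<theta>n (Suc n) \<le> \<theta>'" using \<theta>n Suc.prems by auto
    have th0: "0 \<le> \<theta>n (Suc n)" using th \<theta> by linarith
    have R0: "0 \<le> R" unfolding R_def using s0 B \<epsilon> Ks0 \<theta> by (auto simp: Ks_def intro!: divide_nonneg_nonneg add_nonneg_nonneg)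
    have F0: "- Ks \<le> F 0" using absW[OF Suc.prems, of 0] u(2) by (simp add: F_def)
    have loc: "(norm h)\<^sup>2 \<le> R" if "h \<in> D" "F 0 \<le> F h" for h
    proof -
      have "u h \<le> W (Suc n) h + s * B / 2 + \<epsilon>" using u(3)[OF that(1)] W_ge[OF Suc.prems, of h] by linarith
      then have "\<theta>n (Suc n) * (norm h)\<^sup>2 \<le> s * B / 2 + \<epsilon> + Ks" using F0 that(2) by (simp add: F_def)
      moreover have "\<theta> * (norm h)\<^sup>2 \<le> \<theta>n (Suc n) * (norm h)\<^sup>2" using th by (intro mult_right_mono) auto
      ultimately have "\<theta> * (norm h)\<^sup>2 \<le> s * B / 2 + \<epsilon> + Ks" by linarith
      then show ?thesis using \<theta> by (simp add: R_def Ks_def field_simps)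
    qed
    define C where "C = D \<inter> cball 0 (sqrt R)"
    have "compact C" unfolding C_def using D(1) by (simp add: closed_Int_compact)
    moreover have "C \<noteq> {}" using D(2) R0 by (auto simp: C_def)
    moreover have "usc_on C F" unfolding F_def
    proof (rule usc_on_diff_continuous)
      show "usc_on C u" using u(1) by (rule usc_on_subset) (auto simp: C_def)
      show "continuous_on C (\<lambda>h. W (Suc n) h + \<theta>n (Suc n) * (norm h)\<^sup>2)"
        by (intro continuous_intros continuous_on_subset[OF contW[OF Suc.prems]]) auto
    qed
    ultimately have "\<exists>h\<in>C. \<forall>y\<in>C. F y \<le> F h" by (rule usc_on_attains_max)
    then obtain h where h: "h \<in> C" "\<And>y. y \<in> C \<Longrightarrow> F y \<le> F h" by auto
    have hD: "h \<in> D" using h by (simp add: C_def)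
    have max: "F y \<le> F h" if "y \<in> D" for y
    proof (cases "y \<in> C")
      case False
      then have "\<not> (norm y)\<^sup>2 \<le> R" using that R0 by (auto simp: C_def real_le_rsqrt)
      then have "F y \<le> F 0" using loc[OF that] by linarith
      also have "F 0 \<le> F h" using h(2)[of 0] D R0 by (simp add: C_def)
      finally show ?thesis .
    qed (use h in auto)
    have hR: "(norm h)\<^sup>2 \<le> R" using loc[OF hD max[OF D(2)]] .
    have hR': "norm h \<le> 1 + R"
    proof -
      have "0 \<le> (norm h - 1)\<^sup>2" by simp
      then have "2 * norm h \<le> 1 + (norm h)\<^sup>2" by (simp add: power2_diff)
      moreover have "0 \<le> norm h" by simp
      ultimately show ?thesis using hR R0 by linarith
    qed
    define \<omega> where "\<omega> = Ks * (1 + (norm h)\<^sup>2)"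
    have \<omega>: "0 \<le> \<omega>" "\<omega> \<le> Ks * (1 + R)" using Ks0 hR by (auto simp: \<omega>_def intro!: mult_left_mono)
    obtain g X where T: "taylor2 (W (Suc n)) h g X \<omega>" using TW[OF Suc.prems] \<omega>_def by blast
    obtain g' X' where T': "taylor2 (W n) h g' X' \<omega>" using TW[of n] Suc.prems \<omega>_def by (metis Suc_leD)
    let ?X = "\<lambda>d. X d + (2 * \<theta>n (Suc n)) *\<^sub>R d"
    let ?p = "g + (2 * \<theta>n (Suc n)) *\<^sub>R h"
    have t': "0 \<le> \<theta>'" using th0 th by linarith
    have M1: "1 + R \<le> M" "\<omega> + 2 * \<theta>' * (1 + R) \<le> M" "2 * (Ks * (1 + R)) + \<epsilon> \<le> M" "\<omega> + 2 * \<theta>' \<le> M" "\<omega> \<le> M"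
    proof -
      have "M = 1 + R + 2 * (Ks * (1 + R)) + \<epsilon> + 2 * (\<theta>' * (1 + R))" by (simp add: M_def Ks_def mult.assoc)
      moreover have "\<theta>' \<le> \<theta>' * (1 + R)" "0 \<le> Ks * (1 + R)" using t' Ks0 R0 by (auto simp: distrib_left)
      ultimately show "1 + R \<le> M" "\<omega> + 2 * \<theta>' * (1 + R) \<le> M" "2 * (Ks * (1 + R)) + \<epsilon> \<le> M" "\<omega> + 2 * \<theta>' \<le> M" "\<omega> \<le> M"
        using R0 \<epsilon> t' \<omega> unfolding mult.assoc by linarith+
    qed
    have "\<alpha> \<le> (\<Sum>l\<in>UNIV. a l \<bullet> ?X (a l))"
    proof (rule jets[unfolded superjets_bound_def, rule_format, OF hD])
      show "norm h \<le> M" using hR' M1 by linarith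
      have "u h \<le> K * (1 + (norm h)\<^sup>2) + \<epsilon>" using u(3)[OF hD] G(2)[of h] by linarith
      also have "K * (1 + (norm h)\<^sup>2) \<le> \<omega>" unfolding \<omega>_def Ks_def using K s0 
        by (intro mult_right_mono) (auto simp: algebra_simps)
      finally have 1: "u h \<le> \<omega> + \<epsilon>" by simp
      have "- Ks \<le> F h" using F0 max[OF D(2)] by linarith
      then have "- Ks + W (Suc n) h \<le> u h" using th0 by (simp add: F_def) (smt (verit) mult_nonneg_nonneg zero_le_power2)
      then have 2: "- Ks - \<omega> \<le> u h" using absW[OF Suc.prems, of h] by (simp add: \<omega>_def)
      have 3: "Ks \<le> Ks * (1 + R)" using Ks0 R0 by (simp add: algebra_simps)
      show "\<bar>u h\<bar> \<le> M" using 1 2 3 \<omega> M1(3) \<epsilon> by linarith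
      have "norm ?p \<le> norm g + 2 * \<theta>n (Suc n) * norm h" using th0 by (intro norm_triangle_le) simp
      also have "\<dots> \<le> \<omega> + 2 * \<theta>' * (1 + R)" using T th th0 hR' R0 t' unfolding taylor2_def
        by (intro add_mono mult_mono) auto
      finally show "norm ?p \<le> M" using M1 by linarith
      show "symmetric_op ?X" using T unfolding taylor2_def by (intro symmetric_op_add symmetric_op_scale symmetric_op_id) auto
      fix d
      have "norm (?X d) \<le> norm (X d) + 2 * \<theta>n (Suc n) * norm d" using th0 by (intro norm_triangle_le) simp
      also have "\<dots> \<le> \<omega> * norm d + 2 * \<theta>' * norm d" using T th unfolding taylor2_def
        by (intro add_mono mult_right_mono) auto
      also have "\<dots> \<le> M * norm d" using mult_right_mono[OF M1(4), of "norm d"] by (simp add: algebra_simps)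
      finally show "norm (?X d) \<le> M * norm d" .
      assume d: "norm d \<le> 1" and hd: "h + d \<in> D"
      have eq: "(norm (h + d))\<^sup>2 = (norm h)\<^sup>2 + 2 * (h \<bullet> d) + (norm d)\<^sup>2"
        by (simp add: power2_norm_eq_inner inner_add_left inner_add_right inner_commute)
      define \<theta>1 where "\<theta>1 = \<theta>n (Suc n)"
      have eq3: "?p \<bullet> d = g \<bullet> d + 2 * (\<theta>1 * (h \<bullet> d))" by (simp add: inner_add_left \<theta>1_def)
      have eq4: "d \<bullet> ?X d = d \<bullet> X d + 2 * (\<theta>1 * (norm d)\<^sup>2)" by (simp add: inner_add_right \<theta>1_def power2_norm_eq_inner)
      have eq5: "\<theta>n (Suc n) * (norm (h + d))\<^sup>2 = \<theta>n (Suc n) * (norm h)\<^sup>2 + 2 * (\<theta>1 * (h \<bullet> d)) + \<theta>1 * (norm d)\<^sup>2"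
        unfolding eq by (simp add: \<theta>1_def algebra_simps)
      have "W (Suc n) (h + d) \<le> W (Suc n) h + g \<bullet> d + (d \<bullet> X d) / 2 + \<omega> * norm d ^ 3"
        using T d unfolding taylor2_def by (smt (verit))
      moreover have "\<omega> * norm d ^ 3 \<le> M * norm d ^ 3" using M1 by (intro mult_right_mono) auto
      moreover have "u (h + d) - (W (Suc n) (h + d) + \<theta>n (Suc n) * (norm (h + d))\<^sup>2) \<le> u h - (W (Suc n) h + \<theta>n (Suc n) * (norm h)\<^sup>2)"
        using max[OF hd] by (simp add: F_def)
      ultimately show "u (h + d) \<le> u h + ?p \<bullet> d + (d \<bullet> ?X d) / 2 + M * norm d ^ 3"
        unfolding eq5 eq3 eq4 add_divide_distrib by simp
    qed
    also have "(\<Sum>l\<in>UNIV. a l \<bullet> ?X (a l)) = (\<Sum>l\<in>UNIV. a l \<bullet> X (a l)) + 2 * \<theta>n (Suc n) * s"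
      by (simp add: s_def inner_add_right sum.distrib sum_distrib_left power2_norm_eq_inner)
    also have "\<dots> \<le> (\<Sum>l\<in>UNIV. a l \<bullet> X (a l)) + 2 * \<theta>' * s" using th s0 by (intro add_left_mono mult_right_mono) auto
    finally have \<alpha>: "\<alpha> - 2 * \<theta>' * s \<le> (\<Sum>l\<in>UNIV. a l \<bullet> X (a l))" by simp
    have "(\<Sum>l\<in>UNIV. e l \<bullet> X (e l)) = \<rho>\<^sup>2 * (\<Sum>l\<in>UNIV. a l \<bullet> X (a l))"
      using T by (simp add: e_def taylor2_def symmetric_op_def linear_scale sum_distrib_left power2_eq_square mult.assoc)
    then have "\<rho>\<^sup>2 * (\<alpha> - 2 * \<theta>' * s) / (2 * m) \<le> (\<Sum>l\<in>UNIV. e l \<bullet> X (e l)) / (2 * m)"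
      using \<alpha> m0 by (intro divide_right_mono) (auto intro: mult_left_mono)
    moreover have "(\<Sum>l\<in>UNIV. e l \<bullet> X (e l)) / (2 * m) - 33 * \<omega> * (\<rho> * A) ^ 3 \<le> W (Suc n) h - W n h"
      using walk_increment_ge[OF T', of e g X "\<rho> * A"] T A \<rho> m_def
      by (simp add: W_def e_def mult_left_mono)
    moreover have "33 * \<omega> * (\<rho> * A) ^ 3 = \<rho>^3 * L + \<rho>^3 * L * (norm h)\<^sup>2"
      by (simp add: \<omega>_def L_def Ks_def power_mult_distrib algebra_simps)
    moreover have "u h \<le> W n h + \<theta>n n * (norm h)\<^sup>2 + c n" using Suc hD by auto
    moreover have "\<theta>n (Suc n) * (norm h)\<^sup>2 = \<theta>n n * (norm h)\<^sup>2 + \<rho>^3 * L * (norm h)\<^sup>2" by (simp add: \<theta>n_def algebra_simps)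
    moreover have "c (Suc n) = c n - \<rho>\<^sup>2 * (\<alpha> - 2 * \<theta>' * s) / (2 * m) + \<rho>^3 * L"
      unfolding c_def by (simp add: algebra_simps add_divide_distrib diff_divide_distrib)
    ultimately have "F h \<le> c (Suc n)" unfolding F_def by linarith
    then have "F y \<le> c (Suc n)" if "y \<in> D" for y using max[OF that] by linarith
    then show ?case unfolding F_def by (auto simp: algebra_simps)
  qed
  have "0 \<le> W N 0 + c N" using main[of N] D(2) u(2) by force
  moreover have "real N * (\<rho>\<^sup>2 / (2 * m)) = 1 / 2" using N m0 by (simp add: m_def)
  then have "c N = \<epsilon> - (1 / 2) * (\<alpha> - 2 * \<theta>' * s) + real N * \<rho>^3 * L" by (simp only: c_def)
  moreover have "real N * \<rho>^3 * L \<le> L * m * \<rho>" using mult_right_mono[OF nm[of N] L0] by (simp add: mult_ac)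
  ultimately have "0 \<le> W N 0 + \<epsilon> - (\<alpha> - 2 * \<theta>' * s) / 2 + L * m * \<rho>" by linarith
  then show ?thesis by (simp add: W_def e_def m_def field_simps)
qed

section \<open>Sup-convolution\<close>

definition sup_convolution :: "real \<Rightarrow> 'a set \<Rightarrow> ('a::real_inner \<Rightarrow> real) \<Rightarrow> 'a \<Rightarrow> real"
  where "sup_convolution \<delta> D u h = (SUP y\<in>D. u y - (norm (h - y))\<^sup>2 / (2 * \<delta>))"

lemma norm_sq_add_le: "(norm (x + y))\<^sup>2 \<le> 2 * (norm x)\<^sup>2 + 2 * (norm (y::'a::real_inner))\<^sup>2"
proof -
  have "0 \<le> (norm (x - y))\<^sup>2" by simp
  then show ?thesis by (simp add: power2_norm_eq_inner inner_add_left inner_add_right inner_diff_left inner_diff_right inner_commute)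
qed

lemma norm_sq_add_weighted:
  fixes x y :: "'a::real_inner"
  assumes "0 < \<tau>"
  shows "(norm (x + y))\<^sup>2 \<le> (1 + \<tau>) * (norm x)\<^sup>2 + (1 + 1 / \<tau>) * (norm y)\<^sup>2"
proof -
  have "0 \<le> (norm (\<tau> *\<^sub>R x - y))\<^sup>2 / \<tau>" using assms by simp
  also have "(norm (\<tau> *\<^sub>R x - y))\<^sup>2 / \<tau> = \<tau> * (norm x)\<^sup>2 - 2 * (x \<bullet> y) + (norm y)\<^sup>2 / \<tau>"
  proof -
    have "(norm (\<tau> *\<^sub>R x - y))\<^sup>2 = \<tau> * \<tau> * (norm x)\<^sup>2 - 2 * \<tau> * (x \<bullet> y) + (norm y)\<^sup>2"
      by (simp add: power2_norm_eq_inner inner_diff_left inner_diff_right inner_commute)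
    then show ?thesis using assms by (simp add: field_simps)
  qed
  finally show ?thesis
    by (simp add: power2_norm_eq_inner inner_add_left inner_add_right inner_commute algebra_simps)
qed

lemma sup_convolution_term_le:
  fixes u :: "'a::real_inner \<Rightarrow> real"
  assumes C: "0 \<le> C" and \<delta>: "0 < \<delta>" "4 * C * \<delta> \<le> 1" and u: "\<And>y. y \<in> D \<Longrightarrow> u y \<le> C * (norm y)\<^sup>2"
    and y: "y \<in> D"
  shows "u y - (norm (h - y))\<^sup>2 / (2 * \<delta>) \<le> 2 * C * (norm h)\<^sup>2"
proof -
  have "u y \<le> C * (norm (h + (y - h)))\<^sup>2" using u[OF y] by simp
  also have "\<dots> \<le> C * (2 * (norm h)\<^sup>2 + 2 * (norm (y - h))\<^sup>2)" by (rule mult_left_mono[OF norm_sq_add_le C])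
  also have "\<dots> = 2 * C * (norm h)\<^sup>2 + (2 * C) * (norm (h - y))\<^sup>2" by (simp add: algebra_simps norm_minus_commute)
  also have "\<dots> \<le> 2 * C * (norm h)\<^sup>2 + (1 / (2 * \<delta>)) * (norm (h - y))\<^sup>2"
    using \<delta> by (intro add_left_mono mult_right_mono) (auto simp: field_simps)
  finally show ?thesis by simp
qed

lemma sup_convolution_bdd:
  fixes u :: "'a::real_inner \<Rightarrow> real"
  assumes C: "0 \<le> C" and \<delta>: "0 < \<delta>" "4 * C * \<delta> \<le> 1" and u: "\<And>y. y \<in> D \<Longrightarrow> u y \<le> C * (norm y)\<^sup>2"
  shows "bdd_above ((\<lambda>y. u y - (norm (h - y))\<^sup>2 / (2 * \<delta>)) ` D)"
  using sup_convolution_term_le[OF assms] by (intro bdd_aboveI2) blast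

lemma sup_convolution_upper:
  assumes "0 \<le> C" "0 < \<delta>" "4 * C * \<delta> \<le> 1" "\<And>y. y \<in> D \<Longrightarrow> u y \<le> C * (norm y)\<^sup>2" "y \<in> D"
  shows "u y - (norm (h - y))\<^sup>2 / (2 * \<delta>) \<le> sup_convolution \<delta> D u h"
  unfolding sup_convolution_def using sup_convolution_bdd[OF assms(1-4)] assms(5) by (intro cSUP_upper) auto

lemma sup_convolution_ge_self:
  assumes "0 \<le> C" "0 < \<delta>" "4 * C * \<delta> \<le> 1" "\<And>y. y \<in> D \<Longrightarrow> u y \<le> C * (norm y)\<^sup>2" "y \<in> D"
  shows "u y \<le> sup_convolution \<delta> D u y"
  using sup_convolution_upper[OF assms, of y] by simp

lemma sup_convolution_abs_le:
  assumes C: "0 \<le> C" and \<delta>: "0 < \<delta>" "4 * C * \<delta> \<le> 1" and u: "\<And>y. y \<in> D \<Longrightarrow> u y \<le> C * (norm y)\<^sup>2"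
    and 0: "0 \<in> D" "u 0 = 0"
  shows "\<bar>sup_convolution \<delta> D u h\<bar> \<le> (2 * C + 1 / (2 * \<delta>)) * (norm h)\<^sup>2"
proof -
  have "- (norm h)\<^sup>2 / (2 * \<delta>) \<le> sup_convolution \<delta> D u h"
    using sup_convolution_upper[OF C \<delta> u 0(1), of h] 0 by simp
  moreover have "sup_convolution \<delta> D u h \<le> 2 * C * (norm h)\<^sup>2"
    unfolding sup_convolution_def using 0 sup_convolution_term_le[OF C \<delta> u] by (intro cSUP_least) auto
  moreover have "0 \<le> 2 * C * (norm h)\<^sup>2" "0 \<le> (norm h)\<^sup>2 / (2 * \<delta>)" using C \<delta> by auto
  moreover have "(2 * C + 1 / (2 * \<delta>)) * (norm h)\<^sup>2 = 2 * C * (norm h)\<^sup>2 + (norm h)\<^sup>2 / (2 * \<delta>)"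
    by (simp add: distrib_right)
  ultimately show ?thesis unfolding abs_le_iff by linarith
qed

lemma sup_convolution_semiconvex:
  assumes C: "0 \<le> C" and \<delta>: "0 < \<delta>" "4 * C * \<delta> \<le> 1" and u: "\<And>y. y \<in> D \<Longrightarrow> u y \<le> C * (norm y)\<^sup>2"
    and D: "D \<noteq> {}"
  shows "- (1 / \<delta>) * (norm z)\<^sup>2 \<le> second_difference z (sup_convolution \<delta> D u) h"
proof -
  let ?U = "sup_convolution \<delta> D u"
  have "?U h \<le> (?U (h + z) + ?U (h - z) + (norm z)\<^sup>2 / \<delta>) / 2"
    unfolding sup_convolution_def[of \<delta> D u h]
  proof (rule cSUP_least[OF D])
    fix y assume y: "y \<in> D"
    have "u y - (norm (h + z - y))\<^sup>2 / (2 * \<delta>) \<le> ?U (h + z)" "u y - (norm (h - z - y))\<^sup>2 / (2 * \<delta>) \<le> ?U (h - z)"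
      by (intro sup_convolution_upper[OF C \<delta> u y]; simp)+
    moreover have "(norm (h + z - y))\<^sup>2 + (norm (h - z - y))\<^sup>2 = 2 * (norm (h - y))\<^sup>2 + 2 * (norm z)\<^sup>2"
      by (simp add: power2_norm_eq_inner inner_add_left inner_add_right inner_diff_left inner_diff_right inner_commute)
    then have "(norm (h + z - y))\<^sup>2 / (2 * \<delta>) + (norm (h - z - y))\<^sup>2 / (2 * \<delta>) = 2 * ((norm (h - y))\<^sup>2 / (2 * \<delta>)) + (norm z)\<^sup>2 / \<delta>"
      using \<delta> by (simp add: field_simps)
    ultimately show "u y - (norm (h - y))\<^sup>2 / (2 * \<delta>) \<le> (?U (h + z) + ?U (h - z) + (norm z)\<^sup>2 / \<delta>) / 2" by argo
  qed
  then show ?thesis by (simp add: second_difference_def field_simps)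
qed

lemma sup_convolution_continuous:
  fixes u :: "'a::euclidean_space \<Rightarrow> real"
  assumes C: "0 \<le> C" and \<delta>: "0 < \<delta>" "4 * C * \<delta> \<le> 1" and u: "\<And>y. y \<in> D \<Longrightarrow> u y \<le> C * (norm y)\<^sup>2"
    and D: "D \<noteq> {}"
  shows "continuous_on UNIV (sup_convolution \<delta> D u)"
proof -
  let ?U = "sup_convolution \<delta> D u"
  define F where "F h = ?U h + (norm h)\<^sup>2 / (2 * \<delta>)" for h
  have eq: "u y - (norm (h - y))\<^sup>2 / (2 * \<delta>) + (norm h)\<^sup>2 / (2 * \<delta>) = u y - (norm y)\<^sup>2 / (2 * \<delta>) + (h \<bullet> y) / \<delta>" for h y
    using \<delta> by (simp add: power2_norm_eq_inner inner_diff_left inner_diff_right inner_commute field_simps)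
  have up: "u y - (norm y)\<^sup>2 / (2 * \<delta>) + (h \<bullet> y) / \<delta> \<le> F h" if "y \<in> D" for h y
    unfolding F_def eq[symmetric] using sup_convolution_upper[OF C \<delta> u that] by simp
  have "convex_on UNIV F"
  proof (rule convex_onI)
    fix t :: real and x y :: 'a assume t: "0 < t" "t < 1"
    define w where "w = (1 - t) *\<^sub>R x + t *\<^sub>R y"
    have "?U w \<le> (1 - t) * F x + t * F y - (norm w)\<^sup>2 / (2 * \<delta>)"
      unfolding sup_convolution_def[of \<delta> D u w]
    proof (rule cSUP_least[OF D])
      fix z assume z: "z \<in> D"
      have "(1 - t) * (u z - (norm z)\<^sup>2 / (2 * \<delta>) + (x \<bullet> z) / \<delta>) \<le> (1 - t) * F x"
        "t * (u z - (norm z)\<^sup>2 / (2 * \<delta>) + (y \<bullet> z) / \<delta>) \<le> t * F y"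
        using up[OF z] t by (auto intro!: mult_left_mono)
      moreover have "(1 - t) * (u z - (norm z)\<^sup>2 / (2 * \<delta>) + (x \<bullet> z) / \<delta>) + t * (u z - (norm z)\<^sup>2 / (2 * \<delta>) + (y \<bullet> z) / \<delta>)
        = u z - (norm z)\<^sup>2 / (2 * \<delta>) + (w \<bullet> z) / \<delta>"
        by (simp add: w_def inner_add_left algebra_simps add_divide_distrib diff_divide_distrib)
      ultimately show "u z - (norm (w - z))\<^sup>2 / (2 * \<delta>) \<le> (1 - t) * F x + t * F y - (norm w)\<^sup>2 / (2 * \<delta>)"
        using eq[of z w] by linarith
    qed
    then show "F ((1 - t) *\<^sub>R x + t *\<^sub>R y) \<le> (1 - t) * F x + t * F y" by (simp add: F_def w_def)
  qed simp
  then have "continuous_on UNIV F" by (intro convex_on_continuous) auto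
  then have "continuous_on UNIV (\<lambda>h. F h - (norm h)\<^sup>2 / (2 * \<delta>))" by (intro continuous_intros) (use \<delta> in auto)
  then show ?thesis by (simp add: F_def)
qed

text \<open>
  Passing to the sup-convolutions costs only the factor \<open>1 + \<tau>\<close> in a bound by a quadratic form of the
  difference: the effect of moving the two points is paid for by the two quadratic penalties
  if \<open>\<delta>\<close> is small.
\<close>

lemma sup_convolution_coupled:
  fixes A :: "'a::real_inner \<Rightarrow> 'b::real_inner"
  assumes A: "linear A" "\<And>x. norm (A x) \<le> c * norm x" and \<tau>: "0 < \<tau>" and \<delta>: "0 < \<delta>" "2 * (1 + 1 / \<tau>) * c\<^sup>2 * \<delta> \<le> 1"
    and D: "D \<noteq> {}" "D' \<noteq> {}"
    and uv: "\<And>x y. x \<in> D \<Longrightarrow> y \<in> D' \<Longrightarrow> u x + v y \<le> (norm (A (x - y)))\<^sup>2 / 2"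
  shows "sup_convolution \<delta> D u h + sup_convolution \<delta> D' v k \<le> (1 + \<tau>) / 2 * (norm (A (h - k)))\<^sup>2"
proof -
  let ?S = "(1 + \<tau>) / 2 * (norm (A (h - k)))\<^sup>2"
  have key: "(u x - (norm (h - x))\<^sup>2 / (2 * \<delta>)) + (v y - (norm (k - y))\<^sup>2 / (2 * \<delta>)) \<le> ?S"
    if "x \<in> D" "y \<in> D'" for x y
  proof -
    define e where "e = (x - h) + (k - y)"
    have e: "(norm e)\<^sup>2 \<le> 2 * (norm (h - x))\<^sup>2 + 2 * (norm (k - y))\<^sup>2"
      unfolding e_def using norm_sq_add_le[of "x - h" "k - y"] by (simp add: norm_minus_commute)
    have "A (x - y) = A (h - k) + A e"
      unfolding e_def linear_add[OF A(1), symmetric] by (simp add: algebra_simps)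
    then have "(norm (A (x - y)))\<^sup>2 \<le> (1 + \<tau>) * (norm (A (h - k)))\<^sup>2 + (1 + 1 / \<tau>) * (norm (A e))\<^sup>2"
      using norm_sq_add_weighted[OF \<tau>] by metis
    also have "(norm (A e))\<^sup>2 \<le> (c * norm e)\<^sup>2" using A(2) by (intro power_mono) auto
    then have "(1 + 1 / \<tau>) * (norm (A e))\<^sup>2 \<le> (1 + 1 / \<tau>) * (c\<^sup>2 * (norm e)\<^sup>2)"
      using \<tau> by (intro mult_left_mono) (auto simp: power_mult_distrib)
    also have "\<dots> = (2 * (1 + 1 / \<tau>) * c\<^sup>2 * \<delta>) * ((norm e)\<^sup>2 / (2 * \<delta>))" using \<delta> by simp
    also have "\<dots> \<le> 1 * ((norm e)\<^sup>2 / (2 * \<delta>))" using \<delta> by (intro mult_right_mono) auto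
    also have "1 * ((norm e)\<^sup>2 / (2 * \<delta>)) \<le> (2 * (norm (h - x))\<^sup>2 + 2 * (norm (k - y))\<^sup>2) / (2 * \<delta>)"
      using e \<delta> by (auto intro: divide_right_mono)
    also have "\<dots> = 2 * ((norm (h - x))\<^sup>2 / (2 * \<delta>)) + 2 * ((norm (k - y))\<^sup>2 / (2 * \<delta>))" by (simp add: add_divide_distrib)
    finally show ?thesis using uv[OF that] by (simp add: field_simps)
  qed
  have "sup_convolution \<delta> D u h \<le> ?S - sup_convolution \<delta> D' v k"
    unfolding sup_convolution_def[of \<delta> D]
  proof (rule cSUP_least[OF D(1)])
    fix x assume x: "x \<in> D"
    have "sup_convolution \<delta> D' v k \<le> ?S - (u x - (norm (h - x))\<^sup>2 / (2 * \<delta>))"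
      unfolding sup_convolution_def
    proof (rule cSUP_least[OF D(2)])
      fix y assume "y \<in> D'"
      from key[OF x this] show "v y - (norm (k - y))\<^sup>2 / (2 * \<delta>) \<le> ?S - (u x - (norm (h - x))\<^sup>2 / (2 * \<delta>))" by argo
    qed
    then show "u x - (norm (h - x))\<^sup>2 / (2 * \<delta>) \<le> ?S - sup_convolution \<delta> D' v k" by linarith
  qed
  then show ?thesis by linarith
qed

section \<open>Coupled random walks\<close>

text \<open>
  The two walks choose the same index and the same sign in every step. Hence their difference is a
  walk with steps \<open>\<plusminus> (a l - b l)\<close>, along which the mean of a quadratic form is computed exactly by
  the parallelogram law. This coupling is where the mixed second derivatives of the quadratic form enter.
\<close>

lemma walk_coupled:
  fixes a b :: "'l::finite \<Rightarrow> 'a::real_inner" and A :: "'a \<Rightarrow> 'b::real_inner"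
  assumes A: "linear A" and FG: "\<And>h k. F h + G k \<le> c * (norm (A (h - k)))\<^sup>2" and c: "0 \<le> c"
  shows "(walk a ^^ n) F h + (walk b ^^ n) G k
    \<le> c * ((norm (A (h - k)))\<^sup>2 + real n * ((\<Sum>l\<in>UNIV. (norm (A (a l - b l)))\<^sup>2) / real CARD('l)))"
proof (induction n arbitrary: h k)
  case (Suc n)
  let ?m = "2 * real CARD('l)"
  define S where "S = real n * ((\<Sum>l\<in>UNIV. (norm (A (a l - b l)))\<^sup>2) / real CARD('l))"
  define F' G' where "F' = (walk a ^^ n) F" and "G' = (walk b ^^ n) G"
  have IH: "F' h + G' k \<le> c * ((norm (A (h - k)))\<^sup>2 + S)" for h k using Suc.IH by (simp add: F'_def G'_def S_def)
  have "walk a F' h + walk b G' k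
     = (\<Sum>l\<in>UNIV. (F' (h + a l) + G' (k + b l)) + (F' (h - a l) + G' (k - b l))) / ?m"
    unfolding walk_def add_divide_distrib[symmetric] sum.distrib[symmetric] by (simp add: add_ac)
  also have "\<dots> \<le> (\<Sum>l\<in>UNIV. c * (2 * (norm (A (h - k)))\<^sup>2 + 2 * (norm (A (a l - b l)))\<^sup>2 + 2 * S)) / ?m"
  proof (intro divide_right_mono sum_mono)
    fix l
    have 1: "A (h + a l - (k + b l)) = A (h - k) + A (a l - b l)" "A (h - a l - (k - b l)) = A (h - k) - A (a l - b l)"
      unfolding linear_add[OF A, symmetric] linear_diff[OF A, symmetric] by (simp_all add: algebra_simps)
    have gen: "c * (x + S) + c * (y + S) = c * (z + 2 * S)" if "x + y = z" for x y z
      by (simp add: that[symmetric] algebra_simps)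
    have "(norm (A (h - k) + A (a l - b l)))\<^sup>2 + (norm (A (h - k) - A (a l - b l)))\<^sup>2
      = 2 * (norm (A (h - k)))\<^sup>2 + 2 * (norm (A (a l - b l)))\<^sup>2"
      by (simp only: power2_norm_eq_inner) (simp add: inner_add_left inner_add_right inner_diff_left inner_diff_right inner_commute)
    then have "c * ((norm (A (h + a l - (k + b l))))\<^sup>2 + S) + c * ((norm (A (h - a l - (k - b l))))\<^sup>2 + S)
       = c * (2 * (norm (A (h - k)))\<^sup>2 + 2 * (norm (A (a l - b l)))\<^sup>2 + 2 * S)"
      unfolding 1 by (rule gen)
    with IH[of "h + a l" "k + b l"] IH[of "h - a l" "k - b l"]
    show "(F' (h + a l) + G' (k + b l)) + (F' (h - a l) + G' (k - b l))
      \<le> c * (2 * (norm (A (h - k)))\<^sup>2 + 2 * (norm (A (a l - b l)))\<^sup>2 + 2 * S)" by linarith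
  qed simp
  also have "(\<Sum>l\<in>(UNIV::'l set). c * (2 * (norm (A (h - k)))\<^sup>2 + 2 * (norm (A (a l - b l)))\<^sup>2 + 2 * S)) / ?m
     = c * ((norm (A (h - k)))\<^sup>2 + S + (\<Sum>l\<in>UNIV. (norm (A (a l - b l)))\<^sup>2) / real CARD('l))"
  proof -
    have "(\<Sum>l\<in>(UNIV::'l set). c * (2 * (norm (A (h - k)))\<^sup>2 + 2 * (norm (A (a l - b l)))\<^sup>2 + 2 * S))
      = c * ((2 * (norm (A (h - k)))\<^sup>2 + 2 * S) * real CARD('l) + 2 * (\<Sum>l\<in>UNIV. (norm (A (a l - b l)))\<^sup>2))"
      by (simp add: sum_distrib_left[symmetric] sum.distrib algebra_simps)
    then show ?thesis by (simp add: field_simps)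
  qed
  finally show ?case by (simp add: F'_def G'_def S_def algebra_simps add_divide_distrib)
qed (use FG c in auto)

section \<open>Mollification\<close>

text \<open>
  The cube is the lowest power of the positive part with a second order expansion and a cubic
  remainder that hold across the kink, with one constant.
\<close>

lemma positive_cube_taylor:
  fixes s e :: real
  shows "\<bar>max 0 (s + e) ^ 3 - max 0 s ^ 3 - 3 * (max 0 s)\<^sup>2 * e - 3 * max 0 s * e\<^sup>2\<bar> \<le> 7 * \<bar>e\<bar> ^ 3"
proof (cases "0 \<le> s")
  case s: True
  show ?thesis
  proof (cases "0 \<le> s + e")
    case True
    have "max 0 (s + e) ^ 3 - max 0 s ^ 3 - 3 * (max 0 s)\<^sup>2 * e - 3 * max 0 s * e\<^sup>2 = e ^ 3"
      using s True by (simp add: max_def power2_eq_square power3_eq_cube algebra_simps)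
    then show ?thesis by (simp add: power_abs)
  next
    case False
    then have se: "s \<le> \<bar>e\<bar>" by simp
    have "s ^ 3 \<le> \<bar>e\<bar> ^ 3" using se s by (rule power_mono)
    moreover have "s\<^sup>2 * \<bar>e\<bar> \<le> \<bar>e\<bar>\<^sup>2 * \<bar>e\<bar>" using s se by (intro mult_right_mono power_mono) auto
    moreover have "s * \<bar>e\<bar>\<^sup>2 \<le> \<bar>e\<bar> * \<bar>e\<bar>\<^sup>2" using s se by (intro mult_right_mono) auto
    moreover have "\<bar>e\<bar>\<^sup>2 * \<bar>e\<bar> = \<bar>e\<bar> ^ 3" "\<bar>e\<bar> * \<bar>e\<bar>\<^sup>2 = \<bar>e\<bar> ^ 3" by (simp_all add: power2_eq_square power3_eq_cube)
    moreover have "0 \<le> s ^ 3" "0 \<le> s\<^sup>2 * \<bar>e\<bar>" "0 \<le> s * \<bar>e\<bar>\<^sup>2" using s by auto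
    moreover have "max 0 (s + e) ^ 3 - max 0 s ^ 3 - 3 * (max 0 s)\<^sup>2 * e - 3 * max 0 s * e\<^sup>2
      = - (s ^ 3) + 3 * (s\<^sup>2 * \<bar>e\<bar>) - 3 * (s * \<bar>e\<bar>\<^sup>2)" using s False by (simp add: max_def)
    moreover have "\<bar>- a + 3 * b - 3 * c\<bar> \<le> 7 * x" if "0 \<le> a" "a \<le> x" "0 \<le> b" "b \<le> x" "0 \<le> c" "c \<le> x" for a b c x :: real
      using that by linarith
    ultimately show ?thesis by metis
  qed
next
  case False
  then have "max 0 (s + e) ^ 3 \<le> \<bar>e\<bar> ^ 3" by (intro power_mono) auto
  moreover have "max 0 s = 0" using False by simp
  then have "max 0 (s + e) ^ 3 - max 0 s ^ 3 - 3 * (max 0 s)\<^sup>2 * e - 3 * max 0 s * e\<^sup>2 = max 0 (s + e) ^ 3" by simp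
  moreover have "0 \<le> \<bar>e\<bar> ^ 3" "0 \<le> max 0 (s + e) ^ 3" by (intro zero_le_power; simp)+
  ultimately show ?thesis unfolding abs_le_iff by linarith
qed

text \<open>
  A mollifier that need not be smooth: an expansion of second order with a cubic remainder suffices
  and is elementary for this function.
\<close>

definition bump :: "real \<Rightarrow> 'a::real_inner \<Rightarrow> real"
  where "bump \<kappa> z = max 0 (\<kappa>\<^sup>2 - (norm z)\<^sup>2) ^ 3"

definition bump_gradient :: "real \<Rightarrow> 'a::real_inner \<Rightarrow> 'a"
  where "bump_gradient \<kappa> z = - (6 * (max 0 (\<kappa>\<^sup>2 - (norm z)\<^sup>2))\<^sup>2) *\<^sub>R z"

definition bump_hessian :: "real \<Rightarrow> 'a::real_inner \<Rightarrow> 'a \<Rightarrow> 'a"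
  where "bump_hessian \<kappa> z d = (24 * max 0 (\<kappa>\<^sup>2 - (norm z)\<^sup>2) * (z \<bullet> d)) *\<^sub>R z
    - (6 * (max 0 (\<kappa>\<^sup>2 - (norm z)\<^sup>2))\<^sup>2) *\<^sub>R d"

lemma bump_support:
  assumes "\<kappa> < norm z" "0 < \<kappa>" 
  shows "bump \<kappa> z = 0" "bump_gradient \<kappa> z = 0" "bump_hessian \<kappa> z d = 0"
proof -
  have "\<kappa>\<^sup>2 < (norm z)\<^sup>2" using assms by (intro power_strict_mono) auto
  then have "max 0 (\<kappa>\<^sup>2 - (norm z)\<^sup>2) = 0" by simp
  then show "bump \<kappa> z = 0" "bump_gradient \<kappa> z = 0" "bump_hessian \<kappa> z d = 0"
    by (simp_all add: bump_def bump_gradient_def bump_hessian_def)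
qed

lemma bump_nonneg: "0 \<le> bump \<kappa> z" by (simp add: bump_def)

lemma bump_minus: "bump \<kappa> (- z) = bump \<kappa> z" by (simp add: bump_def)

lemma max_minus_sq_le: "max 0 (\<kappa>\<^sup>2 - (norm z)\<^sup>2) \<le> (\<kappa>::real)\<^sup>2"
  by simp

lemma bump_le: "bump \<kappa> z \<le> (\<kappa>\<^sup>2) ^ 3"
  unfolding bump_def by (intro power_mono max_minus_sq_le) simp

lemma norm_bump_gradient_le:
  assumes \<kappa>: "0 < \<kappa>" shows "norm (bump_gradient \<kappa> z) \<le> 6 * (\<kappa>\<^sup>2)\<^sup>2 * \<kappa>"
proof (cases "\<kappa> < norm z")
  case True
  then show ?thesis using bump_support[OF True \<kappa>] \<kappa> by simp
next
  case False
  define P where "P = max 0 (\<kappa>\<^sup>2 - (norm z)\<^sup>2)"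
  have "0 \<le> P" "P \<le> \<kappa>\<^sup>2" by (auto simp: P_def)
  then have "6 * P\<^sup>2 * norm z \<le> 6 * (\<kappa>\<^sup>2)\<^sup>2 * \<kappa>" using False by (intro mult_mono power_mono) auto
  then show ?thesis unfolding bump_gradient_def P_def[symmetric] by simp
qed

lemma norm_bump_hessian_le:
  assumes \<kappa>: "0 < \<kappa>" shows "norm (bump_hessian \<kappa> z d) \<le> (24 * \<kappa>\<^sup>2 * \<kappa>\<^sup>2 + 6 * (\<kappa>\<^sup>2)\<^sup>2) * norm d"
proof (cases "\<kappa> < norm z")
  case True
  then show ?thesis using bump_support[OF True \<kappa>] \<kappa> by simp
next
  case False
  let ?P = "max 0 (\<kappa>\<^sup>2 - (norm z)\<^sup>2)"
  have P: "0 \<le> ?P" "?P \<le> \<kappa>\<^sup>2" by auto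
  have "norm (bump_hessian \<kappa> z d) \<le> 24 * ?P * \<bar>z \<bullet> d\<bar> * norm z + 6 * ?P\<^sup>2 * norm d"
    unfolding bump_hessian_def by (rule order_trans[OF norm_triangle_ineq4]) (use P in \<open>simp add: abs_mult\<close>)
  also have "\<bar>z \<bullet> d\<bar> \<le> norm z * norm d" by (rule Cauchy_Schwarz_ineq2)
  also have "24 * ?P * (norm z * norm d) * norm z \<le> 24 * \<kappa>\<^sup>2 * (\<kappa> * norm d) * \<kappa>"
    using P False \<kappa> by (intro mult_mono mult_nonneg_nonneg) auto
  also have "6 * ?P\<^sup>2 * norm d \<le> 6 * (\<kappa>\<^sup>2)\<^sup>2 * norm d"
    using P by (intro mult_mono power_mono) auto
  finally show ?thesis using P by (simp add: algebra_simps power2_eq_square mult_right_mono)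
qed

lemma bump_taylor:
  fixes z d :: "'a::real_inner"
  assumes \<kappa>: "0 < \<kappa>" and d: "norm d \<le> 1"
  shows "\<bar>bump \<kappa> (z + d) - bump \<kappa> z - bump_gradient \<kappa> z \<bullet> d - (d \<bullet> bump_hessian \<kappa> z d) / 2\<bar>
    \<le> (3 * \<kappa>\<^sup>2 * (4 * \<kappa> + 5) + 7 * (2 * \<kappa> + 3) ^ 3) * norm d ^ 3"
    (is "\<bar>?lhs\<bar> \<le> ?rhs")
proof (cases "\<kappa> + 1 < norm z")
  case True
  have "norm z \<le> norm (z + d) + norm d" using norm_triangle_ineq4[of "z + d" d] by simp
  then have zd: "\<kappa> < norm (z + d)" using True d by linarith
  have z: "\<kappa> < norm z" using True by simp
  have "0 \<le> ?rhs" using \<kappa> by auto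
  then show ?thesis using bump_support[OF z \<kappa>] bump_support[OF zd \<kappa>] by simp
next
  case False
  define P where "P = max 0 (\<kappa>\<^sup>2 - (norm z)\<^sup>2)"
  define e where "e = - (2 * (z \<bullet> d) + (norm d)\<^sup>2)"
  define R where "R = bump \<kappa> (z + d) - P ^ 3 - 3 * P\<^sup>2 * e - 3 * P * e\<^sup>2"
  have P: "0 \<le> P" "P \<le> \<kappa>\<^sup>2" by (auto simp: P_def)
  have zd: "\<bar>z \<bullet> d\<bar> \<le> (\<kappa> + 1) * norm d"
    using Cauchy_Schwarz_ineq2[of z d] False mult_right_mono[of "norm z" "\<kappa> + 1" "norm d"] by simp
  have dd: "(norm d)\<^sup>2 \<le> norm d" "norm d ^ 4 \<le> norm d ^ 3"
    using d power_decreasing[of 1 2 "norm d"] power_decreasing[of 3 4 "norm d"] by auto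
  have "bump \<kappa> (z + d) = max 0 ((\<kappa>\<^sup>2 - (norm z)\<^sup>2) + e) ^ 3"
    unfolding bump_def e_def by (simp add: power2_norm_eq_inner inner_add_left inner_add_right inner_commute algebra_simps)
  then have "\<bar>R\<bar> \<le> 7 * \<bar>e\<bar> ^ 3" unfolding R_def P_def using positive_cube_taylor by metis
  moreover have "\<bar>e\<bar> \<le> (2 * \<kappa> + 3) * norm d"
  proof -
    have "(2 * \<kappa> + 3) * norm d = 2 * ((\<kappa> + 1) * norm d) + norm d" by (simp add: algebra_simps)
    moreover have "0 \<le> (norm d)\<^sup>2" "0 \<le> norm d" by auto
    ultimately show ?thesis using zd dd(1) unfolding e_def abs_le_iff by linarith
  qed
  then have "\<bar>e\<bar> ^ 3 \<le> ((2 * \<kappa> + 3) * norm d) ^ 3" by (intro power_mono) auto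
  ultimately have R: "\<bar>R\<bar> \<le> 7 * ((2 * \<kappa> + 3) ^ 3 * norm d ^ 3)" by (simp add: power_mult_distrib)
  define q where "q = 4 * (z \<bullet> d) * (norm d)\<^sup>2 + norm d ^ 4"
  have "\<bar>(z \<bullet> d) * (norm d)\<^sup>2\<bar> \<le> ((\<kappa> + 1) * norm d) * (norm d)\<^sup>2"
    unfolding abs_mult using zd by (intro mult_mono) auto
  also have "\<dots> = (\<kappa> + 1) * norm d ^ 3" by (simp add: power2_eq_square power3_eq_cube)
  finally have "\<bar>(z \<bullet> d) * (norm d)\<^sup>2\<bar> \<le> (\<kappa> + 1) * norm d ^ 3" .
  then have "\<bar>q\<bar> \<le> (4 * \<kappa> + 5) * norm d ^ 3" 
  proof -
    have "(4 * \<kappa> + 5) * norm d ^ 3 = 4 * ((\<kappa> + 1) * norm d ^ 3) + norm d ^ 3" by (simp add: algebra_simps)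
    moreover have "0 \<le> norm d ^ 4" by simp
    moreover have "q = 4 * ((z \<bullet> d) * (norm d)\<^sup>2) + norm d ^ 4" by (simp add: q_def)
    ultimately show ?thesis using dd(2) \<open>\<bar>(z \<bullet> d) * (norm d)\<^sup>2\<bar> \<le> (\<kappa> + 1) * norm d ^ 3\<close> unfolding abs_le_iff by linarith
  qed
  then have q: "\<bar>3 * P * q\<bar> \<le> 3 * \<kappa>\<^sup>2 * ((4 * \<kappa> + 5) * norm d ^ 3)"
    unfolding abs_mult using P by (intro mult_mono) auto
  have e2: "e\<^sup>2 = 4 * (z \<bullet> d)\<^sup>2 + q"
    by (simp add: e_def q_def power2_eq_square power4_eq_xxxx algebra_simps)
  have "?lhs = R + 3 * P\<^sup>2 * e + 3 * P * e\<^sup>2 + 6 * P\<^sup>2 * (z \<bullet> d) - 12 * P * (z \<bullet> d)\<^sup>2 + 3 * P\<^sup>2 * (norm d)\<^sup>2"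
    unfolding R_def bump_gradient_def bump_hessian_def P_def[symmetric]
    by (simp add: bump_def P_def inner_diff_right inner_commute dot_square_norm power2_eq_square diff_divide_distrib)
  also have "\<dots> = R + 3 * P * q" unfolding e2 by (simp add: e_def algebra_simps)
  finally show ?thesis using R q by (simp add: algebra_simps abs_le_iff)
qed

lemma continuous_on_bump [continuous_intros]:
  fixes g :: "'b::topological_space \<Rightarrow> 'a::real_inner" 
  assumes "continuous_on S g"
  shows "continuous_on S (\<lambda>x. bump \<kappa> (g x))" "continuous_on S (\<lambda>x. bump_gradient \<kappa> (g x))"
    "continuous_on S (\<lambda>x. bump_hessian \<kappa> (g x) d)"
  unfolding bump_def bump_gradient_def bump_hessian_def by (intro continuous_intros assms)+

lemma integrable_continuous_compact_support:
  fixes F :: "'a::euclidean_space \<Rightarrow> 'b::{banach, second_countable_topology}"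
  assumes "continuous_on UNIV F" "\<And>y. r < norm (y - h) \<Longrightarrow> F y = 0"
  shows "integrable lborel F"
proof -
  have "integrable lborel (\<lambda>x. indicator (cball h r) x *\<^sub>R F x)"
    by (intro borel_integrable_compact compact_cball continuous_on_subset[OF assms(1)]) auto
  also have "(\<lambda>x. indicator (cball h r) x *\<^sub>R F x) = F"
    using assms(2) by (auto simp: fun_eq_iff indicator_def dist_norm norm_minus_commute not_le)
  finally show ?thesis .
qed

lemma norm_integral_compact_support_le:
  fixes F :: "'a::euclidean_space \<Rightarrow> 'b::{banach, second_countable_topology}"
  assumes "continuous_on UNIV F" "\<And>y. r < norm (y - h) \<Longrightarrow> F y = 0" "\<And>y. norm (y - h) \<le> r \<Longrightarrow> norm (F y) \<le> c"
  shows "norm (integral\<^sup>L lborel F) \<le> c * measure lborel (cball h r)"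
proof -
  have "norm (integral\<^sup>L lborel F) \<le> (\<integral>y. c * indicator (cball h r) y \<partial>lborel)"
  proof (rule Bochner_Integration.integral_norm_bound_integral[OF integrable_continuous_compact_support[OF assms(1,2)]])
    show "integrable lborel (\<lambda>y. c * indicator (cball h r) y)" 
      by (intro integrable_mult_right integrable_real_indicator emeasure_lborel_cball_finite) auto
    show "norm (F y) \<le> c * indicator (cball h r) y" for y
      using assms(2)[of y] assms(3)[of y] by (cases "norm (y - h) \<le> r") (auto simp: indicator_def dist_norm norm_minus_commute)
  qed
  then show ?thesis by simp
qed

lemma lborel_integral_shift:
  fixes F :: "'a::euclidean_space \<Rightarrow> real"
  assumes "F \<in> borel_measurable borel"
  shows "(\<integral>y. F (h + y) \<partial>lborel) = integral\<^sup>L lborel F"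
proof -
  have "integral\<^sup>L lborel F = integral\<^sup>L (distr lborel borel ((+) h)) F" by (simp add: lborel_distr_plus)
  also have "\<dots> = (\<integral>y. F (h + y) \<partial>lborel)" using assms by (intro integral_distr) auto
  finally show ?thesis ..
qed

lemma lborel_integral_reflect:
  fixes F :: "'a::euclidean_space \<Rightarrow> real"
  assumes "F \<in> borel_measurable borel"
  shows "(\<integral>y. F (- y) \<partial>lborel) = integral\<^sup>L lborel F"
proof -
  have "(lborel :: 'a measure) = distr lborel borel (\<lambda>x. - x)"
    using lborel_affine[of "-1" "0 :: 'a"] by (simp add: density_1)
  then have "integral\<^sup>L lborel F = integral\<^sup>L (distr lborel borel (\<lambda>x. - x)) F" by simp
  also have "\<dots> = (\<integral>y. F (- y) \<partial>lborel)" using assms by (intro integral_distr) auto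
  finally show ?thesis ..
qed

definition bump_mass :: "'a::euclidean_space itself \<Rightarrow> real \<Rightarrow> real"
  where "bump_mass _ \<kappa> = (\<integral>z. bump \<kappa> (z::'a) \<partial>lborel)"

definition mollify :: "real \<Rightarrow> ('a::euclidean_space \<Rightarrow> real) \<Rightarrow> 'a \<Rightarrow> real"
  where "mollify \<kappa> U h = (\<integral>y. bump \<kappa> (y - h) * U y \<partial>lborel) / bump_mass TYPE('a) \<kappa>"

lemma bump_mass_pos:
  assumes "0 < \<kappa>" shows "0 < bump_mass TYPE('a::euclidean_space) \<kappa>"
proof -
  have int: "integrable lborel (bump \<kappa> :: 'a \<Rightarrow> real)"
    using assms by (intro integrable_continuous_compact_support[where r=\<kappa> and h=0] continuous_intros) (simp_all add: bump_support)
  have le: "((3/4) * \<kappa>\<^sup>2) ^ 3 * indicator (ball 0 (\<kappa>/2)) z \<le> bump \<kappa> z" for z :: 'a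
  proof (cases "norm z < \<kappa> / 2")
    case True
    then have "(norm z)\<^sup>2 \<le> (\<kappa> / 2)\<^sup>2" by (intro power_mono) auto
    then have "(3/4) * \<kappa>\<^sup>2 \<le> max 0 (\<kappa>\<^sup>2 - (norm z)\<^sup>2)"
      by (intro max.coboundedI2) (simp add: power_divide)
    then show ?thesis using True unfolding bump_def by (auto simp: indicator_def intro!: power_mono)
  qed (simp add: bump_nonneg indicator_def)
  have "0 < ((3/4) * \<kappa>\<^sup>2) ^ 3 * measure lborel (ball (0::'a) (\<kappa>/2))"
    using assms by (intro mult_pos_pos content_ball_pos) auto
  also have "\<dots> = (\<integral>z. ((3/4) * \<kappa>\<^sup>2) ^ 3 * indicator (ball (0::'a) (\<kappa>/2)) z \<partial>lborel)" by simp
  also have "\<dots> \<le> bump_mass TYPE('a) \<kappa>" unfolding bump_mass_def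
    using int le by (intro integral_mono integrable_mult_right integrable_real_indicator emeasure_lborel_ball_finite) auto
  finally show ?thesis .
qed

lemma linear_bump_hessian: "linear (bump_hessian \<kappa> z)"
  by (rule linearI) (simp_all add: bump_hessian_def inner_add_right algebra_simps)

lemma bump_hessian_symmetric: "x \<bullet> bump_hessian \<kappa> z y = bump_hessian \<kappa> z x \<bullet> y"
  by (simp add: bump_hessian_def inner_diff_left inner_diff_right inner_commute)

lemma integrable_weighted:
  fixes U :: "'a::euclidean_space \<Rightarrow> real" and q :: "'a \<Rightarrow> 'b::{banach, second_countable_topology}"
  assumes "continuous_on UNIV U" "continuous_on UNIV q" "\<And>z. r < norm z \<Longrightarrow> q z = 0"
  shows "integrable lborel (\<lambda>y. U y *\<^sub>R q (y - h))"
proof (rule integrable_continuous_compact_support[where r=r and h=h])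
  show "continuous_on UNIV (\<lambda>y. U y *\<^sub>R q (y - h))"
    by (intro continuous_intros assms(1) continuous_on_compose2[OF assms(2)]) auto
qed (use assms(3) in auto)

lemma norm_weighted_integral_le:
  fixes U :: "'a::euclidean_space \<Rightarrow> real" and q :: "'a \<Rightarrow> 'b::{banach, second_countable_topology}"
  assumes U: "continuous_on UNIV U" "\<And>y. \<bar>U y\<bar> \<le> C * (1 + (norm y)\<^sup>2)" "0 \<le> C"
    and q: "continuous_on UNIV q" "\<And>z. r < norm z \<Longrightarrow> q z = 0" "\<And>z. norm (q z) \<le> c" and r: "0 \<le> r"
  shows "norm (\<integral>y. U y *\<^sub>R q (y - h) \<partial>lborel)
    \<le> c * (C * (2 + 2 * r\<^sup>2) * measure lborel (cball (0::'a) r)) * (1 + (norm h)\<^sup>2)"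
proof -
  have c: "0 \<le> c" using q(3) norm_ge_zero order_trans by blast
  have "norm (\<integral>y. U y *\<^sub>R q (y - h) \<partial>lborel) \<le> (C * ((2 + 2 * r\<^sup>2) * (1 + (norm h)\<^sup>2)) * c) * measure lborel (cball h r)"
  proof (rule norm_integral_compact_support_le)
    show "continuous_on UNIV (\<lambda>y. U y *\<^sub>R q (y - h))"
      by (intro continuous_intros U(1) continuous_on_compose2[OF q(1)]) auto
    fix y assume y: "norm (y - h) \<le> r"
    have "(norm (h + (y - h)))\<^sup>2 \<le> 2 * (norm h)\<^sup>2 + 2 * (norm (y - h))\<^sup>2" by (rule norm_sq_add_le)
    moreover have "(norm (y - h))\<^sup>2 \<le> r\<^sup>2" using y by (intro power_mono) auto
    moreover have "(2 + 2 * r\<^sup>2) * (1 + (norm h)\<^sup>2) = 2 + 2 * r\<^sup>2 + 2 * (norm h)\<^sup>2 + 2 * (r\<^sup>2 * (norm h)\<^sup>2)"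
      by (simp add: algebra_simps)
    moreover have "0 \<le> r\<^sup>2 * (norm h)\<^sup>2" by simp
    moreover have "1 + a' \<le> S" if "a' \<le> 2 * b + 2 * c'" "c' \<le> r'" "S = 2 + 2 * r' + 2 * b + 2 * p" "0 \<le> p"
      for a' b c' r' S p :: real using that by linarith
    ultimately have "1 + (norm (h + (y - h)))\<^sup>2 \<le> (2 + 2 * r\<^sup>2) * (1 + (norm h)\<^sup>2)" by metis
    then have "1 + (norm y)\<^sup>2 \<le> (2 + 2 * r\<^sup>2) * (1 + (norm h)\<^sup>2)" by simp
    then have "\<bar>U y\<bar> \<le> C * ((2 + 2 * r\<^sup>2) * (1 + (norm h)\<^sup>2))" using U(2)[of y] U(3)
      by (meson mult_left_mono order_trans)
    then show "norm (U y *\<^sub>R q (y - h)) \<le> C * ((2 + 2 * r\<^sup>2) * (1 + (norm h)\<^sup>2)) * c"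
      using q(3)[of "y - h"] by (auto intro!: mult_mono)
  qed (use q(2) in auto)
  also have "measure lborel (cball h r) = measure lborel (cball (0::'a) r)" using r by (simp add: content_cball)
  finally show ?thesis by (simp add: mult_ac)
qed

text \<open>
  The expansion of the kernel is integrated against \<open>U\<close>, so nothing but the growth of \<open>U\<close> matters. In
  particular \<open>K\<close> is the same for all the rescaled functions to which this will be applied.
\<close>

lemma mollify_taylor2:
  assumes \<kappa>: "0 < \<kappa>" and C: "0 \<le> C"
  shows "\<exists>K\<ge>0. \<forall>U::'a::euclidean_space \<Rightarrow> real. continuous_on UNIV U \<longrightarrow> (\<forall>y. \<bar>U y\<bar> \<le> C * (1 + (norm y)\<^sup>2)) \<longrightarrow>
    (\<forall>h. \<bar>mollify \<kappa> U h\<bar> \<le> K * (1 + (norm h)\<^sup>2) \<and> (\<exists>g X. taylor2 (mollify \<kappa> U) h g X (K * (1 + (norm h)\<^sup>2))))"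
proof -
  define r where "r = \<kappa> + 1"
  define Z where "Z = bump_mass TYPE('a) \<kappa>"
  have Z: "0 < Z" using bump_mass_pos[OF \<kappa>] by (simp add: Z_def)
  define V where "V = C * (2 + 2 * r\<^sup>2) * measure lborel (cball (0::'a) r) / Z"
  have V: "0 \<le> V" using C Z by (simp add: V_def)
  define c0 where "c0 = (\<kappa>\<^sup>2) ^ 3"
  define c1 where "c1 = 6 * (\<kappa>\<^sup>2)\<^sup>2 * \<kappa>"
  define c2 where "c2 = 24 * \<kappa>\<^sup>2 * \<kappa>\<^sup>2 + 6 * (\<kappa>\<^sup>2)\<^sup>2"
  define c3 where "c3 = 3 * \<kappa>\<^sup>2 * (4 * \<kappa> + 5) + 7 * (2 * \<kappa> + 3) ^ 3"
  define c where "c = c0 + c1 + c2 + c3"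
  have cs: "0 \<le> c0" "0 \<le> c1" "0 \<le> c2" "0 \<le> c3" using \<kappa> by (auto simp: c0_def c1_def c2_def c3_def)
  have cle: "c0 \<le> c" "c1 \<le> c" "c2 \<le> c" "c3 \<le> c" using cs by (auto simp: c_def)
  have c: "0 \<le> c" using cle cs by linarith
  have main: "\<bar>mollify \<kappa> U h\<bar> \<le> c * V * (1 + (norm h)\<^sup>2) \<and> (\<exists>g X. taylor2 (mollify \<kappa> U) h g X (c * V * (1 + (norm h)\<^sup>2)))"
    if U: "continuous_on UNIV U" "\<And>y. \<bar>U y\<bar> \<le> C * (1 + (norm y)\<^sup>2)" for U :: "'a \<Rightarrow> real" and h
  proof -
    define \<omega> where "\<omega> = V * (1 + (norm h)\<^sup>2)"
    have \<omega>: "0 \<le> \<omega>" using V by (simp add: \<omega>_def)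
    have boundv: "norm ((1 / Z) *\<^sub>R (\<integral>y. U y *\<^sub>R q (y - h) \<partial>lborel)) \<le> k * \<omega>"
      if "continuous_on UNIV q" "\<And>z. r < norm z \<Longrightarrow> q z = 0" "\<And>z. norm (q z) \<le> k"
      for q :: "'a \<Rightarrow> 'a" and k
    proof -
      have "norm (\<integral>y. U y *\<^sub>R q (y - h) \<partial>lborel) / Z \<le> (k * (C * (2 + 2 * r\<^sup>2) * measure lborel (cball (0::'a) r)) * (1 + (norm h)\<^sup>2)) / Z"
        using Z by (intro divide_right_mono norm_weighted_integral_le[OF U C that]) (auto simp: r_def \<kappa> less_imp_le)
      then show ?thesis using Z by (simp add: \<omega>_def V_def mult_ac)
    qed
    have boundr: "norm ((1 / Z) *\<^sub>R (\<integral>y. U y *\<^sub>R q (y - h) \<partial>lborel)) \<le> k * \<omega>"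
      if "continuous_on UNIV q" "\<And>z. r < norm z \<Longrightarrow> q z = 0" "\<And>z. norm (q z) \<le> k"
      for q :: "'a \<Rightarrow> real" and k
    proof -
      have "norm (\<integral>y. U y *\<^sub>R q (y - h) \<partial>lborel) / Z \<le> (k * (C * (2 + 2 * r\<^sup>2) * measure lborel (cball (0::'a) r)) * (1 + (norm h)\<^sup>2)) / Z"
        using Z by (intro divide_right_mono norm_weighted_integral_le[OF U C that]) (auto simp: r_def \<kappa> less_imp_le)
      then show ?thesis using Z by (simp add: \<omega>_def V_def mult_ac)
    qed
    have supp: "bump \<kappa> z = 0" "bump_gradient \<kappa> z = 0" "bump_hessian \<kappa> z d = 0" if "r < norm z" for z d :: 'a
      using bump_support[of \<kappa> z] that \<kappa> by (auto simp: r_def)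
    have bc: "continuous_on UNIV (bump \<kappa> :: 'a \<Rightarrow> real)" "continuous_on UNIV (bump_gradient \<kappa> :: 'a \<Rightarrow> 'a)"
       "continuous_on UNIV (\<lambda>z::'a. bump_hessian \<kappa> z d)" for d by (intro continuous_intros)+
    have int: "integrable lborel (\<lambda>y. U y * bump \<kappa> (y - h))" 
       "integrable lborel (\<lambda>y. U y *\<^sub>R bump_gradient \<kappa> (y - h))" 
       "integrable lborel (\<lambda>y. U y *\<^sub>R bump_hessian \<kappa> (y - h) d)" for h d
      using integrable_weighted[OF U(1) bc(1) supp(1), where h=h] integrable_weighted[OF U(1) bc(2) supp(2), where h=h] 
        integrable_weighted[OF U(1) bc(3) supp(3), where h=h] by simp_all
    define g where "g = - ((1 / Z) *\<^sub>R (\<integral>y. U y *\<^sub>R bump_gradient \<kappa> (y - h) \<partial>lborel))"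
    define X where "X d = (1 / Z) *\<^sub>R (\<integral>y. U y *\<^sub>R bump_hessian \<kappa> (y - h) d \<partial>lborel)" for d
    have sym: "x \<bullet> X y = X x \<bullet> y" for x y
    proof -
      have "x \<bullet> (\<integral>z. U z *\<^sub>R bump_hessian \<kappa> (z - h) y \<partial>lborel) = (\<integral>z. x \<bullet> (U z *\<^sub>R bump_hessian \<kappa> (z - h) y) \<partial>lborel)"
        by (rule integral_inner_right[symmetric]) (rule int)
      also have "\<dots> = (\<integral>z. (U z *\<^sub>R bump_hessian \<kappa> (z - h) x) \<bullet> y \<partial>lborel)"
        by (simp add: bump_hessian_symmetric)
      also have "\<dots> = (\<integral>z. (U z *\<^sub>R bump_hessian \<kappa> (z - h) x) \<partial>lborel) \<bullet> y"
        by (rule integral_inner_left) (rule int)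
      finally show ?thesis by (simp add: X_def)
    qed
    have lin: "linear X"
    proof (rule linearI)
      fix x y :: 'a and s :: real
      show "X (x + y) = X x + X y"
        unfolding X_def linear_add[OF linear_bump_hessian] scaleR_add_right by (subst Bochner_Integration.integral_add[OF int(3) int(3)]) (rule scaleR_add_right)
      show "X (s *\<^sub>R x) = s *\<^sub>R X x"
        unfolding X_def linear_scale[OF linear_bump_hessian] by (simp add: scaleR_left_commute[of _ s] del: scaleR_scaleR)
    qed
    have T: "taylor2 (mollify \<kappa> U) h g X (c * \<omega>)"
      unfolding taylor2_def symmetric_op_def
    proof (intro conjI allI impI)
      show "linear X" by (rule lin)
      show "x \<bullet> X y = X x \<bullet> y" for x y by (rule sym)
      have "norm g \<le> c1 * \<omega>" unfolding g_def norm_minus_cancel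
        by (rule boundv) (use bc supp norm_bump_gradient_le[OF \<kappa>] in \<open>auto simp: c1_def\<close>)
      also have "\<dots> \<le> c * \<omega>" using cle \<omega> by (intro mult_right_mono) auto
      finally show "norm g \<le> c * \<omega>" .
      fix d
      have "norm (X d) \<le> (c2 * norm d) * \<omega>" unfolding X_def
        by (rule boundv) (use bc supp norm_bump_hessian_le[OF \<kappa>] in \<open>auto simp: c2_def\<close>)
      also have "\<dots> = c2 * (\<omega> * norm d)" by simp
      also have "\<dots> \<le> c * (\<omega> * norm d)" using cle \<omega> by (intro mult_right_mono) auto
      finally show "norm (X d) \<le> c * \<omega> * norm d" by (simp add: mult.assoc)
      assume d: "norm d \<le> 1"
      define q where "q z = bump \<kappa> (z - d) - bump \<kappa> z + bump_gradient \<kappa> z \<bullet> d - (d \<bullet> bump_hessian \<kappa> z d) / 2" for z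
      have eq: "mollify \<kappa> U (h + d) - mollify \<kappa> U h - g \<bullet> d - (d \<bullet> X d) / 2 = (1 / Z) *\<^sub>R (\<integral>y. U y *\<^sub>R q (y - h) \<partial>lborel)"
      proof -
        have i2: "integrable lborel (\<lambda>y. U y * (bump_gradient \<kappa> (y - h) \<bullet> d))" 
          using integrable_inner_left[OF int(2)[of h], of d] by simp
        have i3: "integrable lborel (\<lambda>y. U y * (d \<bullet> bump_hessian \<kappa> (y - h) d))" 
          using integrable_inner_right[OF int(3)[of h d], of d] by simp
        have a1: "g \<bullet> d = - ((1 / Z) * (\<integral>y. U y * (bump_gradient \<kappa> (y - h) \<bullet> d) \<partial>lborel))"
          unfolding g_def using integral_inner_left[OF int(2)[of h], of d] by simp
        have a2: "d \<bullet> X d = (1 / Z) * (\<integral>y. U y * (d \<bullet> bump_hessian \<kappa> (y - h) d) \<partial>lborel)"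
          unfolding X_def using integral_inner_right[OF int(3)[of h d], of d] by simp
        have "(\<integral>y. U y * q (y - h) \<partial>lborel) = (\<integral>y. U y * bump \<kappa> (y - (h + d)) - U y * bump \<kappa> (y - h)
            + U y * (bump_gradient \<kappa> (y - h) \<bullet> d) - (1 / 2) * (U y * (d \<bullet> bump_hessian \<kappa> (y - h) d)) \<partial>lborel)"
          by (intro Bochner_Integration.integral_cong refl) (simp add: q_def algebra_simps)
        also have "\<dots> = (\<integral>y. U y * bump \<kappa> (y - (h + d)) \<partial>lborel) - (\<integral>y. U y * bump \<kappa> (y - h) \<partial>lborel)
            + (\<integral>y. U y * (bump_gradient \<kappa> (y - h) \<bullet> d) \<partial>lborel) - (1 / 2) * (\<integral>y. U y * (d \<bullet> bump_hessian \<kappa> (y - h) d) \<partial>lborel)"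
          using int(1)[of h] int(1)[of "h + d"] i2 i3 by simp
        finally have a3: "(\<integral>y. U y * q (y - h) \<partial>lborel) = \<dots>" .
        have gen: "i1 / Z - i0 / Z - gd - dX / 2 = (1 / Z) * iq"
          if "gd = - ((1 / Z) * ig)" "dX = (1 / Z) * ih" "iq = i1 - i0 + ig - (1 / 2) * ih" for i1 i0 gd dX ig ih iq
          unfolding that by (simp add: diff_divide_distrib add_divide_distrib)
        show ?thesis using gen[OF a1 a2 a3]
          unfolding mollify_def Z_def[symmetric] by (simp add: mult.commute)
      qed
      have "norm ((1 / Z) *\<^sub>R (\<integral>y. U y *\<^sub>R q (y - h) \<partial>lborel)) \<le> (c3 * norm d ^ 3) * \<omega>"
      proof (rule boundr)
        show "continuous_on UNIV q" unfolding q_def by (intro continuous_intros) auto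
        fix z
        have "\<bar>q z\<bar> = \<bar>bump \<kappa> (z + (- d)) - bump \<kappa> z - bump_gradient \<kappa> z \<bullet> (- d) - ((- d) \<bullet> bump_hessian \<kappa> z (- d)) / 2\<bar>"
          by (simp add: q_def linear_neg[OF linear_bump_hessian])
        also have "\<dots> \<le> c3 * norm (- d) ^ 3" unfolding c3_def using d by (intro bump_taylor[OF \<kappa>]) simp
        finally show "norm (q z) \<le> c3 * norm d ^ 3" by simp
        assume z: "r < norm z"
        have "norm z \<le> norm (z - d) + norm d" using norm_triangle_ineq[of "z - d" d] by simp
        then have "\<kappa> < norm (z - d)" "\<kappa> < norm z" using z d by (auto simp: r_def)
        then show "q z = 0" using bump_support[of \<kappa> z] bump_support[of \<kappa> "z - d"] \<kappa> by (simp add: q_def)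
      qed
      also have "\<dots> = c3 * (\<omega> * norm d ^ 3)" by simp
      also have "\<dots> \<le> c * (\<omega> * norm d ^ 3)" using cle \<omega> by (intro mult_right_mono) auto
      finally show "\<bar>mollify \<kappa> U (h + d) - mollify \<kappa> U h - g \<bullet> d - d \<bullet> X d / 2\<bar> \<le> c * \<omega> * norm d ^ 3"
        unfolding eq by (simp add: mult.assoc)
    qed
    have "mollify \<kappa> U h = (1 / Z) *\<^sub>R (\<integral>y. U y *\<^sub>R bump \<kappa> (y - h) \<partial>lborel)" 
      by (simp add: mollify_def Z_def mult.commute)
    moreover have "norm ((1 / Z) *\<^sub>R (\<integral>y. U y *\<^sub>R bump \<kappa> (y - h) \<partial>lborel)) \<le> c0 * \<omega>"
      by (rule boundr) (use bc supp bump_le in \<open>auto simp: c0_def abs_of_nonneg[OF bump_nonneg]\<close>)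
    moreover have "c0 * \<omega> \<le> c * \<omega>" using cle \<omega> by (intro mult_right_mono) auto
    ultimately have "\<bar>mollify \<kappa> U h\<bar> \<le> c * \<omega>" by simp
    then show ?thesis using T unfolding \<omega>_def by (auto simp: mult.assoc)
  qed
  show ?thesis
    by (rule exI[of _ "c * V"]) (use main c V in auto)
qed

lemma mollify_shift_form:
  fixes U :: "'a::euclidean_space \<Rightarrow> real"
  assumes U: "continuous_on UNIV U"
  shows "mollify \<kappa> U h = (\<integral>z. bump \<kappa> z * U (h + z) \<partial>lborel) / bump_mass TYPE('a) \<kappa>"
proof -
  have "(\<lambda>y. bump \<kappa> (y - h) * U y) \<in> borel_measurable borel"
    by (intro borel_measurable_continuous_onI continuous_intros U)
  from lborel_integral_shift[OF this, of h] show ?thesis by (simp add: mollify_def)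
qed

lemma integrable_bump_times:
  fixes F :: "'a::euclidean_space \<Rightarrow> real"
  assumes "continuous_on UNIV F" "0 < \<kappa>" shows "integrable lborel (\<lambda>z. bump \<kappa> z * F z)"
  using assms by (intro integrable_continuous_compact_support[where r=\<kappa> and h=0] continuous_intros) (auto simp: bump_support)

lemma continuous_shift:
  fixes U :: "'a::real_normed_vector \<Rightarrow> real"
  assumes "continuous_on UNIV U" 
  shows "continuous_on UNIV (\<lambda>z. U (h + z))" "continuous_on UNIV (\<lambda>z. U (h - z))"
  by (intro continuous_intros continuous_on_compose2[OF assms]; simp)+

lemma mollify_semiconvex:
  fixes U :: "'a::euclidean_space \<Rightarrow> real"
  assumes \<kappa>: "0 < \<kappa>" and U: "continuous_on UNIV U" and sc: "\<And>z h. - B * (norm z)\<^sup>2 \<le> second_difference z U h"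
  shows "- B * (norm z)\<^sup>2 \<le> second_difference z (mollify \<kappa> U) h"
proof -
  define Z where "Z = bump_mass TYPE('a) \<kappa>"
  have Z: "0 < Z" using bump_mass_pos[OF \<kappa>] by (simp add: Z_def)
  note int = integrable_bump_times[OF continuous_shift(1)[OF U] \<kappa>]
  have "(- B * (norm z)\<^sup>2) * Z = (\<integral>y. bump \<kappa> y * (- B * (norm z)\<^sup>2) \<partial>(lborel :: 'a measure))" 
    unfolding Z_def bump_mass_def by simp
  also have "\<dots> \<le> (\<integral>y. bump \<kappa> y * U (h + z + y) + bump \<kappa> y * U (h - z + y) - 2 * (bump \<kappa> y * U (h + y)) \<partial>lborel)"
  proof (rule integral_mono)
    show "integrable lborel (\<lambda>y::'a. bump \<kappa> y * (- B * (norm z)\<^sup>2))" by (rule integrable_bump_times[OF _ \<kappa>]) simp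
    show "integrable lborel (\<lambda>y. bump \<kappa> y * U (h + z + y) + bump \<kappa> y * U (h - z + y) - 2 * (bump \<kappa> y * U (h + y)))"
      using int by simp
    fix y
    have "bump \<kappa> y * (- B * (norm z)\<^sup>2) \<le> bump \<kappa> y * second_difference z U (h + y)"
      by (intro mult_left_mono sc bump_nonneg)
    then show "bump \<kappa> y * (- B * (norm z)\<^sup>2) \<le> bump \<kappa> y * U (h + z + y) + bump \<kappa> y * U (h - z + y) - 2 * (bump \<kappa> y * U (h + y))"
      by (simp add: second_difference_def algebra_simps)
  qed
  also have "\<dots> = (\<integral>y. bump \<kappa> y * U (h + z + y) \<partial>lborel) + (\<integral>y. bump \<kappa> y * U (h - z + y) \<partial>lborel) - 2 * (\<integral>y. bump \<kappa> y * U (h + y) \<partial>lborel)"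
    using int by simp
  finally show ?thesis using Z unfolding second_difference_def mollify_shift_form[OF U] Z_def[symmetric] 
      pos_le_divide_eq[OF Z, symmetric] by (simp only: add_divide_distrib diff_divide_distrib times_divide_eq_right)
qed

text \<open>
  By symmetry of the kernel, \<open>mollify \<kappa> U h - U h\<close> is an average of second differences of \<open>U\<close> at \<open>h\<close>,
  which are bounded from below.
\<close>

lemma mollify_ge:
  fixes U :: "'a::euclidean_space \<Rightarrow> real"
  assumes \<kappa>: "0 < \<kappa>" and U: "continuous_on UNIV U" and sc: "\<And>z h. - B * (norm z)\<^sup>2 \<le> second_difference z U h" and B: "0 \<le> B"
  shows "U h \<le> mollify \<kappa> U h + B * \<kappa>\<^sup>2 / 2"
proof -
  define Z where "Z = bump_mass TYPE('a) \<kappa>"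
  have Z: "0 < Z" using bump_mass_pos[OF \<kappa>] by (simp add: Z_def)
  note int = integrable_bump_times[OF continuous_shift(1)[OF U] \<kappa>] integrable_bump_times[OF continuous_shift(2)[OF U] \<kappa>]
  have refl: "(\<integral>y. bump \<kappa> y * U (h - y) \<partial>lborel) = (\<integral>y. bump \<kappa> y * U (h + y) \<partial>lborel)"
  proof -
    have "(\<lambda>y. bump \<kappa> y * U (h + y)) \<in> borel_measurable borel"
      by (intro borel_measurable_continuous_onI continuous_intros continuous_shift U)
    from lborel_integral_reflect[OF this] show ?thesis by (simp add: bump_minus)
  qed
  have "(2 * U h - B * \<kappa>\<^sup>2) * Z = (\<integral>y. bump \<kappa> y * (2 * U h - B * \<kappa>\<^sup>2) \<partial>(lborel :: 'a measure))" 
    unfolding Z_def bump_mass_def by simp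
  also have "\<dots> \<le> (\<integral>y. bump \<kappa> y * U (h + y) + bump \<kappa> y * U (h - y) \<partial>lborel)"
  proof (rule integral_mono)
    show "integrable lborel (\<lambda>y::'a. bump \<kappa> y * (2 * U h - B * \<kappa>\<^sup>2))" by (rule integrable_bump_times[OF _ \<kappa>]) simp
    show "integrable lborel (\<lambda>y. bump \<kappa> y * U (h + y) + bump \<kappa> y * U (h - y))" using int by simp
    fix y :: 'a
    show "bump \<kappa> y * (2 * U h - B * \<kappa>\<^sup>2) \<le> bump \<kappa> y * U (h + y) + bump \<kappa> y * U (h - y)"
    proof (cases "\<kappa> < norm y")
      case False
      then have "(norm y)\<^sup>2 \<le> \<kappa>\<^sup>2" by (intro power_mono) auto
      then have "B * (norm y)\<^sup>2 \<le> B * \<kappa>\<^sup>2" using B by (rule mult_left_mono)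
      then have "2 * U h - B * \<kappa>\<^sup>2 \<le> U (h + y) + U (h - y)" using sc[of y h] by (simp add: second_difference_def)
      then have "bump \<kappa> y * (2 * U h - B * \<kappa>\<^sup>2) \<le> bump \<kappa> y * (U (h + y) + U (h - y))"
        by (intro mult_left_mono bump_nonneg)
      then show ?thesis by (simp add: distrib_left)
    qed (use bump_support(1)[OF _ \<kappa>, of y] in simp)
  qed
  also have "\<dots> = 2 * (\<integral>y. bump \<kappa> y * U (h + y) \<partial>lborel)"
    using int refl by simp
  finally show ?thesis using Z unfolding mollify_shift_form[OF U] Z_def[symmetric]
    by (simp add: field_simps)
qed

lemma mollify_coupled:
  fixes U V :: "'a::euclidean_space \<Rightarrow> real"
  assumes \<kappa>: "0 < \<kappa>" and U: "continuous_on UNIV U" and V: "continuous_on UNIV V"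
    and UV: "\<And>h k. U h + V k \<le> c * (norm (A (h - k)))\<^sup>2"
  shows "mollify \<kappa> U h + mollify \<kappa> V k \<le> c * (norm (A (h - k)))\<^sup>2"
proof -
  define Z where "Z = bump_mass TYPE('a) \<kappa>"
  have Z: "0 < Z" using bump_mass_pos[OF \<kappa>] by (simp add: Z_def)
  let ?S = "c * (norm (A (h - k)))\<^sup>2"
  note int = integrable_bump_times[OF continuous_shift(1)[OF U] \<kappa>] integrable_bump_times[OF continuous_shift(1)[OF V] \<kappa>]
  have "(\<integral>y. bump \<kappa> y * U (h + y) \<partial>lborel) + (\<integral>y. bump \<kappa> y * V (k + y) \<partial>lborel) = (\<integral>y. bump \<kappa> y * U (h + y) + bump \<kappa> y * V (k + y) \<partial>lborel)"
    using int by simp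
  also have "\<dots> \<le> (\<integral>y. bump \<kappa> y * ?S \<partial>(lborel :: 'a measure))"
  proof (rule integral_mono)
    show "integrable lborel (\<lambda>y::'a. bump \<kappa> y * ?S)" by (rule integrable_bump_times[OF _ \<kappa>]) simp
    show "integrable lborel (\<lambda>y. bump \<kappa> y * U (h + y) + bump \<kappa> y * V (k + y))" using int by simp
    fix y :: 'a
    have "U (h + y) + V (k + y) \<le> ?S" using UV[of "h + y" "k + y"] by simp
    then have "bump \<kappa> y * (U (h + y) + V (k + y)) \<le> bump \<kappa> y * ?S" by (intro mult_left_mono bump_nonneg)
    then show "bump \<kappa> y * U (h + y) + bump \<kappa> y * V (k + y) \<le> bump \<kappa> y * ?S" by (simp add: distrib_left)
  qed
  also have "\<dots> = Z * ?S" unfolding Z_def bump_mass_def by simp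
  finally show ?thesis using Z unfolding mollify_shift_form[OF U] mollify_shift_form[OF V] Z_def[symmetric]
    by (simp add: field_simps)
qed

section \<open>The theorem on sums in trace form\<close>

text \<open>
  The smooth function of \<open>walk_comparison\<close> is chosen as the mollified sup-convolution of \<open>u\<close>: taking the
  supremum over shifts first makes \<open>u\<close>, which is only semicontinuous, lie below a semiconvex function.
  The constant \<open>M\<close> is chosen before \<open>D\<close>, \<open>u\<close> and \<open>\<alpha>\<close>.
\<close>

lemma smoothed_walk_comparison:
  fixes a :: "'l::finite \<Rightarrow> 'a::euclidean_space"
  assumes C: "0 \<le> C" and \<delta>: "0 < \<delta>" "4 * C * \<delta> \<le> 1" and \<kappa>: "0 < \<kappa>" and K: "0 \<le> K"
    and KU: "\<forall>U::'a \<Rightarrow> real. continuous_on UNIV U \<longrightarrow> (\<forall>y. \<bar>U y\<bar> \<le> (2 * C + 1 / (2 * \<delta>)) * (1 + (norm y)\<^sup>2)) \<longrightarrow>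
      (\<forall>h. \<bar>mollify \<kappa> U h\<bar> \<le> K * (1 + (norm h)\<^sup>2) \<and> (\<exists>g X. taylor2 (mollify \<kappa> U) h g X (K * (1 + (norm h)\<^sup>2))))"
    and \<theta>: "0 < \<theta>" and \<rho>: "0 \<le> \<rho>" and N: "real N * \<rho>\<^sup>2 = real CARD('l)"
    and A: "\<And>l. norm (a l) \<le> A" "2 * (\<rho> * A) \<le> 1"
    and s_def: "s = (\<Sum>l\<in>UNIV. (norm (a l))\<^sup>2)" and L_def: "L = 33 * (K * (1 + s)) * A ^ 3"
  shows "\<exists>M. \<forall>D u \<alpha>. closed D \<longrightarrow> 0 \<in> D \<longrightarrow> usc_on D u \<longrightarrow> u 0 = 0 \<longrightarrow> (\<forall>h\<in>D. u h \<le> C * (norm h)\<^sup>2) \<longrightarrow>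
    superjets_bound a D u M \<alpha> \<longrightarrow>
    \<alpha> / 2 \<le> (walk (\<lambda>l. \<rho> *\<^sub>R a l) ^^ N) (mollify \<kappa> (sup_convolution \<delta> D u)) 0
      + \<kappa>\<^sup>2 / (2 * \<delta>) + (\<theta> + L * real CARD('l) * \<rho>) * s + L * real CARD('l) * \<rho>"
proof (intro exI allI impI)
  fix D u \<alpha>
  assume D: "closed D" "0 \<in> D" and u: "usc_on D u" "u 0 = 0" and uC: "\<forall>h\<in>D. u h \<le> C * (norm h)\<^sup>2"
    and jets: "superjets_bound a D u (1 + (s * (1 / \<delta>) / 2 + \<kappa>\<^sup>2 / (2 * \<delta>) + K * (1 + s)) / \<theta> + 
      2 * (K * (1 + s)) * (1 + (s * (1 / \<delta>) / 2 + \<kappa>\<^sup>2 / (2 * \<delta>) + K * (1 + s)) / \<theta>) + \<kappa>\<^sup>2 / (2 * \<delta>) 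
      + 2 * (\<theta> + L * real CARD('l) * \<rho>) * (1 + (s * (1 / \<delta>) / 2 + \<kappa>\<^sup>2 / (2 * \<delta>) + K * (1 + s)) / \<theta>)) \<alpha>"
  define U where "U = sup_convolution \<delta> D u"
  have ne: "D \<noteq> {}" using D by auto
  have uC': "\<And>h. h \<in> D \<Longrightarrow> u h \<le> C * (norm h)\<^sup>2" using uC by blast
  have Uc: "continuous_on UNIV U" unfolding U_def by (rule sup_convolution_continuous[OF C \<delta> uC' ne])
  have Usc: "\<And>z h. - (1 / \<delta>) * (norm z)\<^sup>2 \<le> second_difference z U h"
    unfolding U_def by (rule sup_convolution_semiconvex[OF C \<delta> uC' ne])
  have Ub: "\<bar>U y\<bar> \<le> (2 * C + 1 / (2 * \<delta>)) * (1 + (norm y)\<^sup>2)" for y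
  proof -
    have "\<bar>U y\<bar> \<le> (2 * C + 1 / (2 * \<delta>)) * (norm y)\<^sup>2"
      unfolding U_def by (rule sup_convolution_abs_le[OF C \<delta> uC' D(2) u(2)])
    also have "\<dots> \<le> (2 * C + 1 / (2 * \<delta>)) * (1 + (norm y)\<^sup>2)" using C \<delta> by (intro mult_left_mono) auto
    finally show ?thesis .
  qed
  note KU' = KU[rule_format, OF Uc Ub]
  have uG: "u h \<le> mollify \<kappa> U h + \<kappa>\<^sup>2 / (2 * \<delta>)" if "h \<in> D" for h
  proof -
    have "u h \<le> U h" unfolding U_def by (rule sup_convolution_ge_self[OF C \<delta> uC' that])
    also have "\<dots> \<le> mollify \<kappa> U h + (1 / \<delta>) * \<kappa>\<^sup>2 / 2" using \<delta> by (intro mollify_ge[OF \<kappa> Uc Usc]) auto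
    finally show ?thesis by (simp add: mult.commute)
  qed
  have "\<alpha> / 2 \<le> (walk (\<lambda>l. \<rho> *\<^sub>R a l) ^^ N) (mollify \<kappa> U) 0
      + \<kappa>\<^sup>2 / (2 * \<delta>) + (\<theta> + L * real CARD('l) * \<rho>) * s + L * real CARD('l) * \<rho>"
    by (rule walk_comparison[where B="1 / \<delta>" and a=a and K=K and D=D and u=u, 
        OF K _ \<theta> _ \<rho> N A s_def L_def refl refl refl _ _ mollify_semiconvex[OF \<kappa> Uc Usc] D u uG jets])
      (use \<delta> KU' in auto)
  then show "\<alpha> / 2 \<le> (walk (\<lambda>l. \<rho> *\<^sub>R a l) ^^ N) (mollify \<kappa> (sup_convolution \<delta> D u)) 0
      + \<kappa>\<^sup>2 / (2 * \<delta>) + (\<theta> + L * real CARD('l) * \<rho>) * s + L * real CARD('l) * \<rho>"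
    by (simp add: U_def)
qed

text \<open>
  This says that \<open>(\<Sum>l. a l \<bullet> X (a l)) \<ge> \<alpha>\<close> for all limits \<open>(P, X)\<close> of superjets at points
  converging to \<open>x0\<close>, written without limits: for a fixed bound \<open>M\<close> of the Hessians, nearby superjets
  satisfy the inequality up to \<open>\<eta>\<close>.
\<close>

definition limiting_superjets_bound ::
  "('l::finite \<Rightarrow> 'a::real_inner) \<Rightarrow> 'a set \<Rightarrow> ('a \<Rightarrow> real) \<Rightarrow> 'a \<Rightarrow> 'a \<Rightarrow> real \<Rightarrow> bool"
  where "limiting_superjets_bound a D u x0 P \<alpha> \<longleftrightarrow>
    (\<forall>M. \<forall>\<eta>>0. \<exists>\<epsilon>>0. \<forall>x\<in>D. \<forall>p X K r. 0 < r \<longrightarrow> norm (x - x0) \<le> \<epsilon> \<longrightarrow> \<bar>u x - u x0\<bar> \<le> \<epsilon> \<longrightarrow> norm (p - P) \<le> \<epsilon> \<longrightarrow>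
      symmetric_op X \<longrightarrow> (\<forall>d. norm (X d) \<le> M * norm d) \<longrightarrow>
      (\<forall>d. norm d \<le> r \<longrightarrow> x + d \<in> D \<longrightarrow> u (x + d) \<le> u x + p \<bullet> d + (d \<bullet> X d) / 2 + K * norm d ^ 3) \<longrightarrow>
      \<alpha> - \<eta> \<le> (\<Sum>l\<in>UNIV. a l \<bullet> X (a l)))"

definition blow_up :: "real \<Rightarrow> 'a \<Rightarrow> 'a \<Rightarrow> ('a::real_inner \<Rightarrow> real) \<Rightarrow> 'a \<Rightarrow> real"
  where "blow_up r x0 P u h = (u (x0 + r *\<^sub>R h) - u x0 - r * (P \<bullet> h)) / r\<^sup>2"

definition blow_up_domain :: "real \<Rightarrow> 'a \<Rightarrow> 'a::real_inner set \<Rightarrow> 'a set"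
  where "blow_up_domain r x0 D = {h. x0 + r *\<^sub>R h \<in> D}"

lemma blow_up_eq: "r \<noteq> 0 \<Longrightarrow> u (x0 + r *\<^sub>R h) = u x0 + r * (P \<bullet> h) + r\<^sup>2 * blow_up r x0 P u h"
  by (simp add: blow_up_def)

text \<open>
  The rescaling maps a superjet \<open>(p, X)\<close> of the blow-up to the superjet \<open>(P + r *\<^sub>R p, X)\<close> of \<open>u\<close>. For bounded
  \<open>p\<close> and small \<open>r\<close> the slope is close to \<open>P\<close>; the remainder constant becomes \<open>M / r\<close>, which
  \<open>limiting_superjets_bound\<close> permits.
\<close>

lemma blow_up_superjets_bound:
  assumes lim: "limiting_superjets_bound a D u x0 P \<alpha>" and \<eta>: "0 < \<eta>"
  shows "\<exists>r0>0. \<forall>r>0. r \<le> r0 \<longrightarrow> superjets_bound a (blow_up_domain r x0 D) (blow_up r x0 P u) M (\<alpha> - \<eta>)"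
proof -
  have "\<exists>\<epsilon>>0. \<forall>x\<in>D. \<forall>p X K r. 0 < r \<longrightarrow> norm (x - x0) \<le> \<epsilon> \<longrightarrow> \<bar>u x - u x0\<bar> \<le> \<epsilon> \<longrightarrow> norm (p - P) \<le> \<epsilon> \<longrightarrow>
      symmetric_op X \<longrightarrow> (\<forall>d. norm (X d) \<le> M * norm d) \<longrightarrow>
      (\<forall>d. norm d \<le> r \<longrightarrow> x + d \<in> D \<longrightarrow> u (x + d) \<le> u x + p \<bullet> d + (d \<bullet> X d) / 2 + K * norm d ^ 3) \<longrightarrow>
      \<alpha> - \<eta> \<le> (\<Sum>l\<in>UNIV. a l \<bullet> X (a l))"
    using spec[OF spec[OF lim[unfolded limiting_superjets_bound_def], of M], of \<eta>] \<eta> by (rule mp)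
  then obtain \<epsilon> where \<epsilon>: "0 < \<epsilon>" and E': "\<forall>x\<in>D. \<forall>p X K r. 0 < r \<longrightarrow> norm (x - x0) \<le> \<epsilon> \<longrightarrow> \<bar>u x - u x0\<bar> \<le> \<epsilon> \<longrightarrow> norm (p - P) \<le> \<epsilon> \<longrightarrow>
      symmetric_op X \<longrightarrow> (\<forall>d. norm (X d) \<le> M * norm d) \<longrightarrow>
      (\<forall>d. norm d \<le> r \<longrightarrow> x + d \<in> D \<longrightarrow> u (x + d) \<le> u x + p \<bullet> d + (d \<bullet> X d) / 2 + K * norm d ^ 3) \<longrightarrow>
      \<alpha> - \<eta> \<le> (\<Sum>l\<in>UNIV. a l \<bullet> X (a l))" by (elim exE conjE)
  note E = E'[THEN bspec, THEN spec, THEN spec, THEN spec, THEN spec, THEN mp, THEN mp, THEN mp, THEN mp, THEN mp, THEN mp, THEN mp]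
  define m where "m = \<bar>M\<bar> * (1 + norm P) + 1"
  have m: "0 < m" by (simp add: m_def add_nonneg_pos)
  have mM: "\<bar>M\<bar> \<le> m" "norm P * \<bar>M\<bar> + \<bar>M\<bar> \<le> m" by (auto simp: m_def algebra_simps)
  show ?thesis
  proof (intro exI[of _ "min 1 (\<epsilon> / m)"] conjI allI impI)
    show "0 < min 1 (\<epsilon> / m)" using \<epsilon> m by simp
    fix r assume r: "0 < r" "r \<le> min 1 (\<epsilon> / m)"
    have rm: "r * m \<le> \<epsilon>" using r m by (simp add: pos_le_divide_eq)
    show "superjets_bound a (blow_up_domain r x0 D) (blow_up r x0 P u) M (\<alpha> - \<eta>)"
      unfolding superjets_bound_def
    proof (intro ballI allI impI)
      fix h p X
      let ?u = "blow_up r x0 P u"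
      assume h: "h \<in> blow_up_domain r x0 D" and hM: "norm h \<le> M" and uM: "\<bar>?u h\<bar> \<le> M" and pM: "norm p \<le> M"
        and X: "symmetric_op X" "\<forall>d. norm (X d) \<le> M * norm d"
        and T: "\<forall>d. norm d \<le> 1 \<longrightarrow> h + d \<in> blow_up_domain r x0 D \<longrightarrow> ?u (h + d) \<le> ?u h + p \<bullet> d + d \<bullet> X d / 2 + M * norm d ^ 3"
      have r0: "r \<noteq> 0" using r by simp
      show "\<alpha> - \<eta> \<le> (\<Sum>l\<in>UNIV. a l \<bullet> X (a l))"
      proof (rule E[of "x0 + r *\<^sub>R h" r "P + r *\<^sub>R p" X "M / r"])
        show "x0 + r *\<^sub>R h \<in> D" using h by (simp add: blow_up_domain_def)
        show "0 < r" by (rule r)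
        have "r * \<bar>M\<bar> \<le> \<epsilon>" using rm mult_left_mono[OF mM(1), of r] r by linarith
        moreover have "r * norm h \<le> r * \<bar>M\<bar>" "r * norm p \<le> r * \<bar>M\<bar>" using hM pM r by (auto intro!: mult_left_mono)
        moreover have "norm (x0 + r *\<^sub>R h - x0) = r * norm h" "norm (P + r *\<^sub>R p - P) = r * norm p" using r by simp_all
        ultimately show "norm (x0 + r *\<^sub>R h - x0) \<le> \<epsilon>" "norm (P + r *\<^sub>R p - P) \<le> \<epsilon>" by linarith+
        have "\<bar>P \<bullet> h\<bar> \<le> norm P * \<bar>M\<bar>" using Cauchy_Schwarz_ineq2[of P h] hM
          by (meson abs_ge_self mult_left_mono norm_ge_zero order_trans)
        then have 1: "\<bar>r * (P \<bullet> h)\<bar> \<le> r * (norm P * \<bar>M\<bar>)" using r by (simp add: abs_mult)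
        have "r\<^sup>2 * \<bar>?u h\<bar> \<le> r * \<bar>M\<bar>"
          using r uM by (intro mult_mono) (auto simp: power2_eq_square)
        then have 2: "\<bar>r\<^sup>2 * ?u h\<bar> \<le> r * \<bar>M\<bar>" by (simp add: abs_mult)
        have "r * (norm P * \<bar>M\<bar>) + r * \<bar>M\<bar> \<le> \<epsilon>" using rm mult_left_mono[OF mM(2), of r] r by (simp add: distrib_left)
        then show "\<bar>u (x0 + r *\<^sub>R h) - u x0\<bar> \<le> \<epsilon>" using 1 2 unfolding blow_up_eq[OF r0, of u x0 h P] by linarith
        show "symmetric_op X" "\<forall>d. norm (X d) \<le> M * norm d" by (rule X)+
        show "\<forall>d. norm d \<le> r \<longrightarrow> x0 + r *\<^sub>R h + d \<in> D \<longrightarrow>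
          u (x0 + r *\<^sub>R h + d) \<le> u (x0 + r *\<^sub>R h) + (P + r *\<^sub>R p) \<bullet> d + d \<bullet> X d / 2 + M / r * norm d ^ 3"
        proof (intro allI impI)
          fix d assume d: "norm d \<le> r" "x0 + r *\<^sub>R h + d \<in> D"
          define e where "e = (1 / r) *\<^sub>R d"
          have de: "d = r *\<^sub>R e" using r by (simp add: e_def)
          have x: "x0 + r *\<^sub>R h + d = x0 + r *\<^sub>R (h + e)" by (simp add: de algebra_simps)
          have "norm e \<le> 1" "h + e \<in> blow_up_domain r x0 D"
            using d r x by (auto simp: e_def blow_up_domain_def)
          then have "?u (h + e) \<le> ?u h + p \<bullet> e + e \<bullet> X e / 2 + M * norm e ^ 3" using T by blast
          then have "r\<^sup>2 * ?u (h + e) \<le> r\<^sup>2 * (?u h + p \<bullet> e + e \<bullet> X e / 2 + M * norm e ^ 3)"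
            by (intro mult_left_mono) auto
          also have "\<dots> = r\<^sup>2 * ?u h + (r *\<^sub>R p) \<bullet> d + d \<bullet> X d / 2 + M / r * norm d ^ 3"
            using X(1) r by (simp add: de symmetric_op_def linear_scale power2_eq_square power3_eq_cube power_mult_distrib algebra_simps)
          finally show "u (x0 + r *\<^sub>R h + d) \<le> u (x0 + r *\<^sub>R h) + (P + r *\<^sub>R p) \<bullet> d + d \<bullet> X d / 2 + M / r * norm d ^ 3"
            unfolding x blow_up_eq[OF r0, of u x0 _ P] by (simp add: inner_add_left inner_add_right de distrib_left)
        qed
      qed
    qed
  qed
qed

lemma blow_up_usc:
  fixes u :: "'a::real_inner \<Rightarrow> real"
  assumes u: "usc_on D u" and r: "0 < r"
  shows "usc_on (blow_up_domain r x0 D) (blow_up r x0 P u)"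
proof -
  have "usc_on (blow_up_domain r x0 D) (\<lambda>h. u (x0 + r *\<^sub>R h))"
    by (rule usc_on_compose[OF u]) (auto simp: blow_up_domain_def intro!: continuous_intros)
  then have "usc_on (blow_up_domain r x0 D) (\<lambda>h. u (x0 + r *\<^sub>R h) - (u x0 + r * (P \<bullet> h)))"
    by (rule usc_on_diff_continuous) (intro continuous_intros)
  from usc_on_scale[OF this, of "r\<^sup>2"] r show ?thesis by (simp add: blow_up_def[abs_def] diff_diff_add)
qed

lemma closed_blow_up_domain:
  "closed D \<Longrightarrow> closed (blow_up_domain r x0 D)"
  unfolding blow_up_domain_def
  using continuous_closed_vimage[of D "\<lambda>h. x0 + r *\<^sub>R h"] by (simp add: vimage_def)

text \<open>
  The trace form of the theorem on sums of Crandall and Ishii. The usual conclusion is a block matrix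
  inequality between limiting second order jets \<open>X\<close> of \<open>u\<close> and \<open>Y\<close> of \<open>v\<close>; an equation that is linear in the
  second derivatives uses it only after summation against the vectors \<open>(a l, b l)\<close>, that is in the form
  \<open>(\<Sum>l. a l \<bullet> X (a l)) + (\<Sum>l. b l \<bullet> Y (b l)) \<le> (\<Sum>l. (norm (A (a l - b l)))\<^sup>2)\<close>.
  Suppose that the two sums are at least \<open>\<alpha>\<close> and \<open>\<beta>\<close>. After blowing up around \<open>x0\<close> and \<open>y0\<close>, both functions
  vanish at \<open>0\<close>, the sum at \<open>(h, k)\<close> is at most \<open>(norm (A (h - k)))\<^sup>2 / 2\<close>, and each function lies below its mean along
  a random walk minus \<open>\<alpha> / 2\<close> or \<open>\<beta> / 2\<close>. Coupling the walks bounds the sum of the means by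
  \<open>(\<Sum>l. (norm (A (a l - b l)))\<^sup>2) / 2\<close>. The parameters are chosen in the order \<open>\<tau>\<close>, \<open>\<delta>\<close>, \<open>\<kappa>\<close>, \<open>\<theta>\<close>, \<open>N\<close>, \<open>r\<close>, and every
  error is a fraction of the assumed gap.
\<close>

theorem trace_theorem_on_sums:
  fixes a b :: "'l::finite \<Rightarrow> 'a::euclidean_space" and A :: "'a \<Rightarrow> 'b::real_inner"
  assumes A: "linear A" "\<And>x. norm (A x) \<le> c * norm x"
    and D: "closed D" "closed D'" and x0: "x0 \<in> D" and y0: "y0 \<in> D'"
    and usc: "usc_on D u" "usc_on D' v"
    and max: "\<And>x y. x \<in> D \<Longrightarrow> y \<in> D' \<Longrightarrow>
      u x + v y \<le> u x0 + v y0 + P \<bullet> (x - x0) + Q \<bullet> (y - y0) + (norm (A ((x - x0) - (y - y0))))\<^sup>2 / 2"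
    and jets: "limiting_superjets_bound a D u x0 P \<alpha>" "limiting_superjets_bound b D' v y0 Q \<beta>"
  shows "\<alpha> + \<beta> \<le> (\<Sum>l\<in>UNIV. (norm (A (a l - b l)))\<^sup>2)"
proof (rule ccontr)
  define B where "B = (\<Sum>l\<in>UNIV. (norm (A (a l - b l)))\<^sup>2)"
  define m where "m = real CARD('l)"
  assume "\<not> ?thesis"
  then have gap: "B < \<alpha> + \<beta>" by (simp add: B_def)
  have B0: "0 \<le> B" unfolding B_def by (intro sum_nonneg) auto
  have m: "0 < m" by (simp add: m_def)
  \<comment> \<open>The errors below add up to \<open>5 * \<eta>\<close>.\<close>
  define \<eta> where "\<eta> = (\<alpha> + \<beta> - B) / 8"
  have \<eta>: "0 < \<eta>" using gap by (simp add: \<eta>_def)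
  define \<tau> where "\<tau> = \<eta> / (B + 1)"
  have \<tau>: "0 < \<tau>" "\<tau> * B \<le> \<eta>" using \<eta> B0 by (auto simp: \<tau>_def field_simps)
  define C where "C = c\<^sup>2 / 2"
  have C: "0 \<le> C" by (simp add: C_def)
  define \<delta> where "\<delta> = 1 / (1 + 4 * C + 2 * (1 + 1 / \<tau>) * c\<^sup>2)"
  have den: "0 \<le> 2 * (1 + 1 / \<tau>) * c\<^sup>2" using \<tau> by simp
  define G where "G = 2 * (1 + 1 / \<tau>) * c\<^sup>2"
  have G: "0 \<le> G" using den by (simp add: G_def)
  have \<delta>G: "\<delta> = 1 / (1 + 4 * C + G)" by (simp add: \<delta>_def G_def)
  have "0 < \<delta>" "4 * C * \<delta> \<le> 1" "G * \<delta> \<le> 1" using C G by (simp_all add: \<delta>G)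
  then have \<delta>: "0 < \<delta>" "4 * C * \<delta> \<le> 1" "2 * (1 + 1 / \<tau>) * c\<^sup>2 * \<delta> \<le> 1" by (simp_all only: G_def)
  define \<kappa> where "\<kappa> = sqrt (\<delta> * \<eta> / 4)"
  have \<kappa>: "0 < \<kappa>" "\<kappa>\<^sup>2 / (2 * \<delta>) = \<eta> / 8" using \<delta> \<eta> by (auto simp: \<kappa>_def)
  obtain K where K: "0 \<le> K" and KU: "\<forall>U::'a \<Rightarrow> real. continuous_on UNIV U \<longrightarrow> (\<forall>y. \<bar>U y\<bar> \<le> (2 * C + 1 / (2 * \<delta>)) * (1 + (norm y)\<^sup>2)) \<longrightarrow>
      (\<forall>h. \<bar>mollify \<kappa> U h\<bar> \<le> K * (1 + (norm h)\<^sup>2) \<and> (\<exists>g X. taylor2 (mollify \<kappa> U) h g X (K * (1 + (norm h)\<^sup>2))))"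
    using mollify_taylor2[OF \<kappa>(1), of "2 * C + 1 / (2 * \<delta>)", where 'a='a] C \<delta>(1) by (auto simp del: times_divide_eq_right) 
  define R where "R = (\<Sum>l\<in>UNIV. norm (a l)) + (\<Sum>l\<in>UNIV. norm (b l))"
  have R0: "0 \<le> R" unfolding R_def by (intro add_nonneg_nonneg sum_nonneg) auto
  have aR: "norm (a l) \<le> R" and bR: "norm (b l) \<le> R" for l
  proof -
    have "norm (a l) \<le> (\<Sum>l\<in>UNIV. norm (a l))" "norm (b l) \<le> (\<Sum>l\<in>UNIV. norm (b l))" by (rule member_le_sum; simp)+
    moreover have "0 \<le> (\<Sum>l\<in>UNIV. norm (a l))" "0 \<le> (\<Sum>l\<in>UNIV. norm (b l))" by (rule sum_nonneg; simp)+
    ultimately show "norm (a l) \<le> R" "norm (b l) \<le> R" unfolding R_def by linarith+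
  qed
  define sa sb where "sa = (\<Sum>l\<in>UNIV. (norm (a l))\<^sup>2)" and "sb = (\<Sum>l\<in>UNIV. (norm (b l))\<^sup>2)"
  have s0: "0 \<le> sa" "0 \<le> sb" unfolding sa_def sb_def by (intro sum_nonneg; simp)+
  define La Lb where "La = 33 * (K * (1 + sa)) * R ^ 3" and "Lb = 33 * (K * (1 + sb)) * R ^ 3"
  have L0: "0 \<le> La" "0 \<le> Lb" using K s0 R0 by (auto simp: La_def Lb_def)
  define \<theta> where "\<theta> = \<eta> / (8 * (1 + sa + sb))"
  have \<theta>: "0 < \<theta>" "\<theta> * sa \<le> \<eta> / 8" "\<theta> * sb \<le> \<eta> / 8" using \<eta> s0 by (auto simp: \<theta>_def field_simps)
  define Y where "Y = (1 + La + Lb) * m * (1 + sa + sb)"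
  have Ypos: "0 < Y" using L0 s0 m by (simp add: Y_def add_nonneg_pos add_pos_nonneg)
  have Y1: "La * m * (1 + sa) \<le> Y" "Lb * m * (1 + sb) \<le> Y" unfolding Y_def using L0 s0 m by (intro mult_mono; simp)+
  define \<rho>0 where "\<rho>0 = min (1 / (2 * R + 1)) (\<eta> / (8 * Y))"
  have \<rho>0: "0 < \<rho>0" using R0 \<eta> Ypos by (simp add: \<rho>0_def)
  obtain N :: nat where N: "m / \<rho>0\<^sup>2 < real N" using reals_Archimedean2 by blast
  define \<rho> where "\<rho> = sqrt (m / real N)"
  have Npos: "0 < real N" using N m \<rho>0 by (meson divide_pos_pos order_less_trans zero_less_power)
  have \<rho>: "0 \<le> \<rho>" "real N * \<rho>\<^sup>2 = m" using m Npos by (auto simp: \<rho>_def)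
  have "\<rho> \<le> \<rho>0"
  proof -
    have "m / real N \<le> \<rho>0\<^sup>2" using N Npos \<rho>0 by (simp add: field_simps)
    then show ?thesis unfolding \<rho>_def using \<rho>0 by (metis abs_of_pos real_sqrt_abs real_sqrt_le_iff)
  qed
  then have \<rho>1: "\<rho> \<le> 1 / (2 * R + 1)" "\<rho> \<le> \<eta> / (8 * Y)" by (auto simp: \<rho>0_def)
  have \<rho>R: "2 * (\<rho> * R) \<le> 1"
  proof -
    have "\<rho> * (2 * R + 1) \<le> 1" using \<rho>1(1) R0 by (simp add: field_simps)
    then show ?thesis using \<rho>(1) by (simp add: algebra_simps)
  qed
  have \<rho>Y: "\<rho> * Y \<le> \<eta> / 8" using \<rho>1(2) Ypos by (simp add: field_simps)
  have err: "\<kappa>\<^sup>2 / (2 * \<delta>) + (\<theta> + La * m * \<rho>) * sa + La * m * \<rho> \<le> 3 * \<eta> / 8"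
    "\<kappa>\<^sup>2 / (2 * \<delta>) + (\<theta> + Lb * m * \<rho>) * sb + Lb * m * \<rho> \<le> 3 * \<eta> / 8"
  proof -
    have "\<rho> * (La * m * (1 + sa)) \<le> \<eta> / 8" "\<rho> * (Lb * m * (1 + sb)) \<le> \<eta> / 8"
      using mult_left_mono[OF Y1(1) \<rho>(1)] mult_left_mono[OF Y1(2) \<rho>(1)] \<rho>Y by linarith+
    then show "\<kappa>\<^sup>2 / (2 * \<delta>) + (\<theta> + La * m * \<rho>) * sa + La * m * \<rho> \<le> 3 * \<eta> / 8"
    "\<kappa>\<^sup>2 / (2 * \<delta>) + (\<theta> + Lb * m * \<rho>) * sb + Lb * m * \<rho> \<le> 3 * \<eta> / 8"
      using \<theta>(2,3) unfolding \<kappa>(2) by (simp_all add: algebra_simps)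
  qed
  note cmp = smoothed_walk_comparison[OF C \<delta>(1,2) \<kappa>(1) K KU \<theta>(1) \<rho>(1) \<rho>(2)[unfolded m_def] _ \<rho>R refl refl]
  obtain Ma where Ma: "\<And>D u \<alpha>. closed D \<Longrightarrow> 0 \<in> D \<Longrightarrow> usc_on D u \<Longrightarrow> u 0 = 0 \<Longrightarrow> (\<forall>h\<in>D. u h \<le> C * (norm h)\<^sup>2) \<Longrightarrow>
    superjets_bound a D u Ma \<alpha> \<Longrightarrow>
    \<alpha> / 2 \<le> (walk (\<lambda>l. \<rho> *\<^sub>R a l) ^^ N) (mollify \<kappa> (sup_convolution \<delta> D u)) 0
      + \<kappa>\<^sup>2 / (2 * \<delta>) + (\<theta> + La * m * \<rho>) * sa + La * m * \<rho>"
    using cmp[of a, OF aR] unfolding La_def sa_def m_def by metis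
  obtain Mb where Mb: "\<And>D u \<alpha>. closed D \<Longrightarrow> 0 \<in> D \<Longrightarrow> usc_on D u \<Longrightarrow> u 0 = 0 \<Longrightarrow> (\<forall>h\<in>D. u h \<le> C * (norm h)\<^sup>2) \<Longrightarrow>
    superjets_bound b D u Mb \<alpha> \<Longrightarrow>
    \<alpha> / 2 \<le> (walk (\<lambda>l. \<rho> *\<^sub>R b l) ^^ N) (mollify \<kappa> (sup_convolution \<delta> D u)) 0
      + \<kappa>\<^sup>2 / (2 * \<delta>) + (\<theta> + Lb * m * \<rho>) * sb + Lb * m * \<rho>"
    using cmp[of b, OF bR] unfolding Lb_def sb_def m_def by metis
  obtain ra where ra: "0 < ra" "\<And>r. 0 < r \<Longrightarrow> r \<le> ra \<Longrightarrow> superjets_bound a (blow_up_domain r x0 D) (blow_up r x0 P u) Ma (\<alpha> - \<eta>)"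
    using blow_up_superjets_bound[OF jets(1) \<eta>] by blast
  obtain rb where rb: "0 < rb" "\<And>r. 0 < r \<Longrightarrow> r \<le> rb \<Longrightarrow> superjets_bound b (blow_up_domain r y0 D') (blow_up r y0 Q v) Mb (\<beta> - \<eta>)"
    using blow_up_superjets_bound[OF jets(2) \<eta>] by blast
  define r where "r = min ra rb"
  have r: "0 < r" "r \<le> ra" "r \<le> rb" using ra rb by (auto simp: r_def)
  define ur vr Dr Dr' where "ur = blow_up r x0 P u" and "vr = blow_up r y0 Q v" and "Dr = blow_up_domain r x0 D" and "Dr' = blow_up_domain r y0 D'"
  have zero: "0 \<in> Dr" "0 \<in> Dr'" "ur 0 = 0" "vr 0 = 0"
    using x0 y0 by (auto simp: Dr_def Dr'_def ur_def vr_def blow_up_domain_def blow_up_def)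
  have uv: "ur h + vr k \<le> (norm (A (h - k)))\<^sup>2 / 2" if "h \<in> Dr" "k \<in> Dr'" for h k
  proof -
    have "u (x0 + r *\<^sub>R h) + v (y0 + r *\<^sub>R k) \<le> u x0 + v y0 + P \<bullet> (r *\<^sub>R h) + Q \<bullet> (r *\<^sub>R k) + (norm (A (r *\<^sub>R h - r *\<^sub>R k)))\<^sup>2 / 2"
      using max[of "x0 + r *\<^sub>R h" "y0 + r *\<^sub>R k"] that by (simp add: Dr_def Dr'_def blow_up_domain_def)
    also have "A (r *\<^sub>R h - r *\<^sub>R k) = r *\<^sub>R A (h - k)" by (simp add: linear_scale[OF A(1)] flip: scaleR_diff_right)
    finally have "r\<^sup>2 * ur h + r\<^sup>2 * vr k \<le> r\<^sup>2 * ((norm (A (h - k)))\<^sup>2 / 2)"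
      using r blow_up_eq[of r u x0 h P] blow_up_eq[of r v y0 k Q] by (simp add: ur_def vr_def power_mult_distrib)
    then have "r\<^sup>2 * (ur h + vr k) \<le> r\<^sup>2 * ((norm (A (h - k)))\<^sup>2 / 2)" by (simp add: distrib_left)
    then show ?thesis using r by simp
  qed
  have normA: "(norm (A h))\<^sup>2 / 2 \<le> C * (norm h)\<^sup>2" for h
    using power_mono[OF A(2)[of h], of 2] by (simp add: C_def power_mult_distrib)
  have uC: "\<forall>h\<in>Dr. ur h \<le> C * (norm h)\<^sup>2" 
  proof
    fix h assume "h \<in> Dr" from uv[OF this zero(2)] normA[of h] zero show "ur h \<le> C * (norm h)\<^sup>2" by simp
  qed
  have vC: "\<forall>h\<in>Dr'. vr h \<le> C * (norm h)\<^sup>2"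
  proof
    fix h assume "h \<in> Dr'" from uv[OF zero(1) this] normA[of "- h"] zero show "vr h \<le> C * (norm h)\<^sup>2" by simp
  qed
  have cl: "closed Dr" "closed Dr'" and us: "usc_on Dr ur" "usc_on Dr' vr"
    unfolding Dr_def Dr'_def ur_def vr_def using closed_blow_up_domain D blow_up_usc usc r(1) by auto
  define U V where "U = sup_convolution \<delta> Dr ur" and "V = sup_convolution \<delta> Dr' vr"
  have Uc: "continuous_on UNIV U" "continuous_on UNIV V" unfolding U_def V_def
    by (rule sup_convolution_continuous[OF C \<delta>(1,2)]; use uC vC zero in blast)+
  have UV: "U h + V k \<le> (1 + \<tau>) / 2 * (norm (A (h - k)))\<^sup>2" for h k
    unfolding U_def V_def by (rule sup_convolution_coupled[OF A \<tau>(1) \<delta>(1,3)]) (use zero uv in auto)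
  have MUV: "mollify \<kappa> U h + mollify \<kappa> V k \<le> (1 + \<tau>) / 2 * (norm (A (h - k)))\<^sup>2" for h k
    by (rule mollify_coupled[OF \<kappa>(1) Uc UV])
  define Wa Wb where "Wa = (walk (\<lambda>l. \<rho> *\<^sub>R a l) ^^ N) (mollify \<kappa> U) 0" and "Wb = (walk (\<lambda>l. \<rho> *\<^sub>R b l) ^^ N) (mollify \<kappa> V) 0"
  have "Wa + Wb \<le> (1 + \<tau>) / 2 * ((norm (A (0 - 0)))\<^sup>2 + real N * ((\<Sum>l\<in>UNIV. (norm (A (\<rho> *\<^sub>R a l - \<rho> *\<^sub>R b l)))\<^sup>2) / real CARD('l)))"
    unfolding Wa_def Wb_def using \<tau> by (intro walk_coupled[OF A(1) MUV]) auto
  also have "(\<Sum>l\<in>UNIV. (norm (A (\<rho> *\<^sub>R a l - \<rho> *\<^sub>R b l)))\<^sup>2) = \<rho>\<^sup>2 * B"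
    by (simp add: B_def sum_distrib_left power_mult_distrib linear_scale[OF A(1)] flip: scaleR_diff_right)
  also have "real N * (\<rho>\<^sup>2 * B / real CARD('l)) = B" using \<rho>(2) m by (simp add: m_def flip: mult.assoc)
  finally have W: "Wa + Wb \<le> (1 + \<tau>) / 2 * B" by (simp add: linear_0[OF A(1)])
  have "(\<alpha> - \<eta>) / 2 \<le> Wa + 3 * \<eta> / 8"
    using Ma[OF cl(1) zero(1) us(1) zero(3) uC, of "\<alpha> - \<eta>"] ra(2)[OF r(1,2)] err(1) by (simp add: Wa_def U_def ur_def Dr_def)
  moreover have "(\<beta> - \<eta>) / 2 \<le> Wb + 3 * \<eta> / 8"
    using Mb[OF cl(2) zero(2) us(2) zero(4) vC, of "\<beta> - \<eta>"] rb(2)[OF r(1,3)] err(2) by (simp add: Wb_def V_def vr_def Dr'_def)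
  moreover have "2 * ((1 + \<tau>) / 2 * B) = B + \<tau> * B" by (simp add: algebra_simps)
  ultimately have "\<alpha> + \<beta> \<le> B + 5 * \<eta>" using W \<tau>(2) \<eta> by argo
  moreover have "\<alpha> + \<beta> = B + 8 * \<eta>" by (simp add: \<eta>_def field_simps)
  ultimately show False using \<eta> by linarith
qed

section \<open>Parabolic jets\<close>

text \<open>
  The remainder function is the positive part of the difference of the two sides.
\<close>

lemma superjetI:
  fixes u :: "real \<Rightarrow> real ^ 'k \<Rightarrow> real"
  assumes M: "transpose M = M"
    and bound: "\<And>\<epsilon>. 0 < \<epsilon> \<Longrightarrow> \<exists>\<delta>>0. \<forall>\<tau> d. t + \<tau> \<in> {0..T} \<longrightarrow> \<bar>\<tau>\<bar> < \<delta> \<longrightarrow> norm d < \<delta> \<longrightarrow>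
      u (t + \<tau>) (x + d) \<le> u t x + p * \<tau> + q \<bullet> d + (d \<bullet> (M *v d)) / 2 + \<epsilon> * (\<bar>\<tau>\<bar> + (norm d)\<^sup>2)"
  shows "(p, q, M) \<in> superjet T u t x"
proof -
  define Q where "Q = (\<lambda>t' x'. u t x + p * (t' - t) + q \<bullet> (x' - x) + 1/2 * ((x' - x) \<bullet> (M *v (x' - x))))"
  define r where "r = (\<lambda>(t', x'). max 0 (u t' x' - Q t' x'))"
  have "r \<in> o[at (t, x) within dom_T T](\<lambda>(t', x'). \<bar>t' - t\<bar> + (norm (x' - x))\<^sup>2)"
  proof (rule landau_o.smallI)
    fix c :: real assume "0 < c"
    from bound[OF this] obtain \<delta> where \<delta>: "0 < \<delta>" and b: "\<And>\<tau> d. t + \<tau> \<in> {0..T} \<Longrightarrow> \<bar>\<tau>\<bar> < \<delta> \<Longrightarrow> norm d < \<delta> \<Longrightarrow>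
      u (t + \<tau>) (x + d) \<le> u t x + p * \<tau> + q \<bullet> d + (d \<bullet> (M *v d)) / 2 + c * (\<bar>\<tau>\<bar> + (norm d)\<^sup>2)" by metis
    show "\<forall>\<^sub>F z in at (t, x) within dom_T T. norm (r z) \<le> c * norm (case z of (t', x') \<Rightarrow> \<bar>t' - t\<bar> + (norm (x' - x))\<^sup>2)"
      unfolding eventually_at
    proof (intro exI[of _ \<delta>] conjI ballI impI \<delta>)
      fix z assume z: "z \<in> dom_T T" "z \<noteq> (t, x) \<and> dist z (t, x) < \<delta>"
      obtain t' x' where zz: "z = (t', x')" by (cases z)
      have "\<bar>t' - t\<bar> < \<delta>" "norm (x' - x) < \<delta>"
        using z dist_fst_le[of z "(t, x)"] dist_snd_le[of z "(t, x)"] by (auto simp: zz dist_real_def dist_norm)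
      then have "u t' x' \<le> Q t' x' + c * (\<bar>t' - t\<bar> + (norm (x' - x))\<^sup>2)"
        using b[of "t' - t" "x' - x"] z by (simp add: zz Q_def)
      moreover have "0 \<le> c * (\<bar>t' - t\<bar> + (norm (x' - x))\<^sup>2)" using \<open>0 < c\<close> by simp
      ultimately show "norm (r z) \<le> c * norm (case z of (t', x') \<Rightarrow> \<bar>t' - t\<bar> + (norm (x' - x))\<^sup>2)"
        by (simp add: zz r_def)
    qed
  qed
  moreover have "u t' x' \<le> Q t' x' + r (t', x')" for t' x' by (simp add: r_def)
  ultimately show ?thesis using M unfolding superjet_def Q_def by fastforce
qed

lemma superjet_subset_closure:
  assumes "t \<in> {0..T}" "(p, q, M) \<in> superjet T u t x"
  shows "(p, q, M) \<in> superjet_closure T u t x"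
  unfolding superjet_closure_def jet_closure_def mem_Collect_eq case_prod_conv
  by (rule exI[of _ "\<lambda>_. t"], rule exI[of _ "\<lambda>_. x"], rule exI[of _ "\<lambda>_. p"], rule exI[of _ "\<lambda>_. q"], rule exI[of _ "\<lambda>_. M"])
    (use assms in simp)

lemma uminus_matrix_vector_mult: "(- M) *v x = - (M *v (x :: real ^ 'n))" for M :: "real ^ 'n ^ 'm"
  by (simp add: matrix_vector_mult_def vec_eq_iff sum_negf)

lemma superjet_uminus:
  fixes w :: "real \<Rightarrow> real ^ 'k \<Rightarrow> real"
  assumes "(p, q, M) \<in> superjet T (\<lambda>t x. - w t x) t x"
  shows "(- p, - q, - M) \<in> subjet T w t x"
proof -
  from assms obtain r where M: "transpose M = M" and r: "r \<in> o[at (t, x) within dom_T T](\<lambda>(t', x'). \<bar>t' - t\<bar> + (norm (x' - x))\<^sup>2)"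
    and le: "\<And>t' x'. t' \<in> {0..T} \<Longrightarrow> - w t' x' \<le> - w t x + p * (t' - t) + q \<bullet> (x' - x)
        + 1/2 * ((x' - x) \<bullet> (M *v (x' - x))) + r (t', x')"
    by (auto simp: superjet_def)
  have "transpose (- M) = - M" using M by (simp add: transpose_def vec_eq_iff)
  moreover have "(\<lambda>z. - r z) \<in> o[at (t, x) within dom_T T](\<lambda>(t', x'). \<bar>t' - t\<bar> + (norm (x' - x))\<^sup>2)" using r by simp
  moreover have "w t' x' \<ge> w t x + (- p) * (t' - t) + (- q) \<bullet> (x' - x)
        + 1/2 * ((x' - x) \<bullet> ((- M) *v (x' - x))) + - r (t', x')" if "t' \<in> {0..T}" for t' x'
    using le[OF that, of x'] by (simp add: uminus_matrix_vector_mult)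
  ultimately show ?thesis unfolding subjet_def mem_Collect_eq case_prod_conv
    by (intro conjI bexI[of _ "\<lambda>z. - r z"] ballI allI) auto
qed

lemma superjet_closure_uminus:
  fixes w :: "real \<Rightarrow> real ^ 'k \<Rightarrow> real"
  assumes "(p, q, M) \<in> superjet_closure T (\<lambda>t x. - w t x) t x"
  shows "(- p, - q, - M) \<in> subjet_closure T w t x"
proof -
  from assms obtain tn xn pn qn Mn where
    *: "\<And>n::nat. tn n \<in> {0..T} \<and> (pn n, qn n, Mn n) \<in> superjet T (\<lambda>t x. - w t x) (tn n) (xn n)"
    "tn \<longlonglongrightarrow> t" "xn \<longlonglongrightarrow> x" "(\<lambda>n. - w (tn n) (xn n)) \<longlonglongrightarrow> - w t x" "pn \<longlonglongrightarrow> p" "qn \<longlonglongrightarrow> q" "Mn \<longlonglongrightarrow> M"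
    unfolding superjet_closure_def jet_closure_def by blast
  have "(\<forall>n. tn n \<in> {0..T} \<and> (- pn n, - qn n, - Mn n) \<in> subjet T w (tn n) (xn n))"
    using *(1) superjet_uminus by blast
  moreover have "(\<lambda>n. w (tn n) (xn n)) \<longlonglongrightarrow> w t x" using tendsto_minus[OF *(4)] by simp
  moreover have "(\<lambda>n. - pn n) \<longlonglongrightarrow> - p" "(\<lambda>n. - qn n) \<longlonglongrightarrow> - q" "(\<lambda>n. - Mn n) \<longlonglongrightarrow> - M"
    using * by (auto intro: tendsto_minus)
  ultimately show ?thesis
    unfolding subjet_closure_def jet_closure_def mem_Collect_eq case_prod_conv
    by (intro exI[of _ tn] exI[of _ xn] exI[of _ "\<lambda>n. - pn n"] exI[of _ "\<lambda>n. - qn n"] exI[of _ "\<lambda>n. - Mn n"] conjI *(2,3)) auto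
qed

definition parabolic_expansion ::
  "(real \<Rightarrow> real ^ 'k \<Rightarrow> real) \<Rightarrow> real \<Rightarrow> real ^ 'k \<Rightarrow> real \<Rightarrow> real ^ 'k \<Rightarrow> real ^ 'k ^ 'k \<Rightarrow> bool"
  where "parabolic_expansion \<phi> t x p q M \<longleftrightarrow> transpose M = M \<and>
    (\<forall>\<epsilon>>0. \<exists>\<delta>>0. \<forall>\<tau> d. \<bar>\<tau>\<bar> < \<delta> \<longrightarrow> norm d < \<delta> \<longrightarrow>
      \<phi> (t + \<tau>) (x + d) \<le> \<phi> t x + p * \<tau> + q \<bullet> d + (d \<bullet> (M *v d)) / 2 + \<epsilon> * (\<bar>\<tau>\<bar> + (norm d)\<^sup>2))"

text \<open>
  The part of a quadratic form on time and space that a parabolic jet sees.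
\<close>

definition space_block :: "(real \<times> (real ^ 'k) \<Rightarrow> real \<times> (real ^ 'k)) \<Rightarrow> real ^ 'k ^ 'k"
  where "space_block X = matrix (\<lambda>d. snd (X (0, d)))"

lemma space_block_works:
  assumes "linear X" shows "space_block X *v d = snd (X (0, d))"
proof -
  have "linear (\<lambda>d. snd (X (0, d)))"
  proof (rule linearI)
    fix x y :: "real ^ 'a" and c :: real
    show "snd (X (0, x + y)) = snd (X (0, x)) + snd (X (0, y))"
      using linear_add[OF assms, of "(0, x)" "(0, y)"] by (metis add.right_neutral add_Pair snd_add)
    show "snd (X (0, c *\<^sub>R x)) = c *\<^sub>R snd (X (0, x))"
      using linear_scale[OF assms, of c "(0, x)"] by (metis scaleR_Pair scaleR_zero_right snd_scaleR)
  qed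
  then show ?thesis unfolding space_block_def by (simp add: matrix_works)
qed

lemma transpose_space_block:
  assumes "symmetric_op X" shows "transpose (space_block X) = space_block X"
proof -
  have "snd (X (0, axis i 1)) $ j = snd (X (0, axis j 1)) $ i" for i j :: 'a
  proof -
    have "(0, axis j 1) \<bullet> X (0, axis i 1) = X (0, axis j 1) \<bullet> (0, axis i 1)" using assms by (auto simp: symmetric_op_def)
    then show ?thesis by (simp add: inner_prod_def inner_axis inner_axis' )
  qed
  then show ?thesis by (simp add: transpose_def space_block_def matrix_def vec_eq_iff)
qed

lemma norm_Pair_cube_le:
  fixes d :: "'a::real_normed_vector"
  assumes "\<bar>\<tau>\<bar> \<le> \<delta>" "norm d \<le> \<delta>" "\<delta> \<le> 1"
  shows "norm (\<tau>, d) ^ 3 \<le> 2 * \<delta> * (\<bar>\<tau>\<bar> + (norm d)\<^sup>2)"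
proof -
  have "norm (\<tau>, d) \<le> 2 * \<delta>" using norm_Pair_le[of \<tau> d] assms by simp
  moreover have "(norm (\<tau>, d))\<^sup>2 \<le> \<bar>\<tau>\<bar> + (norm d)\<^sup>2"
  proof -
    have "\<tau>\<^sup>2 \<le> \<bar>\<tau>\<bar> * 1" using assms unfolding power2_eq_square abs_mult_self_eq[of \<tau>, symmetric] by (intro mult_left_mono) auto
    then show ?thesis by (simp add: norm_Pair)
  qed
  ultimately have "norm (\<tau>, d) * (norm (\<tau>, d))\<^sup>2 \<le> (2 * \<delta>) * (\<bar>\<tau>\<bar> + (norm d)\<^sup>2)"
    using assms by (intro mult_mono) auto
  then show ?thesis by (simp add: power2_eq_square power3_eq_cube)
qed

text \<open>
  A touching function of second order in time and space jointly yields a parabolic jet, because the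
  terms of the quadratic form that involve the time increment \<open>\<tau>\<close> are \<open>o(\<bar>\<tau>\<bar>)\<close>.
\<close>

lemma touching_superjet:
  fixes v \<psi> :: "real \<Rightarrow> real ^ 'k \<Rightarrow> real"
  assumes X: "symmetric_op X" "\<And>d. norm (X d) \<le> M * norm d" and r: "0 < r"
    and touch: "\<And>d. norm d \<le> r \<Longrightarrow> fst ((t, x) + d) \<in> {0..T} \<Longrightarrow>
      v (fst ((t, x) + d)) (snd ((t, x) + d)) - \<psi> (fst ((t, x) + d)) (snd ((t, x) + d))
      \<le> v t x - \<psi> t x + p \<bullet> d + (d \<bullet> X d) / 2 + K * norm d ^ 3"
    and \<psi>: "parabolic_expansion \<psi> t x ct cx cxx"
  shows "(fst p + ct, snd p + cx, space_block X + cxx) \<in> superjet T v t x"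
proof (rule superjetI)
  have lin: "linear X" using X by (simp add: symmetric_op_def)
  show "transpose (space_block X + cxx) = space_block X + cxx"
    using transpose_space_block[OF X(1)] \<psi> unfolding parabolic_expansion_def
    by (simp add: transpose_def vec_eq_iff)
  fix \<epsilon> :: real assume \<epsilon>: "0 < \<epsilon>"
  have M: "0 \<le> M"
    using order_trans[OF norm_ge_zero X(2)[of "(1, 0)"]] by (simp add: norm_Pair)
  obtain \<delta>1 where \<delta>1: "0 < \<delta>1" and e1: "\<And>\<tau> d. \<bar>\<tau>\<bar> < \<delta>1 \<Longrightarrow> norm d < \<delta>1 \<Longrightarrow>
      \<psi> (t + \<tau>) (x + d) \<le> \<psi> t x + ct * \<tau> + cx \<bullet> d + (d \<bullet> (cxx *v d)) / 2 + (\<epsilon> / 2) * (\<bar>\<tau>\<bar> + (norm d)\<^sup>2)"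
    using \<psi> \<epsilon> unfolding parabolic_expansion_def by (meson half_gt_zero)
  define L where "L = 2 * M + 2 * \<bar>K\<bar> + 1"
  have L: "0 < L" using M by (simp add: L_def add_nonneg_pos)
  define \<delta> where "\<delta> = min \<delta>1 (min 1 (min (r / 2) (\<epsilon> / (2 * L))))"
  have \<delta>: "0 < \<delta>" "\<delta> \<le> \<delta>1" "\<delta> \<le> 1" "2 * \<delta> \<le> r" "L * \<delta> \<le> \<epsilon> / 2"
  proof -
    show "0 < \<delta>" using \<delta>1 r \<epsilon> L by (simp add: \<delta>_def)
    have "\<delta> \<le> r / 2" "\<delta> \<le> \<epsilon> / (2 * L)" by (simp_all add: \<delta>_def)
    then show "2 * \<delta> \<le> r" "L * \<delta> \<le> \<epsilon> / 2" using L by (simp_all add: pos_le_divide_eq mult_ac)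
  qed (simp_all add: \<delta>_def)
  show "\<exists>\<delta>>0. \<forall>\<tau> d. t + \<tau> \<in> {0..T} \<longrightarrow> \<bar>\<tau>\<bar> < \<delta> \<longrightarrow> norm d < \<delta> \<longrightarrow>
      v (t + \<tau>) (x + d) \<le> v t x + (fst p + ct) * \<tau> + (snd p + cx) \<bullet> d + (d \<bullet> ((space_block X + cxx) *v d)) / 2 + \<epsilon> * (\<bar>\<tau>\<bar> + (norm d)\<^sup>2)"
  proof (intro exI[of _ \<delta>] conjI \<delta> allI impI)
    fix \<tau> :: real and d :: "real ^ 'k" assume t: "t + \<tau> \<in> {0..T}" and \<tau>: "\<bar>\<tau>\<bar> < \<delta>" and d: "norm d < \<delta>"
    define S where "S = \<bar>\<tau>\<bar> + (norm d)\<^sup>2"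
    have S: "0 \<le> S" "\<bar>\<tau>\<bar> \<le> S" by (auto simp: S_def)
    have nd: "norm (\<tau>, d) \<le> 2 * \<delta>" using norm_Pair_le[of \<tau> d] \<tau> d by simp
    have quad: "(y + z) \<bullet> X (y + z) = z \<bullet> X z + (y \<bullet> X y + 2 * (y \<bullet> X z))" for y z
    proof -
      have "z \<bullet> X y = y \<bullet> X z" using X(1) by (metis inner_commute symmetric_op_def)
      then show ?thesis by (simp add: linear_add[OF lin] inner_add_left inner_add_right)
    qed
    have "(\<tau>, d) \<bullet> X (\<tau>, d) = (0, d) \<bullet> X (0, d) + ((\<tau>, 0) \<bullet> X (\<tau>, 0) + 2 * ((\<tau>, 0) \<bullet> X (0, d)))"
      using quad[of "(\<tau>, 0)" "(0, d)"] by simp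
    moreover have "(0, d) \<bullet> X (0, d) = d \<bullet> (space_block X *v d)" by (simp add: space_block_works[OF lin] inner_prod_def)
    moreover have "(\<tau>, 0) \<bullet> X (\<tau>, 0) \<le> \<bar>\<tau>\<bar> * (M * \<delta>)"
    proof -
      have "(\<tau>, 0) \<bullet> X (\<tau>, 0) \<le> norm (\<tau>, 0 :: real ^ 'k) * norm (X (\<tau>, 0))" by (rule norm_cauchy_schwarz)
      also have "\<dots> \<le> \<bar>\<tau>\<bar> * (M * \<delta>)" using \<tau> M order_trans[OF X(2)[of "(\<tau>, 0)"], of "M * \<delta>"]
        by (intro mult_mono) (auto simp: norm_Pair mult_left_mono)
      finally show ?thesis .
    qed
    moreover have "(\<tau>, 0) \<bullet> X (0, d) \<le> \<bar>\<tau>\<bar> * (M * \<delta>)"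
    proof -
      have "(\<tau>, 0) \<bullet> X (0, d) \<le> norm (\<tau>, 0 :: real ^ 'k) * norm (X (0, d))" by (rule norm_cauchy_schwarz)
      also have "\<dots> \<le> \<bar>\<tau>\<bar> * (M * \<delta>)" using d M order_trans[OF X(2)[of "(0, d)"], of "M * \<delta>"]
        by (intro mult_mono) (auto simp: norm_Pair mult_left_mono)
      finally show ?thesis .
    qed
    moreover have "\<bar>\<tau>\<bar> * (M * \<delta>) \<le> S * (M * \<delta>)" using S M \<delta> by (intro mult_right_mono) auto
    moreover have "0 \<le> S * (M * \<delta>)" using S M \<delta> by simp
    ultimately have q: "((\<tau>, d) \<bullet> X (\<tau>, d)) / 2 \<le> (d \<bullet> (space_block X *v d)) / 2 + 2 * (S * (M * \<delta>))"
      by linarith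
    have "K * norm (\<tau>, d) ^ 3 \<le> \<bar>K\<bar> * norm (\<tau>, d) ^ 3" by (intro mult_right_mono) auto
    also have "\<dots> \<le> \<bar>K\<bar> * (2 * \<delta> * S)" unfolding S_def using \<tau> d \<delta> by (intro mult_left_mono norm_Pair_cube_le) auto
    finally have c: "K * norm (\<tau>, d) ^ 3 \<le> 2 * \<bar>K\<bar> * \<delta> * S" by simp
    have "v (t + \<tau>) (x + d) - \<psi> (t + \<tau>) (x + d) \<le> v t x - \<psi> t x + p \<bullet> (\<tau>, d) + ((\<tau>, d) \<bullet> X (\<tau>, d)) / 2 + K * norm (\<tau>, d) ^ 3"
      using touch[of "(\<tau>, d)"] nd \<delta> t by simp
    moreover have "p \<bullet> (\<tau>, d) = fst p * \<tau> + snd p \<bullet> d" by (simp add: inner_prod_def)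
    moreover have "\<psi> (t + \<tau>) (x + d) \<le> \<psi> t x + ct * \<tau> + cx \<bullet> d + (d \<bullet> (cxx *v d)) / 2 + (\<epsilon> / 2) * S"
      using e1[of \<tau> d] \<tau> d \<delta> by (simp add: S_def)
    moreover have "2 * (S * (M * \<delta>)) + 2 * \<bar>K\<bar> * \<delta> * S \<le> (\<epsilon> / 2) * S"
    proof -
      have "2 * (S * (M * \<delta>)) + 2 * \<bar>K\<bar> * \<delta> * S \<le> (L * \<delta>) * S" using S \<delta> unfolding L_def by (simp add: algebra_simps)
      also have "\<dots> \<le> (\<epsilon> / 2) * S" using \<delta> S by (intro mult_right_mono) auto
      finally show ?thesis .
    qed
    moreover have "(\<epsilon> / 2) * S + (\<epsilon> / 2) * S = \<epsilon> * S" by simp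
    moreover have "(fst p + ct) * \<tau> + (snd p + cx) \<bullet> d + (d \<bullet> ((space_block X + cxx) *v d)) / 2
       = (fst p * \<tau> + snd p \<bullet> d) + (ct * \<tau> + cx \<bullet> d) + ((d \<bullet> (space_block X *v d)) / 2 + (d \<bullet> (cxx *v d)) / 2)"
      by (simp add: matrix_vector_mult_add_rdistrib inner_add_left inner_add_right distrib_right add_divide_distrib)
    ultimately have "v (t + \<tau>) (x + d) \<le> v t x + (fst p + ct) * \<tau> + (snd p + cx) \<bullet> d + (d \<bullet> ((space_block X + cxx) *v d)) / 2 + \<epsilon> * S"
      using q c by linarith
    then show "v (t + \<tau>) (x + d) \<le> v t x + (fst p + ct) * \<tau> + (snd p + cx) \<bullet> d + (d \<bullet> ((space_block X + cxx) *v d)) / 2 + \<epsilon> * (\<bar>\<tau>\<bar> + (norm d)\<^sup>2)"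
      by (simp add: S_def)
  qed
qed

lemma bounded_space_blocks:
  fixes X :: "nat \<Rightarrow> real \<times> (real ^ 'k) \<Rightarrow> real \<times> (real ^ 'k)"
  assumes "\<And>n d. norm (X n d) \<le> M * norm d"
  shows "bounded (range (\<lambda>n. space_block (X n)))"
  unfolding bounded_iff
proof (intro exI ballI)
  fix Y assume "Y \<in> range (\<lambda>n. space_block (X n))"
  then obtain n where Y: "Y = space_block (X n)" by blast
  have entry: "\<bar>Y $ i $ j\<bar> \<le> M" for i j
  proof -
    have "Y $ i $ j = snd (X n (0, axis j 1)) $ i" by (simp add: Y space_block_def matrix_def)
    also have "\<bar>\<dots>\<bar> \<le> norm (snd (X n (0, axis j 1)))" by (rule component_le_norm_cart)
    also have "\<dots> \<le> norm (X n (0, axis j 1))" by (metis norm_snd_le prod.collapse)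
    also have "\<dots> \<le> M" using assms[of n "(0, axis j 1)"] by (simp add: norm_Pair)
    finally show ?thesis .
  qed
  have "norm Y \<le> (\<Sum>i\<in>UNIV. norm (Y $ i))" unfolding norm_vec_def[of Y] by (rule L2_set_le_sum) simp
  also have "\<dots> \<le> (\<Sum>i\<in>(UNIV::'k set). \<Sum>j\<in>(UNIV::'k set). M)"
    by (intro sum_mono order_trans[OF norm_le_l1_cart]) (rule entry)
  finally show "norm Y \<le> (\<Sum>i\<in>(UNIV::'k set). \<Sum>j\<in>(UNIV::'k set). M)" .
qed

text \<open>
  Bounded Hessians have convergent subsequences, so superjets violating the bound along a sequence
  of radii tending to \<open>0\<close> would produce an element of the closure that violates it. Subtracting a smooth
  function \<open>\<psi>\<close> shifts all jets by its derivatives.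
\<close>

lemma limiting_superjets_bound_from_closure:
  fixes v \<psi> :: "real \<Rightarrow> real ^ 'k \<Rightarrow> real" and c :: "'l::finite \<Rightarrow> real ^ 'k"
  assumes D: "D = dom_T T \<inter> cball z \<rho>" and x0: "t0 \<in> {0..T}" "dist z (t0, x0) < \<rho>"
    and cont: "continuous_on UNIV (\<lambda>(t, x). \<psi> t x)" "continuous_on UNIV (\<lambda>(t, x). ct t x)" 
      "continuous_on UNIV (\<lambda>(t, x). cx t x)" "continuous_on UNIV (\<lambda>(t, x). cxx t x)"
    and \<psi>: "\<And>t x. parabolic_expansion \<psi> t x (ct t x) (cx t x) (cxx t x)"
    and jets: "\<And>M. (fst P + ct t0 x0, snd P + cx t0 x0, M) \<in> superjet_closure T v t0 x0 \<Longrightarrow> \<gamma> \<le> (\<Sum>l\<in>UNIV. c l \<bullet> (M *v c l))"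
  shows "limiting_superjets_bound (\<lambda>l. (0, c l)) D (\<lambda>(t, x). v t x - \<psi> t x) (t0, x0) P
    (\<gamma> - (\<Sum>l\<in>UNIV. c l \<bullet> (cxx t0 x0 *v c l)))"
  unfolding limiting_superjets_bound_def
proof (intro allI impI, rule ccontr)
  define \<alpha> where "\<alpha> = \<gamma> - (\<Sum>l\<in>UNIV. c l \<bullet> (cxx t0 x0 *v c l))"
  define V where "V = (\<lambda>(t, x). v t x - \<psi> t x)"
  fix M \<eta> :: real assume \<eta>: "0 < \<eta>"
  define bad where "bad \<epsilon> x p X K r \<longleftrightarrow> x \<in> D \<and> 0 < r \<and> norm (x - (t0, x0)) \<le> \<epsilon> \<and> \<bar>V x - V (t0, x0)\<bar> \<le> \<epsilon> \<and> norm (p - P) \<le> \<epsilon> \<and>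
    symmetric_op X \<and> (\<forall>d. norm (X d) \<le> M * norm d) \<and>
    (\<forall>d. norm d \<le> r \<longrightarrow> x + d \<in> D \<longrightarrow> V (x + d) \<le> V x + p \<bullet> d + (d \<bullet> X d) / 2 + K * norm d ^ 3) \<and>
    (\<Sum>l\<in>UNIV. (0, c l) \<bullet> X (0, c l)) < \<alpha> - \<eta>" for \<epsilon> x p X K r
  assume "\<not> (\<exists>\<epsilon>>0. \<forall>x\<in>D. \<forall>p X K r. 0 < r \<longrightarrow> norm (x - (t0, x0)) \<le> \<epsilon> \<longrightarrow>
      \<bar>(case x of (t, x) \<Rightarrow> v t x - \<psi> t x) - (case (t0, x0) of (t, x) \<Rightarrow> v t x - \<psi> t x)\<bar> \<le> \<epsilon> \<longrightarrow> norm (p - P) \<le> \<epsilon> \<longrightarrow>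
      symmetric_op X \<longrightarrow> (\<forall>d. norm (X d) \<le> M * norm d) \<longrightarrow>
      (\<forall>d. norm d \<le> r \<longrightarrow> x + d \<in> D \<longrightarrow> (case x + d of (t, x) \<Rightarrow> v t x - \<psi> t x) \<le> (case x of (t, x) \<Rightarrow> v t x - \<psi> t x) + p \<bullet> d + (d \<bullet> X d) / 2 + K * norm d ^ 3) \<longrightarrow>
      \<gamma> - (\<Sum>l\<in>UNIV. c l \<bullet> (cxx t0 x0 *v c l)) - \<eta> \<le> (\<Sum>l\<in>UNIV. (0, c l) \<bullet> X (0, c l)))"
  then have bad: "\<exists>x p X K r. bad \<epsilon> x p X K r" if "0 < \<epsilon>" for \<epsilon>
    using that unfolding bad_def V_def \<alpha>_def not_le[symmetric] by blast
  define \<rho>' where "\<rho>' = \<rho> - dist z (t0, x0)"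
  have \<rho>': "0 < \<rho>'" using x0 by (simp add: \<rho>'_def)
  define \<epsilon> where "\<epsilon> n = min (\<rho>' / 2) (1 / real (Suc n))" for n
  have \<epsilon>: "0 < \<epsilon> n" for n using \<rho>' by (simp add: \<epsilon>_def)
  have \<epsilon>0: "\<epsilon> \<longlonglongrightarrow> 0"
  proof (rule tendsto_sandwich[OF _ _ tendsto_const LIMSEQ_inverse_real_of_nat])
    show "\<forall>\<^sub>F n in sequentially. 0 \<le> \<epsilon> n" using \<epsilon> by (simp add: less_imp_le)
    show "\<forall>\<^sub>F n in sequentially. \<epsilon> n \<le> inverse (real (Suc n))" by (simp add: \<epsilon>_def inverse_eq_divide)
  qed
  have "\<forall>n. \<exists>x p X K r. bad (\<epsilon> n) x p X K r" using bad \<epsilon> by blast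
  then obtain xn pn Xn Kn rn where B: "\<And>n. bad (\<epsilon> n) (xn n) (pn n) (Xn n) (Kn n) (rn n)" by metis
  have xD: "xn n \<in> D" "0 < rn n" "norm (xn n - (t0, x0)) \<le> \<epsilon> n" "\<bar>V (xn n) - V (t0, x0)\<bar> \<le> \<epsilon> n" "norm (pn n - P) \<le> \<epsilon> n"
    "symmetric_op (Xn n)" "\<And>d. norm (Xn n d) \<le> M * norm d"
    "\<And>d. norm d \<le> rn n \<Longrightarrow> xn n + d \<in> D \<Longrightarrow> V (xn n + d) \<le> V (xn n) + pn n \<bullet> d + (d \<bullet> Xn n d) / 2 + Kn n * norm d ^ 3"
    "(\<Sum>l\<in>UNIV. (0, c l) \<bullet> Xn n (0, c l)) < \<alpha> - \<eta>" for n
    using B[of n] unfolding bad_def by auto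
  define tn yn where "tn n = fst (xn n)" and "yn n = snd (xn n)" for n
  have xn: "xn n = (tn n, yn n)" for n by (simp add: tn_def yn_def)
  have tn: "tn n \<in> {0..T}" for n using xD(1)[of n] by (auto simp: D xn)
  have lim: "xn \<longlonglongrightarrow> (t0, x0)" 
    by (rule LIM_zero_cancel, rule Lim_null_comparison[OF always_eventually \<epsilon>0]) (use xD(3) in blast)
  have limp: "pn \<longlonglongrightarrow> P" 
    by (rule LIM_zero_cancel, rule Lim_null_comparison[OF always_eventually \<epsilon>0]) (use xD(5) in blast)
  have limV: "(\<lambda>n. V (xn n)) \<longlonglongrightarrow> V (t0, x0)" 
    by (rule LIM_zero_cancel, rule Lim_null_comparison[OF always_eventually \<epsilon>0]) (use xD(4) in simp)
  note contlim = continuous_on_tendsto_compose[OF _ lim UNIV_I, OF _ always_eventually[OF allI[OF UNIV_I]]]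
  have jet: "(fst (pn n) + ct (tn n) (yn n), snd (pn n) + cx (tn n) (yn n), space_block (Xn n) + cxx (tn n) (yn n)) \<in> superjet T v (tn n) (yn n)" for n
  proof (rule touching_superjet[OF xD(6) xD(7) _ _ \<psi>])
    show "0 < min (rn n) (\<rho>' / 2)" using xD(2)[of n] \<rho>' by simp
    fix d assume d: "norm d \<le> min (rn n) (\<rho>' / 2)" and t: "fst ((tn n, yn n) + d) \<in> {0..T}"
    have "dist z (xn n + d) \<le> dist z (t0, x0) + norm (xn n - (t0, x0)) + norm d"
      using dist_triangle[of z "xn n + d" "(t0, x0)"] norm_triangle_ineq[of "xn n - (t0, x0)" d]
      by (simp add: dist_norm[of "(t0, x0)"] norm_minus_commute algebra_simps)
    also have "\<dots> \<le> \<rho>" using xD(3)[of n] d by (simp add: \<epsilon>_def \<rho>'_def min_def split: if_splits)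
    finally have "xn n + d \<in> D" using t by (auto simp: D xn mem_Times_iff)
    from xD(8)[OF _ this] d show "v (fst ((tn n, yn n) + d)) (snd ((tn n, yn n) + d)) - \<psi> (fst ((tn n, yn n) + d)) (snd ((tn n, yn n) + d))
      \<le> v (tn n) (yn n) - \<psi> (tn n) (yn n) + pn n \<bullet> d + (d \<bullet> Xn n d) / 2 + Kn n * norm d ^ 3"
      by (simp add: V_def xn case_prod_unfold)
  qed
  have "bounded (range (\<lambda>n. space_block (Xn n)))" by (rule bounded_space_blocks) (rule xD(7))
  then obtain Y f where f: "strict_mono (f :: nat \<Rightarrow> nat)" and Y: "((\<lambda>n. space_block (Xn n)) \<circ> f) \<longlonglongrightarrow> Y"
    using bounded_imp_convergent_subsequence[of "\<lambda>n. space_block (Xn n)"] by blast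
  note sub = LIMSEQ_subseq_LIMSEQ[OF _ f, unfolded comp_def]
  have "(fst P + ct t0 x0, snd P + cx t0 x0, Y + cxx t0 x0) \<in> superjet_closure T v t0 x0"
    unfolding superjet_closure_def jet_closure_def mem_Collect_eq case_prod_conv
  proof (intro exI conjI allI)
    fix n
    show "tn (f n) \<in> {0..T}" by (rule tn)
    show "(fst (pn (f n)) + ct (tn (f n)) (yn (f n)), snd (pn (f n)) + cx (tn (f n)) (yn (f n)), space_block (Xn (f n)) + cxx (tn (f n)) (yn (f n))) \<in> superjet T v (tn (f n)) (yn (f n))"
      by (rule jet)
  next
    show "(\<lambda>n. tn (f n)) \<longlonglongrightarrow> t0" "(\<lambda>n. yn (f n)) \<longlonglongrightarrow> x0" unfolding tn_def yn_def
      using sub[OF tendsto_fst[OF lim]] sub[OF tendsto_snd[OF lim]] by simp_all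
    have "(\<lambda>n. V (xn n) + (\<lambda>(t, x). \<psi> t x) (xn n)) \<longlonglongrightarrow> V (t0, x0) + (\<lambda>(t, x). \<psi> t x) (t0, x0)"
      by (intro tendsto_add limV contlim cont)
    from sub[OF this] show "(\<lambda>n. v (tn (f n)) (yn (f n))) \<longlonglongrightarrow> v t0 x0" by (simp add: V_def xn)
    have "(\<lambda>n. fst (pn n) + (\<lambda>(t, x). ct t x) (xn n)) \<longlonglongrightarrow> fst P + (\<lambda>(t, x). ct t x) (t0, x0)"
      by (intro tendsto_add tendsto_fst limp contlim cont)
    from sub[OF this] show "(\<lambda>n. fst (pn (f n)) + ct (tn (f n)) (yn (f n))) \<longlonglongrightarrow> fst P + ct t0 x0" by (simp add: xn)
    have "(\<lambda>n. snd (pn n) + (\<lambda>(t, x). cx t x) (xn n)) \<longlonglongrightarrow> snd P + (\<lambda>(t, x). cx t x) (t0, x0)"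
      by (intro tendsto_add tendsto_snd limp contlim cont)
    from sub[OF this] show "(\<lambda>n. snd (pn (f n)) + cx (tn (f n)) (yn (f n))) \<longlonglongrightarrow> snd P + cx t0 x0" by (simp add: xn)
    have "(\<lambda>n. cxx (tn (f n)) (yn (f n))) \<longlonglongrightarrow> cxx t0 x0"
      using sub[OF contlim[OF cont(4)]] by (simp add: xn)
    from tendsto_add[OF Y this] show "(\<lambda>n. space_block (Xn (f n)) + cxx (tn (f n)) (yn (f n))) \<longlonglongrightarrow> Y + cxx t0 x0"
      by (simp add: comp_def)
  qed
  from jets[OF this] have 1: "\<alpha> \<le> (\<Sum>l\<in>UNIV. c l \<bullet> (Y *v c l))"
    by (simp add: \<alpha>_def matrix_vector_mult_add_rdistrib inner_add_right sum.distrib)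
  have mv: "continuous_on UNIV (\<lambda>M :: real ^ 'k ^ 'k. \<Sum>l\<in>UNIV. c l \<bullet> (M *v c l))"
    unfolding matrix_vector_mult_def by (intro continuous_intros)
  have l1: "(\<lambda>n. \<Sum>l\<in>UNIV. c l \<bullet> (space_block (Xn (f n)) *v c l)) \<longlonglongrightarrow> (\<Sum>l\<in>UNIV. c l \<bullet> (Y *v c l))"
    using continuous_on_tendsto_compose[OF mv Y UNIV_I] by (simp add: comp_def)
  have l2: "(\<Sum>l\<in>UNIV. c l \<bullet> (space_block (Xn (f n)) *v c l)) \<le> \<alpha> - \<eta>" for n
    using xD(9)[of "f n"] xD(6)[of "f n"] by (simp add: space_block_works symmetric_op_def inner_prod_def)
  have "(\<Sum>l\<in>UNIV. c l \<bullet> (Y *v c l)) \<le> \<alpha> - \<eta>" using LIMSEQ_le_const2[OF l1, of "\<alpha> - \<eta>"] l2 by blast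
  with 1 \<eta> show False by linarith
qed

lemma compact_dom_cball: "compact (dom_T T \<inter> cball (z :: real \<times> (real ^ 'k)) r)"
  by (intro closed_Int_compact closed_Times) auto

lemma parabolic_expansion_zero: "parabolic_expansion (\<lambda>t x. 0) t x 0 0 0"
  by (auto simp: parabolic_expansion_def transpose_def vec_eq_iff intro!: exI[of _ 1])

text \<open>
  The maximum points of \<open>v\<close> minus steeper and steeper paraboloids centred at \<open>(t0, x0)\<close>. In this way inequalities
  between the components, which the definition of viscosity solutions gives only where jets exist,
  extend to all points by semicontinuity.
\<close>

lemma superjet_dense:
  fixes v :: "real \<Rightarrow> real ^ 'k \<Rightarrow> real"
  assumes v: "usc_on (dom_T T) (\<lambda>(t, x). v t x)" and t0: "t0 \<in> {0..T}"
  shows "\<exists>X. (\<forall>n. X n \<in> dom_T T \<and> (\<exists>p q M. (p, q, M) \<in> superjet T v (fst (X n)) (snd (X n)))) \<and>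
    X \<longlonglongrightarrow> (t0, x0) \<and> (\<lambda>n::nat. v (fst (X n)) (snd (X n))) \<longlonglongrightarrow> v t0 x0"
proof -
  define V where "V = (\<lambda>(t, x). v t x)"
  define z where "z = (t0, x0)"
  define K where "K = dom_T T \<inter> cball z 1"
  have K: "compact K" unfolding K_def by (rule compact_dom_cball)
  have zK: "z \<in> K" using t0 by (simp add: K_def z_def)
  have uV: "usc_on K V" using v by (auto simp: V_def K_def intro: usc_on_subset)
  obtain y where "y \<in> K" and y: "\<And>x. x \<in> K \<Longrightarrow> V x \<le> V y" using usc_on_attains_max[OF K _ uV] zK by blast
  define B where "B = V y - V z + 1"
  have B: "0 < B" using y[OF zK] by (simp add: B_def)
  \<comment> \<open>The factor 4 keeps all maximum points in the ball of radius 1/2, away from the boundary of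
    the unit ball.\<close>
  define c where "c n = 4 * B * real (Suc n)" for n
  have c: "0 < c n" for n using B by (simp add: c_def)
  have "\<exists>x\<in>K. \<forall>y\<in>K. V y - c n * (norm (y - z))\<^sup>2 \<le> V x - c n * (norm (x - z))\<^sup>2" for n
    by (rule usc_on_attains_max[OF K _ usc_on_diff_continuous[OF uV]]) (use zK in \<open>auto intro!: continuous_intros\<close>)
  then obtain X where X: "\<And>n. X n \<in> K" "\<And>n y. y \<in> K \<Longrightarrow> V y - c n * (norm (y - z))\<^sup>2 \<le> V (X n) - c n * (norm (X n - z))\<^sup>2"
    by metis
  have VX: "V z \<le> V (X n) - c n * (norm (X n - z))\<^sup>2" for n using X(2)[OF zK, of n] by simp
  have near: "(norm (X n - z))\<^sup>2 \<le> 1 / (4 * real (Suc n))" for n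
  proof -
    have "c n * (norm (X n - z))\<^sup>2 \<le> B" using VX[of n] y[OF X(1)[of n]] by (simp add: B_def)
    then have "4 * real (Suc n) * (norm (X n - z))\<^sup>2 * B \<le> 1 * B" by (simp add: c_def mult_ac)
    then have "4 * real (Suc n) * (norm (X n - z))\<^sup>2 \<le> 1" using B by (simp only: mult_le_cancel_right_pos)
    then show ?thesis by (simp add: field_simps)
  qed
  have half: "norm (X n - z) \<le> 1 / 2" for n
  proof (rule power2_le_imp_le)
    have "1 / (4 * real (Suc n)) \<le> 1 / 4" by simp
    then have "(norm (X n - z))\<^sup>2 \<le> 1 / 4" using near[of n] by linarith
    also have "1 / 4 = (1 / 2 :: real)\<^sup>2" by (simp add: power2_eq_square)
    finally show "(norm (X n - z))\<^sup>2 \<le> (1 / 2)\<^sup>2" .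
  qed simp
  have "(\<lambda>n. (norm (X n - z))\<^sup>2) \<longlonglongrightarrow> 0"
  proof (rule tendsto_sandwich[OF _ _ tendsto_const])
    show "(\<lambda>n. 1 / (4 * real (Suc n))) \<longlonglongrightarrow> 0" using tendsto_mult[OF tendsto_const[of "1/4"] LIMSEQ_inverse_real_of_nat] by (simp add: inverse_eq_divide)
  qed (use near in auto)
  then have "(\<lambda>n. sqrt ((norm (X n - z))\<^sup>2)) \<longlonglongrightarrow> sqrt 0" by (rule tendsto_real_sqrt)
  then have lim: "X \<longlonglongrightarrow> z" by (simp add: tendsto_norm_zero_iff LIM_zero_iff)
  have limV: "(\<lambda>n. V (X n)) \<longlonglongrightarrow> V z"
  proof (rule order_tendstoI)
    fix a assume "a < V z"
    then have "a < V (X n)" for n using VX[of n] mult_nonneg_nonneg[of "c n" "(norm (X n - z))\<^sup>2"] c[of n] by (smt (verit) zero_le_power2)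
    then show "\<forall>\<^sub>F n in sequentially. a < V (X n)" by simp
  next
    fix a assume "V z < a"
    then show "\<forall>\<^sub>F n in sequentially. V (X n) < a" by (rule usc_on_eventually_less[OF uV X(1) lim zK])
  qed
  have jet: "\<exists>p q M. (p, q, M) \<in> superjet T v (fst (X n)) (snd (X n))" for n
  proof -
    let ?p = "(2 * c n) *\<^sub>R (X n - z)" and ?X = "\<lambda>d. (2 * c n) *\<^sub>R d"
    have "(fst ?p + 0, snd ?p + 0, space_block ?X + 0) \<in> superjet T v (fst (X n)) (snd (X n))"
    proof (rule touching_superjet[where M="2 * c n" and r="1/2" and K=0 and \<psi>="\<lambda>t x. 0"])
      show "symmetric_op ?X" by (intro symmetric_op_scale symmetric_op_id)
      show "norm (?X d) \<le> 2 * c n * norm d" for d using c[of n] by simp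
      show "parabolic_expansion (\<lambda>t x. 0) (fst (X n)) (snd (X n)) 0 0 0" by (rule parabolic_expansion_zero)
      fix d :: "real \<times> (real ^ 'k)" assume d: "norm d \<le> 1 / 2" and t: "fst ((fst (X n), snd (X n)) + d) \<in> {0..T}"
      have "norm (X n + d - z) \<le> 1" using norm_triangle_ineq[of "X n - z" d] half[of n] d by (simp add: algebra_simps)
      then have "X n + d \<in> K" using t by (auto simp: K_def mem_Times_iff dist_norm norm_minus_commute)
      from X(2)[OF this, of n] have le: "V (X n + d) \<le> V (X n) + c n * (norm (X n + d - z))\<^sup>2 - c n * (norm (X n - z))\<^sup>2" by simp
      have "(norm (X n + d - z))\<^sup>2 = (norm ((X n - z) + d))\<^sup>2" by (simp add: algebra_simps)
      also have "\<dots> = (norm (X n - z))\<^sup>2 + 2 * ((X n - z) \<bullet> d) + d \<bullet> d"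
        unfolding power2_norm_eq_inner by (simp add: inner_add_left inner_add_right inner_commute)
      finally have "c n * (norm (X n + d - z))\<^sup>2 = c n * (norm (X n - z))\<^sup>2 + 2 * (c n * ((X n - z) \<bullet> d)) + c n * (d \<bullet> d)"
        by (simp add: distrib_left)
      moreover have "?p \<bullet> d = 2 * (c n * ((X n - z) \<bullet> d))" "(d \<bullet> ?X d) / 2 = c n * (d \<bullet> d)" by simp_all
      ultimately have "V (X n + d) \<le> V (X n) + ?p \<bullet> d + (d \<bullet> ?X d) / 2" using le by linarith
      then show "v (fst ((fst (X n), snd (X n)) + d)) (snd ((fst (X n), snd (X n)) + d)) - 0 \<le> v (fst (X n)) (snd (X n)) - 0 + ?p \<bullet> d + (d \<bullet> ?X d) / 2 + 0 * norm d ^ 3"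
        by (simp add: V_def case_prod_unfold)
    qed simp
    then show ?thesis by blast
  qed
  show ?thesis
  proof (intro exI[of _ X] conjI allI)
    show "X n \<in> dom_T T" for n using X(1)[of n] by (simp add: K_def)
    show "X \<longlonglongrightarrow> (t0, x0)" using lim by (simp add: z_def)
    show "(\<lambda>n. v (fst (X n)) (snd (X n))) \<longlonglongrightarrow> v t0 x0" using limV by (simp add: V_def z_def case_prod_unfold)
  qed (rule jet)
qed

section \<open>Obstacles and the no free loop property\<close>

lemma ereal_le_SUP_finite:
  fixes f :: "'a \<Rightarrow> real"
  assumes "finite A" shows "ereal a \<le> (SUP k\<in>A. ereal (f k)) \<longleftrightarrow> (\<exists>k\<in>A. a \<le> f k)"
proof
  assume le: "ereal a \<le> (SUP k\<in>A. ereal (f k))"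
  show "\<exists>k\<in>A. a \<le> f k"
  proof (rule ccontr)
    assume *: "\<not> (\<exists>k\<in>A. a \<le> f k)"
    have "(SUP k\<in>A. ereal (f k)) < ereal a"
    proof (cases "A = {}")
      case False
      then show ?thesis using * assms by (subst finite_Sup_less_iff) auto
    qed (simp add: bot_ereal_def)
    with le show False by simp
  qed
qed (auto intro: SUP_upper2)

lemma INF_finite_le_ereal:
  fixes f :: "'a \<Rightarrow> real"
  assumes "finite A" shows "(INF k\<in>A. ereal (f k)) \<le> ereal a \<longleftrightarrow> (\<exists>k\<in>A. f k \<le> a)"
proof
  assume le: "(INF k\<in>A. ereal (f k)) \<le> ereal a"
  show "\<exists>k\<in>A. f k \<le> a"
  proof (rule ccontr)
    assume *: "\<not> (\<exists>k\<in>A. f k \<le> a)"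
    have "ereal a < (INF k\<in>A. ereal (f k))"
    proof (cases "A = {}")
      case False
      then show ?thesis using * assms by (subst finite_less_Inf_iff) auto
    qed (simp add: top_ereal_def)
    with le show False by simp
  qed
qed (auto intro: INF_lower2)

lemma system_operator_le_0_iff:
  "system_operator b \<sigma> f gl gu v i j t x p q M \<le> 0 \<longleftrightarrow>
    (\<exists>k. k \<noteq> i \<and> v i j t x \<le> v k j t x - gl i k t x) \<or>
    (pde_term b \<sigma> f v i j t x p q M \<le> 0 \<and> (\<forall>l. l \<noteq> j \<longrightarrow> v i j t x \<le> v i l t x + gu j l t x))"
proof -
  have diff: "ereal a - S \<le> 0 \<longleftrightarrow> ereal a \<le> S" for a S by (cases S) (auto simp: zero_ereal_def)
  show ?thesis
    unfolding system_operator_def min_le_iff_disj max.bounded_iff diff lower_obstacle_def upper_obstacle_def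
    by (auto simp: ereal_le_SUP_finite le_INF_iff zero_ereal_def)
qed

lemma system_operator_ge_0_iff:
  "0 \<le> system_operator b \<sigma> f gl gu v i j t x p q M \<longleftrightarrow>
    (\<forall>k. k \<noteq> i \<longrightarrow> v k j t x - gl i k t x \<le> v i j t x) \<and>
    (0 \<le> pde_term b \<sigma> f v i j t x p q M \<or> (\<exists>l. l \<noteq> j \<and> v i l t x + gu j l t x \<le> v i j t x))"
proof -
  have diff: "0 \<le> ereal a - S \<longleftrightarrow> S \<le> ereal a" for a S by (cases S) (auto simp: zero_ereal_def)
  show ?thesis
    unfolding system_operator_def min.bounded_iff le_max_iff_disj diff lower_obstacle_def upper_obstacle_def
    by (auto simp: INF_finite_le_ereal SUP_le_iff zero_ereal_def)
qed

text \<open>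
  At points where a superjet exists one of the two alternatives holds. If both failed at \<open>(t0, x0)\<close>, they
  would fail nearby by semicontinuity of the other components.
\<close>

lemma subsolution_obstacle_alternative:
  fixes u :: "'i::finite \<Rightarrow> 'j::finite \<Rightarrow> real \<Rightarrow> real ^ 'k \<Rightarrow> real"
  assumes sub: "viscosity_subsolution T b \<sigma> f gl gu h u" and t0: "t0 \<in> {0..<T}"
    and gl: "\<And>i k. continuous_on (dom_T T) (\<lambda>(t, x). gl i k t x)" and gu: "\<And>j l. continuous_on (dom_T T) (\<lambda>(t, x). gu j l t x)"
  shows "(\<exists>k. k \<noteq> i \<and> u i j t0 x0 \<le> u k j t0 x0 - gl i k t0 x0) \<or> (\<forall>l. l \<noteq> j \<longrightarrow> u i j t0 x0 \<le> u i l t0 x0 + gu j l t0 x0)"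
proof (rule ccontr)
  assume "\<not> ?thesis"
  then obtain l where k: "\<And>k. k \<noteq> i \<Longrightarrow> u k j t0 x0 - gl i k t0 x0 < u i j t0 x0" and l: "l \<noteq> j" "u i l t0 x0 + gu j l t0 x0 < u i j t0 x0"
    by (auto simp: not_le)
  have usc: "usc_on (dom_T T) (\<lambda>(t, x). u i j t x)" for i j using sub by (simp add: viscosity_subsolution_def)
  have t0': "t0 \<in> {0..T}" using t0 by auto
  obtain X where X': "(\<forall>n. X n \<in> dom_T T \<and> (\<exists>p q M. (p, q, M) \<in> superjet T (u i j) (fst (X n)) (snd (X n)))) \<and>
    X \<longlonglongrightarrow> (t0, x0) \<and> (\<lambda>n::nat. u i j (fst (X n)) (snd (X n))) \<longlonglongrightarrow> u i j t0 x0"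
    using superjet_dense[OF usc t0'] by (rule exE)
  have X: "\<And>n. X n \<in> dom_T T" "\<And>n. \<exists>p q M. (p, q, M) \<in> superjet T (u i j) (fst (X n)) (snd (X n))"
    "X \<longlonglongrightarrow> (t0, x0)" "(\<lambda>n::nat. u i j (fst (X n)) (snd (X n))) \<longlonglongrightarrow> u i j t0 x0"
    using X' by simp_all
  have below: "\<forall>\<^sub>F n in sequentially. F (X n) < u i j (fst (X n)) (snd (X n))"
    if F: "usc_on (dom_T T) F" "F (t0, x0) < u i j t0 x0" for F
  proof -
    obtain c where c: "F (t0, x0) < c" "c < u i j t0 x0" using dense[OF F(2)] by blast
    have "\<forall>\<^sub>F n in sequentially. F (X n) < c" using t0' by (intro usc_on_eventually_less[OF F(1) X(1,3)] c) simp
    moreover have "\<forall>\<^sub>F n in sequentially. c < u i j (fst (X n)) (snd (X n))" using X(4) c(2) by (rule order_tendstoD(1))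
    ultimately show ?thesis by eventually_elim simp
  qed
  have above: "\<forall>\<^sub>F n in sequentially. u k j (fst (X n)) (snd (X n)) - gl i k (fst (X n)) (snd (X n)) < u i j (fst (X n)) (snd (X n))" if "k \<noteq> i" for k
    using below[OF usc_on_diff_continuous[OF usc[of k j] gl[of i k]]] k[OF that] by (simp add: case_prod_unfold)
  have "\<forall>\<^sub>F n in sequentially. \<forall>k. k \<noteq> i \<longrightarrow> u k j (fst (X n)) (snd (X n)) - gl i k (fst (X n)) (snd (X n)) < u i j (fst (X n)) (snd (X n))"
  proof (intro eventually_all_finite)
    fix k
    show "\<forall>\<^sub>F n in sequentially. k \<noteq> i \<longrightarrow> u k j (fst (X n)) (snd (X n)) - gl i k (fst (X n)) (snd (X n)) < u i j (fst (X n)) (snd (X n))"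
    proof (cases "k = i")
      case False
      from above[OF this] show ?thesis by (rule eventually_mono) simp
    qed simp
  qed
  moreover have "\<forall>\<^sub>F n in sequentially. u i l (fst (X n)) (snd (X n)) + gu j l (fst (X n)) (snd (X n)) < u i j (fst (X n)) (snd (X n))"
    using below[OF usc_on_add[OF usc[of i l] usc_on_continuous[OF gu[of j l]]]] l by (simp add: case_prod_unfold)
  moreover have "\<forall>\<^sub>F n in sequentially. fst (X n) < T"
    using order_tendstoD(2)[OF tendsto_fst[OF X(3)], of T] t0 by simp
  ultimately have "\<forall>\<^sub>F n in sequentially. False"
  proof eventually_elim
    case (elim n)
    obtain p q M where jet: "(p, q, M) \<in> superjet T (u i j) (fst (X n)) (snd (X n))" using X(2) by blast
    have t: "fst (X n) \<in> {0..T}" using X(1)[of n] by (auto simp: mem_Times_iff)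
    have "system_operator b \<sigma> f gl gu u i j (fst (X n)) (snd (X n)) p q M \<le> 0"
      using sub superjet_subset_closure[OF t jet] t elim(3) unfolding viscosity_subsolution_def by fastforce
    then show False using elim(1,2) l(1) unfolding system_operator_le_0_iff by (meson not_le)
  qed
  then show False by simp
qed

lemma supersolution_lower_obstacle:
  fixes w :: "'i::finite \<Rightarrow> 'j::finite \<Rightarrow> real \<Rightarrow> real ^ 'k \<Rightarrow> real"
  assumes super: "viscosity_supersolution T b \<sigma> f gl gu h w" and t0: "t0 \<in> {0..<T}"
    and gl: "\<And>i k. continuous_on (dom_T T) (\<lambda>(t, x). gl i k t x)" and ki: "k \<noteq> i"
  shows "w k j t0 x0 - gl i k t0 x0 \<le> w i j t0 x0"
proof (rule ccontr)
  assume "\<not> ?thesis"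
  then have "w i j t0 x0 < w k j t0 x0 - gl i k t0 x0" by simp
  then obtain c where c: "w i j t0 x0 < c" "c < w k j t0 x0 - gl i k t0 x0" using dense by blast
  have usc: "usc_on (dom_T T) (\<lambda>z. - (\<lambda>(t, x). w i j t x) z)" for i j
    by (rule usc_on_uminus_lsc) (use super in \<open>simp add: viscosity_supersolution_def\<close>)
  have usc': "usc_on (dom_T T) (\<lambda>(t, x). - w i j t x)" for i j using usc[of i j] by (simp add: case_prod_unfold)
  have t0': "t0 \<in> {0..T}" using t0 by auto
  obtain X where X': "(\<forall>n. X n \<in> dom_T T \<and> (\<exists>p q M. (p, q, M) \<in> superjet T (\<lambda>t x. - w i j t x) (fst (X n)) (snd (X n)))) \<and>
    X \<longlonglongrightarrow> (t0, x0) \<and> (\<lambda>n::nat. - w i j (fst (X n)) (snd (X n))) \<longlonglongrightarrow> - w i j t0 x0"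
    using superjet_dense[OF usc' t0'] by (rule exE)
  have X: "\<And>n. X n \<in> dom_T T" "\<And>n. \<exists>p q M. (p, q, M) \<in> superjet T (\<lambda>t x. - w i j t x) (fst (X n)) (snd (X n))"
    "X \<longlonglongrightarrow> (t0, x0)" "(\<lambda>n::nat. - w i j (fst (X n)) (snd (X n))) \<longlonglongrightarrow> - w i j t0 x0"
    using X' by simp_all
  have "\<forall>\<^sub>F n in sequentially. (\<lambda>z. (\<lambda>(t, x). - w k j t x) z + (\<lambda>(t, x). gl i k t x) z) (X n) < - c"
    using c t0' by (intro usc_on_eventually_less[OF usc_on_add[OF usc' usc_on_continuous[OF gl]] X(1,3)]) auto
  moreover have "\<forall>\<^sub>F n in sequentially. - c < - w i j (fst (X n)) (snd (X n))"
    using X(4) c(1) by (intro order_tendstoD(1)[of _ "- w i j t0 x0"]) auto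
  moreover have "\<forall>\<^sub>F n in sequentially. fst (X n) < T"
    using order_tendstoD(2)[OF tendsto_fst[OF X(3)], of T] t0 by simp
  ultimately have "\<forall>\<^sub>F n in sequentially. False"
  proof eventually_elim
    case (elim n)
    obtain p q M where jet: "(p, q, M) \<in> superjet T (\<lambda>t x. - w i j t x) (fst (X n)) (snd (X n))" using X(2) by blast
    have t: "fst (X n) \<in> {0..T}" using X(1)[of n] by (auto simp: mem_Times_iff)
    have "0 \<le> system_operator b \<sigma> f gl gu w i j (fst (X n)) (snd (X n)) (- p) (- q) (- M)"
      using super superjet_closure_uminus[OF superjet_subset_closure[OF t jet]] t elim(3) unfolding viscosity_supersolution_def by fastforce
    then have "w k j (fst (X n)) (snd (X n)) - gl i k (fst (X n)) (snd (X n)) \<le> w i j (fst (X n)) (snd (X n))"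
      using ki unfolding system_operator_ge_0_iff by blast
    then show False using elim(1,2) by (simp add: case_prod_unfold)
  qed
  then show False by simp
qed

text \<open>
  If no maximising pair of indices were as required, then each of them would have a successor: either the
  subsolution lies below its lower obstacle, and the supersolution inequality forces equality throughout
  for some index \<open>k\<close> attaining the obstacle, which is then maximising as well; or the supersolution lies
  above its upper obstacle, and the alternative for the subsolution does the same. Along successors \<open>u\<close>
  changes exactly by the switching costs. A shortest period of the orbit of successors is a loop with
  total cost zero.
\<close>

lemma no_free_loop_selection:
  fixes u w :: "'i::finite \<Rightarrow> 'j::finite \<Rightarrow> real" and gl :: "'i \<Rightarrow> 'i \<Rightarrow> real" and gu :: "'j \<Rightarrow> 'j \<Rightarrow> real"
  assumes loop: "\<And>N (a :: nat \<Rightarrow> 'i) (b :: nat \<Rightarrow> 'j). 3 \<le> N \<Longrightarrow> (a N, b N) = (a 1, b 1) \<Longrightarrow>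
      card ((\<lambda>q. (a q, b q)) ` {1..N}) = N - 1 \<Longrightarrow>
      (\<forall>q\<in>{1..N - 1}. a (q + 1) = a q \<or> b (q + 1) = b q) \<Longrightarrow>
      (\<Sum>q = 1..N - 1. - gl (a q) (a (q + 1)) * of_bool (a q \<noteq> a (q + 1)) + gu (b q) (b (q + 1)) * of_bool (b q \<noteq> b (q + 1))) \<noteq> 0"
    and low: "\<And>i j k. k \<noteq> i \<Longrightarrow> w k j - gl i k \<le> w i j"
    and alt: "\<And>i j. (\<exists>k. k \<noteq> i \<and> u i j \<le> u k j - gl i k) \<or> (\<forall>l. l \<noteq> j \<longrightarrow> u i j \<le> u i l + gu j l)"
    and max: "\<And>i j. u i j - w i j \<le> c" and attained: "u i0 j0 - w i0 j0 = c"
  shows "\<exists>i j. u i j - w i j = c \<and> (\<forall>k. k \<noteq> i \<longrightarrow> u k j - gl i k < u i j) \<and> (\<forall>l. l \<noteq> j \<longrightarrow> w i j < w i l + gu j l)"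
proof (rule ccontr)
  assume contra: "\<not> ?thesis"
  define A where "A z \<longleftrightarrow> u (fst z) (snd z) - w (fst z) (snd z) = c" for z
  define U where "U z = u (fst z) (snd z)" for z
  define R where "R z z' \<longleftrightarrow> (fst z' \<noteq> fst z \<and> snd z' = snd z \<and> U z - U z' = - gl (fst z) (fst z')) \<or>
    (fst z' = fst z \<and> snd z' \<noteq> snd z \<and> U z - U z' = gu (snd z) (snd z'))" for z z'
  have "\<exists>z'. A z' \<and> R z z'" if "A z" for z
  proof -
    obtain i j where z: "z = (i, j)" by (cases z)
    have c: "u i j - w i j = c" using that by (simp add: A_def z)
    show ?thesis
    proof (cases "\<exists>k. k \<noteq> i \<and> u i j \<le> u k j - gl i k")
      case True
      then obtain k where k: "k \<noteq> i" "u i j \<le> u k j - gl i k" by blast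
      have "A (k, j) \<and> R z (k, j)" using k low[OF k(1), of j] max[of k j] c by (auto simp: A_def R_def U_def z)
      then show ?thesis by blast
    next
      case False
      then have "\<forall>k. k \<noteq> i \<longrightarrow> u k j - gl i k < u i j" by (auto simp: not_le)
      moreover have "\<not> (u i j - w i j = c \<and> (\<forall>k. k \<noteq> i \<longrightarrow> u k j - gl i k < u i j) \<and> (\<forall>l. l \<noteq> j \<longrightarrow> w i j < w i l + gu j l))"
        using contra by blast
      ultimately obtain l where l: "l \<noteq> j" "w i l + gu j l \<le> w i j" using c by (auto simp: not_less)
      moreover have "u i j \<le> u i l + gu j l" using alt[of i j] False l(1) by blast
      ultimately have "A (i, l) \<and> R z (i, l)" using max[of i l] c by (auto simp: A_def R_def U_def z)
      then show ?thesis by blast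
    qed
  qed
  then obtain s where s: "\<And>z. A z \<Longrightarrow> A (s z) \<and> R z (s z)" by metis
  define o' where "o' n = (s ^^ n) (i0, j0)" for n
  have Ao: "A (o' n)" for n
  proof (induction n)
    case 0 show ?case using attained by (simp add: o'_def A_def)
  next
    case (Suc n) then show ?case using s by (simp add: o'_def)
  qed
  have Ro: "R (o' n) (o' (Suc n))" for n using s[OF Ao[of n]] by (simp add: o'_def)
  have shift: "o' (a + k) = o' (b + k)" if "o' a = o' b" for a b k
    using that by (simp add: o'_def add.commute[of _ k] funpow_add)
  define P where "P p \<longleftrightarrow> 0 < p \<and> (\<exists>m. o' m = o' (m + p))" for p
  have "\<not> inj o'"
    using range_inj_infinite[of o'] finite[of "range o'"] by blast
  then obtain a b where "o' a = o' b" "a < b" unfolding inj_def by (metis linorder_neq_iff)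
  then have "P (b - a)" by (auto simp: P_def intro!: exI[of _ a])
  \<comment> \<open>For the least period the loop visits no pair twice.\<close>
  define p where "p = (LEAST p. P p)"
  have Pp: "P p" unfolding p_def using \<open>P (b - a)\<close> by (rule LeastI)
  have least: "p \<le> q" if "P q" for q unfolding p_def using that by (rule Least_le)
  obtain m where m: "o' m = o' (m + p)" and p0: "0 < p" using Pp by (auto simp: P_def)
  have "p \<noteq> 1"
  proof
    assume "p = 1"
    then have "o' m = o' (Suc m)" using m by simp
    then show False using Ro[of m] by (auto simp: R_def)
  qed
  then have p2: "2 \<le> p" using p0 by simp
  have inj: "inj_on (\<lambda>q. o' (m + q)) {..<p}"
  proof (rule linorder_inj_onI)
    fix x y assume xy: "x < y" "x \<in> {..<p}" "y \<in> {..<p}"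
    show "o' (m + x) \<noteq> o' (m + y)"
    proof
      assume "o' (m + x) = o' (m + y)"
      then have "P (y - x)" using xy by (auto simp: P_def intro!: exI[of _ "m + x"])
      then show False using least[of "y - x"] xy by auto
    qed
  qed auto
  define N where "N = Suc p"
  define a b where "a q = fst (o' (m + (q - 1)))" and "b q = snd (o' (m + (q - 1)))" for q
  have ab: "(a q, b q) = o' (m + (q - 1))" for q by (simp add: a_def b_def)
  have img: "(\<lambda>q. (a q, b q)) ` {1..N} = (\<lambda>q. o' (m + q)) ` {..<p}"
  proof (intro equalityI subsetI)
    fix y assume "y \<in> (\<lambda>q. (a q, b q)) ` {1..N}"
    then obtain q where q: "1 \<le> q" "q \<le> Suc p" "y = o' (m + (q - 1))" unfolding ab N_def by auto
    show "y \<in> (\<lambda>q. o' (m + q)) ` {..<p}"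
    proof (cases "q = Suc p")
      case True then show ?thesis using q m p0 by (auto intro!: image_eqI[of _ _ 0])
    next
      case False then show ?thesis using q by (intro image_eqI[of _ _ "q - 1"]) auto
    qed
  next
    fix y assume "y \<in> (\<lambda>q. o' (m + q)) ` {..<p}"
    then obtain q where "q < p" "y = o' (m + q)" by auto
    then show "y \<in> (\<lambda>q. (a q, b q)) ` {1..N}" unfolding ab N_def by (intro image_eqI[of _ _ "Suc q"]) auto
  qed
  have step: "R (a q, b q) (a (q + 1), b (q + 1))" if "1 \<le> q" for q
    using Ro[of "m + (q - 1)"] that unfolding ab by simp
  have "(\<Sum>q = 1..N - 1. - gl (a q) (a (q + 1)) * of_bool (a q \<noteq> a (q + 1)) + gu (b q) (b (q + 1)) * of_bool (b q \<noteq> b (q + 1))) \<noteq> 0"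
  proof (rule loop)
    show "3 \<le> N" using p2 by (simp add: N_def)
    show "(a N, b N) = (a 1, b 1)" unfolding ab using m by (simp add: N_def)
    show "card ((\<lambda>q. (a q, b q)) ` {1..N}) = N - 1" unfolding img card_image[OF inj] by (simp add: N_def)
    show "\<forall>q\<in>{1..N - 1}. a (q + 1) = a q \<or> b (q + 1) = b q"
    proof
      fix q assume "q \<in> {1..N - 1}"
      then show "a (q + 1) = a q \<or> b (q + 1) = b q" using step[of q] by (auto simp: R_def)
    qed
  qed
  moreover have "(\<Sum>q = 1..N - 1. - gl (a q) (a (q + 1)) * of_bool (a q \<noteq> a (q + 1)) + gu (b q) (b (q + 1)) * of_bool (b q \<noteq> b (q + 1)))
    = (\<Sum>q = 1..p. U (a q, b q) - U (a (q + 1), b (q + 1)))"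
  proof (rule sum.cong)
    fix q assume "q \<in> {1..p}"
    then have "R (a q, b q) (a (q + 1), b (q + 1))" using step by simp
    then show "- gl (a q) (a (q + 1)) * of_bool (a q \<noteq> a (q + 1)) + gu (b q) (b (q + 1)) * of_bool (b q \<noteq> b (q + 1))
      = U (a q, b q) - U (a (q + 1), b (q + 1))" unfolding R_def by auto
  qed (simp add: N_def)
  moreover have "\<dots> = U (a 1, b 1) - U (a (Suc p), b (Suc p))"
  proof -
    have "(\<Sum>q = 1..n. U (a q, b q) - U (a (q + 1), b (q + 1))) = U (a 1, b 1) - U (a (Suc n), b (Suc n))" for n
      by (induction n) auto
    then show ?thesis .
  qed
  moreover have "(a (Suc p), b (Suc p)) = (a 1, b 1)" unfolding ab using m by simp
  ultimately show False by simp
qed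

section \<open>Monotone nonlinearities and matrices\<close>

text \<open>
  Monotonicity replaces the components other than \<open>m0\<close>, for which only an upper bound of
  \<open>y1 - y2\<close> is known, by components that are close to \<open>y2\<close>; then the Lipschitz condition applies.
\<close>

lemma quasi_monotone_bound:
  fixes F :: "real ^ 'm \<Rightarrow> real"
  assumes mono: "\<And>m y y'. m \<noteq> m0 \<Longrightarrow> y $ m \<le> y' $ m \<Longrightarrow> (\<And>n. n \<noteq> m \<Longrightarrow> y $ n = y' $ n) \<Longrightarrow> F y \<le> F y'"
    and lip: "\<And>y y'. \<bar>F y - F y'\<bar> \<le> L * norm (y - y')" and L: "0 \<le> L"
    and le: "\<And>m. y1 $ m \<le> y2 $ m + c" and close: "\<bar>y1 $ m0 - y2 $ m0\<bar> \<le> c"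
  shows "F y1 \<le> F y2 + L * (real CARD('m) * c)"
proof -
  define y3 where "y3 = (\<chi> m. if m = m0 then y1 $ m else y2 $ m + c)"
  have "F y1 \<le> F (\<chi> m. if m \<in> S then y3 $ m else y1 $ m)" if "finite S" "m0 \<notin> S" for S
    using that
  proof (induction S rule: finite_induct)
    case (insert m S)
    then have "F y1 \<le> F (\<chi> n. if n \<in> S then y3 $ n else y1 $ n)" by simp
    also have "\<dots> \<le> F (\<chi> n. if n \<in> insert m S then y3 $ n else y1 $ n)"
      by (rule mono[of m]) (use insert le in \<open>auto simp: y3_def\<close>)
    finally show ?case .
  qed simp
  from this[of "UNIV - {m0}"] have "F y1 \<le> F (\<chi> m. if m \<in> UNIV - {m0} then y3 $ m else y1 $ m)" by simp
  also have "(\<chi> m. if m \<in> UNIV - {m0} then y3 $ m else y1 $ m) = y3" by (simp add: y3_def vec_eq_iff)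
  also have "F y3 \<le> F y2 + L * norm (y3 - y2)" using lip[of y3 y2] by linarith
  also have "norm (y3 - y2) \<le> (\<Sum>m\<in>UNIV. \<bar>(y3 - y2) $ m\<bar>)" by (rule norm_le_l1_cart)
  also have "\<dots> \<le> (\<Sum>m\<in>(UNIV::'m set). c)" using close by (intro sum_mono) (auto simp: y3_def)
  finally show ?thesis using L by (simp add: mult_left_mono)
qed

lemma trace_sigma:
  fixes \<sigma> :: "real ^ 'd ^ 'k" and M :: "real ^ 'k ^ 'k"
  shows "trace (\<sigma> ** transpose \<sigma> ** M) = (\<Sum>l\<in>UNIV. column l \<sigma> \<bullet> (M *v column l \<sigma>))"
proof -
  have "trace (\<sigma> ** transpose \<sigma> ** M) = (\<Sum>i\<in>UNIV. \<Sum>j\<in>UNIV. \<Sum>l\<in>UNIV. \<sigma> $ i $ l * \<sigma> $ j $ l * M $ j $ i)"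
    by (simp add: trace_def matrix_matrix_mult_def transpose_def sum_distrib_right)
  also have "\<dots> = (\<Sum>i\<in>UNIV. \<Sum>l\<in>UNIV. \<Sum>j\<in>UNIV. \<sigma> $ i $ l * \<sigma> $ j $ l * M $ j $ i)"
    by (intro sum.cong refl sum.swap)
  also have "\<dots> = (\<Sum>l\<in>UNIV. \<Sum>i\<in>UNIV. \<Sum>j\<in>UNIV. \<sigma> $ i $ l * \<sigma> $ j $ l * M $ j $ i)" by (rule sum.swap)
  also have "\<dots> = (\<Sum>l\<in>UNIV. \<Sum>j\<in>UNIV. \<Sum>i\<in>UNIV. \<sigma> $ i $ l * \<sigma> $ j $ l * M $ j $ i)"
    by (intro sum.cong refl sum.swap)
  also have "\<dots> = (\<Sum>l\<in>UNIV. column l \<sigma> \<bullet> (M *v column l \<sigma>))"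
    by (simp add: inner_vec_def matrix_vector_mult_def column_def sum_distrib_left mult_ac)
  finally show ?thesis .
qed

lemma norm_matrix_sq_columns:
  fixes \<sigma> :: "real ^ 'd ^ 'k" shows "(norm \<sigma>)\<^sup>2 = (\<Sum>l\<in>UNIV. (norm (column l \<sigma>))\<^sup>2)"
proof -
  have "(norm \<sigma>)\<^sup>2 = (\<Sum>i\<in>UNIV. \<Sum>l\<in>UNIV. (\<sigma> $ i $ l)\<^sup>2)"
    unfolding power2_norm_eq_inner inner_vec_def by (simp add: power2_eq_square)
  also have "\<dots> = (\<Sum>l\<in>UNIV. \<Sum>i\<in>UNIV. (\<sigma> $ i $ l)\<^sup>2)" by (rule sum.swap)
  also have "\<dots> = (\<Sum>l\<in>UNIV. (norm (column l \<sigma>))\<^sup>2)"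
    unfolding power2_norm_eq_inner inner_vec_def by (simp add: power2_eq_square column_def)
  finally show ?thesis .
qed

lemma norm_transpose_matrix_vector_le:
  fixes \<sigma> :: "real ^ 'd ^ 'k" shows "norm (transpose \<sigma> *v q) \<le> norm \<sigma> * norm q"
proof (rule power2_le_imp_le)
  have "(transpose \<sigma> *v q) $ l = column l \<sigma> \<bullet> q" for l
    by (simp add: matrix_vector_mult_def transpose_def column_def inner_vec_def)
  then have "(norm (transpose \<sigma> *v q))\<^sup>2 = (\<Sum>l\<in>UNIV. (column l \<sigma> \<bullet> q)\<^sup>2)"
    by (simp only: power2_norm_eq_inner[of "transpose \<sigma> *v q"] inner_vec_def) (simp add: power2_eq_square)
  also have "\<dots> \<le> (\<Sum>l\<in>UNIV. (norm (column l \<sigma>) * norm q)\<^sup>2)"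
    by (intro sum_mono) (metis Cauchy_Schwarz_ineq2 abs_ge_zero power2_abs power_mono)
  also have "\<dots> = (norm \<sigma> * norm q)\<^sup>2"
    by (simp add: power_mult_distrib norm_matrix_sq_columns sum_distrib_right)
  finally show "(norm (transpose \<sigma> *v q))\<^sup>2 \<le> (norm \<sigma> * norm q)\<^sup>2" .
qed simp

definition outer_square :: "real ^ 'k \<Rightarrow> real ^ 'k ^ 'k"
  where "outer_square x = (\<chi> i j. x $ i * x $ j)"

lemma outer_square_works: "outer_square x *v d = (x \<bullet> d) *\<^sub>R x"
  by (simp add: outer_square_def matrix_vector_mult_def vec_eq_iff inner_vec_def sum_distrib_left sum_distrib_right mult_ac)

section \<open>The barrier\<close>

lemma power_taylor2:
  fixes s :: real
  shows "\<exists>K\<ge>0. \<forall>e. \<bar>e\<bar> \<le> 1 \<longrightarrow>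
    \<bar>(s + e) ^ (n + 2) - s ^ (n + 2) - real (n + 2) * s ^ (n + 1) * e - real (n + 2) * real (n + 1) / 2 * s ^ n * e\<^sup>2\<bar> \<le> K * \<bar>e\<bar> ^ 3"
proof (induction n)
  case 0
  show ?case by (intro exI[of _ 0]) (simp add: power2_eq_square algebra_simps)
next
  case (Suc n)
  then obtain K where K: "0 \<le> K" and b: "\<And>e. \<bar>e\<bar> \<le> 1 \<Longrightarrow>
    \<bar>(s + e) ^ (n + 2) - s ^ (n + 2) - real (n + 2) * s ^ (n + 1) * e - real (n + 2) * real (n + 1) / 2 * s ^ n * e\<^sup>2\<bar> \<le> K * \<bar>e\<bar> ^ 3" by blast
  define c where "c = real (n + 2) * real (n + 1) / 2 * s ^ n"
  show ?case
  proof (intro exI[of _ "(\<bar>s\<bar> + 1) * K + \<bar>c\<bar>"] conjI allI impI)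
    show "0 \<le> (\<bar>s\<bar> + 1) * K + \<bar>c\<bar>" using K by simp
    fix e :: real assume e: "\<bar>e\<bar> \<le> 1"
    define R where "R = (s + e) ^ (n + 2) - s ^ (n + 2) - real (n + 2) * s ^ (n + 1) * e - c * e\<^sup>2"
    have R: "\<bar>R\<bar> \<le> K * \<bar>e\<bar> ^ 3" using b[OF e] by (simp add: R_def c_def)
    have "(s + e) ^ (Suc n + 2) = (s + e) * (R + s ^ (n + 2) + real (n + 2) * s ^ (n + 1) * e + c * e\<^sup>2)"
      by (simp add: R_def)
    also have "\<dots> = (s + e) * R + c * e ^ 3 + s ^ (Suc n + 2) + real (Suc n + 2) * s ^ (Suc n + 1) * e
       + (real (n + 2) * s ^ (n + 1) + c * s) * e\<^sup>2"
      by (simp add: algebra_simps power2_eq_square power3_eq_cube)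
    also have "real (n + 2) * s ^ (n + 1) + c * s = real (Suc n + 2) * real (Suc n + 1) / 2 * s ^ (Suc n)"
      by (simp add: c_def field_simps)
    finally have eq: "(s + e) ^ (Suc n + 2) - s ^ (Suc n + 2) - real (Suc n + 2) * s ^ (Suc n + 1) * e - real (Suc n + 2) * real (Suc n + 1) / 2 * s ^ Suc n * e\<^sup>2
      = (s + e) * R + c * e ^ 3" by simp
    have "\<bar>(s + e) * R\<bar> \<le> (\<bar>s\<bar> + 1) * (K * \<bar>e\<bar> ^ 3)" unfolding abs_mult using e R by (intro mult_mono) auto
    moreover have "\<bar>c * e ^ 3\<bar> = \<bar>c\<bar> * \<bar>e\<bar> ^ 3" by (simp add: abs_mult power_abs)
    ultimately show "\<bar>(s + e) ^ (Suc n + 2) - s ^ (Suc n + 2) - real (Suc n + 2) * s ^ (Suc n + 1) * e - real (Suc n + 2) * real (Suc n + 1) / 2 * s ^ Suc n * e\<^sup>2\<bar>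
       \<le> ((\<bar>s\<bar> + 1) * K + \<bar>c\<bar>) * \<bar>e\<bar> ^ 3"
      unfolding eq using abs_triangle_ineq[of "(s + e) * R" "c * e ^ 3"] by (simp add: algebra_simps)
  qed
qed

lemma radial_power_taylor2:
  fixes x :: "'a::real_inner" and n :: nat
  defines "s \<equiv> 1 + x \<bullet> x"
  shows "\<exists>K\<ge>0. \<forall>d. (2 * norm x + 1) * norm d \<le> 1 \<longrightarrow>
    \<bar>(1 + (x + d) \<bullet> (x + d)) ^ (n + 2) - s ^ (n + 2) - (2 * real (n + 2) * s ^ (n + 1)) * (x \<bullet> d)
      - (2 * real (n + 2) * s ^ (n + 1) * (d \<bullet> d) + 4 * real (n + 2) * real (n + 1) * s ^ n * (x \<bullet> d)\<^sup>2) / 2\<bar> \<le> K * norm d ^ 3"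
proof -
  obtain K where K: "0 \<le> K" and b: "\<And>e. \<bar>e\<bar> \<le> 1 \<Longrightarrow>
    \<bar>(s + e) ^ (n + 2) - s ^ (n + 2) - real (n + 2) * s ^ (n + 1) * e - real (n + 2) * real (n + 1) / 2 * s ^ n * e\<^sup>2\<bar> \<le> K * \<bar>e\<bar> ^ 3"
    using power_taylor2[of s n] by blast
  define c where "c = real (n + 2) * real (n + 1) / 2 * s ^ n"
  define m where "m = 2 * norm x + 1"
  have m: "1 \<le> m" by (simp add: m_def)
  show ?thesis
  proof (intro exI[of _ "K * m ^ 3 + \<bar>c\<bar> * (4 * norm x + 1)"] conjI allI impI)
    show "0 \<le> K * m ^ 3 + \<bar>c\<bar> * (4 * norm x + 1)" using K m by simp
    fix d :: 'a assume "(2 * norm x + 1) * norm d \<le> 1"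
    then have d: "m * norm d \<le> 1" by (simp add: m_def)
    have d1: "norm d \<le> 1" using d mult_right_mono[OF m, of "norm d"] by simp
    have dd: "(norm d)\<^sup>2 \<le> norm d" "norm d ^ 4 \<le> norm d ^ 3"
      using d1 power_decreasing[of 1 2 "norm d"] power_decreasing[of 3 4 "norm d"] by auto
    define e where "e = 2 * (x \<bullet> d) + d \<bullet> d"
    have xd: "\<bar>x \<bullet> d\<bar> \<le> norm x * norm d" by (rule Cauchy_Schwarz_ineq2)
    have em: "\<bar>e\<bar> \<le> m * norm d"
    proof -
      have "0 \<le> (norm d)\<^sup>2" "m * norm d = 2 * (norm x * norm d) + norm d" by (simp_all add: m_def algebra_simps)
      then show ?thesis using xd dd(1) unfolding e_def power2_norm_eq_inner abs_le_iff by linarith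
    qed
    define R where "R = (s + e) ^ (n + 2) - s ^ (n + 2) - real (n + 2) * s ^ (n + 1) * e - c * e\<^sup>2"
    have "\<bar>R\<bar> \<le> K * \<bar>e\<bar> ^ 3" using b[of e] em d by (simp add: R_def c_def)
    also have "\<dots> \<le> K * (m * norm d) ^ 3" using K em by (intro mult_left_mono power_mono) auto
    finally have R: "\<bar>R\<bar> \<le> K * m ^ 3 * norm d ^ 3" by (simp add: power_mult_distrib)
    define q where "q = 4 * ((x \<bullet> d) * (norm d)\<^sup>2) + norm d ^ 4"
    have "\<bar>(x \<bullet> d) * (norm d)\<^sup>2\<bar> \<le> (norm x * norm d) * (norm d)\<^sup>2"
      unfolding abs_mult using xd by (intro mult_mono) auto
    also have "\<dots> = norm x * norm d ^ 3" by (simp add: power2_eq_square power3_eq_cube)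
    finally have xd3: "\<bar>(x \<bullet> d) * (norm d)\<^sup>2\<bar> \<le> norm x * norm d ^ 3" .
    have q: "\<bar>q\<bar> \<le> (4 * norm x + 1) * norm d ^ 3"
    proof -
      have "(4 * norm x + 1) * norm d ^ 3 = 4 * (norm x * norm d ^ 3) + norm d ^ 3" by (simp add: algebra_simps)
      moreover have "0 \<le> norm d ^ 4" by simp
      ultimately show ?thesis using dd(2) xd3 unfolding q_def abs_le_iff by linarith
    qed
    have e2: "e\<^sup>2 = 4 * (x \<bullet> d)\<^sup>2 + q"
      unfolding e_def q_def power2_norm_eq_inner[symmetric] by (simp add: power2_eq_square power4_eq_xxxx algebra_simps)
    have "1 + (x + d) \<bullet> (x + d) = s + e" by (simp add: s_def e_def inner_add_left inner_add_right inner_commute)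
    then have "(1 + (x + d) \<bullet> (x + d)) ^ (n + 2) = R + s ^ (n + 2) + real (n + 2) * s ^ (n + 1) * e + c * e\<^sup>2" by (simp add: R_def)
    then have eq: "(1 + (x + d) \<bullet> (x + d)) ^ (n + 2) - s ^ (n + 2) - (2 * real (n + 2) * s ^ (n + 1)) * (x \<bullet> d)
      - (2 * real (n + 2) * s ^ (n + 1) * (d \<bullet> d) + 4 * real (n + 2) * real (n + 1) * s ^ n * (x \<bullet> d)\<^sup>2) / 2 = R + c * q"
    proof -
      define A where "A = real (n + 2) * s ^ (n + 1)"
      have gen: "T - S - (2 * A) * y - ((2 * A) * z + (8 * c) * y\<^sup>2) / 2 = R + c * q"
        if "T = R + S + A * (2 * y + z) + c * (4 * y\<^sup>2 + q)" for T S y z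
        unfolding that by (simp add: algebra_simps)
      have A2: "2 * real (n + 2) * s ^ (n + 1) = 2 * A" and c8: "4 * real (n + 2) * real (n + 1) * s ^ n = 8 * c"
        by (simp_all add: A_def c_def)
      have "(1 + (x + d) \<bullet> (x + d)) ^ (n + 2) = R + s ^ (n + 2) + A * (2 * (x \<bullet> d) + d \<bullet> d) + c * (4 * (x \<bullet> d)\<^sup>2 + q)"
        using \<open>(1 + (x + d) \<bullet> (x + d)) ^ (n + 2) = R + s ^ (n + 2) + real (n + 2) * s ^ (n + 1) * e + c * e\<^sup>2\<close>
        unfolding e2 unfolding A_def e_def .
      from gen[OF this] show ?thesis unfolding A2 c8 .
    qed
    have "\<bar>c * q\<bar> \<le> \<bar>c\<bar> * ((4 * norm x + 1) * norm d ^ 3)" unfolding abs_mult using q by (intro mult_left_mono) auto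
    then show "\<bar>(1 + (x + d) \<bullet> (x + d)) ^ (n + 2) - s ^ (n + 2) - (2 * real (n + 2) * s ^ (n + 1)) * (x \<bullet> d)
      - (2 * real (n + 2) * s ^ (n + 1) * (d \<bullet> d) + 4 * real (n + 2) * real (n + 1) * s ^ n * (x \<bullet> d)\<^sup>2) / 2\<bar>
      \<le> (K * m ^ 3 + \<bar>c\<bar> * (4 * norm x + 1)) * norm d ^ 3"
      unfolding eq using R abs_triangle_ineq[of R "c * q"] by (simp add: algebra_simps)
  qed
qed

text \<open>
  The last term makes the touching strict and vanishes to first order at \<open>(ts, xs)\<close>, where it contributes
  nothing but \<open>2 * \<kappa>\<close> to the Hessian.
\<close>

definition barrier :: "real \<Rightarrow> real \<Rightarrow> nat \<Rightarrow> real \<Rightarrow> real \<Rightarrow> real \<Rightarrow> real ^ 'k \<Rightarrow> real \<Rightarrow> real ^ 'k \<Rightarrow> real"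
  where "barrier \<mu> \<theta> n \<Phi> \<kappa> ts xs t x =
    exp (- \<mu> * t) * (\<theta> * (1 + x \<bullet> x) ^ (n + 2) + \<Phi>) + \<kappa> * ((t - ts)\<^sup>2 + (x - xs) \<bullet> (x - xs))"

definition barrier_t :: "real \<Rightarrow> real \<Rightarrow> nat \<Rightarrow> real \<Rightarrow> real \<Rightarrow> real \<Rightarrow> real ^ 'k \<Rightarrow> real \<Rightarrow> real ^ 'k \<Rightarrow> real"
  where "barrier_t \<mu> \<theta> n \<Phi> \<kappa> ts xs t x =
    - \<mu> * exp (- \<mu> * t) * (\<theta> * (1 + x \<bullet> x) ^ (n + 2) + \<Phi>) + 2 * \<kappa> * (t - ts)"

definition barrier_x :: "real \<Rightarrow> real \<Rightarrow> nat \<Rightarrow> real \<Rightarrow> real \<Rightarrow> real \<Rightarrow> real ^ 'k \<Rightarrow> real \<Rightarrow> real ^ 'k \<Rightarrow> real ^ 'k"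
  where "barrier_x \<mu> \<theta> n \<Phi> \<kappa> ts xs t x =
    (exp (- \<mu> * t) * \<theta> * (2 * real (n + 2) * (1 + x \<bullet> x) ^ (n + 1))) *\<^sub>R x + (2 * \<kappa>) *\<^sub>R (x - xs)"

definition barrier_xx :: "real \<Rightarrow> real \<Rightarrow> nat \<Rightarrow> real \<Rightarrow> real \<Rightarrow> real \<Rightarrow> real ^ 'k \<Rightarrow> real \<Rightarrow> real ^ 'k \<Rightarrow> real ^ 'k ^ 'k"
  where "barrier_xx \<mu> \<theta> n \<Phi> \<kappa> ts xs t x =
    (exp (- \<mu> * t) * \<theta> * (2 * real (n + 2) * (1 + x \<bullet> x) ^ (n + 1)) + 2 * \<kappa>) *\<^sub>R mat 1
    + (exp (- \<mu> * t) * \<theta> * (4 * real (n + 2) * real (n + 1) * (1 + x \<bullet> x) ^ n)) *\<^sub>R outer_square x"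

lemma barrier_xx_works:
  "d \<bullet> (barrier_xx \<mu> \<theta> n \<Phi> \<kappa> ts xs t x *v d) =
    (exp (- \<mu> * t) * \<theta> * (2 * real (n + 2) * (1 + x \<bullet> x) ^ (n + 1)) + 2 * \<kappa>) * (d \<bullet> d)
    + (exp (- \<mu> * t) * \<theta> * (4 * real (n + 2) * real (n + 1) * (1 + x \<bullet> x) ^ n)) * (x \<bullet> d)\<^sup>2"
  unfolding barrier_xx_def matrix_vector_mult_add_rdistrib scaleR_matrix_vector_assoc[symmetric] outer_square_works matrix_vector_mul_lid
  by (simp add: inner_add_right power2_eq_square inner_commute)

lemma barrier_continuous:
  "continuous_on UNIV (\<lambda>(t, x). barrier \<mu> \<theta> n \<Phi> \<kappa> ts xs t x)"
  "continuous_on UNIV (\<lambda>(t, x). barrier_t \<mu> \<theta> n \<Phi> \<kappa> ts xs t x)"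
  "continuous_on UNIV (\<lambda>(t, x). barrier_x \<mu> \<theta> n \<Phi> \<kappa> ts xs t x)"
  "continuous_on UNIV (\<lambda>(t, x). barrier_xx \<mu> \<theta> n \<Phi> \<kappa> ts xs t x)"
  unfolding barrier_def barrier_t_def barrier_x_def barrier_xx_def outer_square_def case_prod_unfold
  by (intro continuous_intros)+

text \<open>
  The remainder may be \<open>o(\<bar>\<tau>\<bar>)\<close> in time. Hence the first derivative of the exponential suffices, and the product of
  the increments in time and in space is negligible by continuity.
\<close>

lemma barrier_expansion:
  assumes \<theta>: "0 \<le> \<theta>"
  shows "parabolic_expansion (barrier \<mu> \<theta> n \<Phi> \<kappa> ts xs) t x (barrier_t \<mu> \<theta> n \<Phi> \<kappa> ts xs t x)
    (barrier_x \<mu> \<theta> n \<Phi> \<kappa> ts xs t x) (barrier_xx \<mu> \<theta> n \<Phi> \<kappa> ts xs t x)"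
  unfolding parabolic_expansion_def
proof (intro conjI allI impI)
  show "transpose (barrier_xx \<mu> \<theta> n \<Phi> \<kappa> ts xs t x) = barrier_xx \<mu> \<theta> n \<Phi> \<kappa> ts xs t x"
    by (simp add: barrier_xx_def transpose_def vec_eq_iff outer_square_def mat_def mult_ac)
  fix \<epsilon> :: real assume \<epsilon>: "0 < \<epsilon>"
  define G where "G y = \<theta> * (1 + y \<bullet> y) ^ (n + 2) + \<Phi>" for y :: "real ^ 'a"
  define E where "E t = exp (- \<mu> * t)" for t :: real
  define s where "s = 1 + x \<bullet> x"
  define g1 where "g1 = 2 * real (n + 2) * s ^ (n + 1)"
  define g2 where "g2 = 4 * real (n + 2) * real (n + 1) * s ^ n"
  obtain K where K: "0 \<le> K" and rad: "\<And>d. (2 * norm x + 1) * norm d \<le> 1 \<Longrightarrow>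
    \<bar>(1 + (x + d) \<bullet> (x + d)) ^ (n + 2) - s ^ (n + 2) - g1 * (x \<bullet> d) - (g1 * (d \<bullet> d) + g2 * (x \<bullet> d)\<^sup>2) / 2\<bar> \<le> K * norm d ^ 3"
    using radial_power_taylor2[of x n] unfolding s_def g1_def g2_def by metis
  have E0: "0 < E t" by (simp add: E_def)
  define \<epsilon>1 where "\<epsilon>1 = \<epsilon> / (4 * (\<bar>G x\<bar> + 1))"
  define \<epsilon>2 where "\<epsilon>2 = min 1 (\<epsilon> / (4 * (\<bar>\<mu>\<bar> * E t + 1)))"
  have \<epsilon>1: "0 < \<epsilon>1" using \<epsilon> by (simp add: \<epsilon>1_def add_nonneg_pos)
  have \<mu>E: "0 \<le> \<bar>\<mu>\<bar> * E t" using E0 by simp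
  have \<epsilon>2: "0 < \<epsilon>2" using \<epsilon> \<mu>E by (simp add: \<epsilon>2_def add_nonneg_pos)
  have "(E has_real_derivative - \<mu> * E t) (at t)"
    unfolding E_def by (auto intro!: derivative_eq_intros)
  then have "((\<lambda>\<tau>. (E (t + \<tau>) - E t) / \<tau>) \<longlongrightarrow> - \<mu> * E t) (at 0)" by (simp only: DERIV_def)
  then have "\<forall>r>0. \<exists>s>0. \<forall>\<tau>. \<tau> \<noteq> 0 \<and> dist \<tau> 0 < s \<longrightarrow> dist ((E (t + \<tau>) - E t) / \<tau>) (- \<mu> * E t) < r" by (simp only: LIM_def)
  from this[rule_format, OF \<epsilon>1] obtain \<delta>1 where \<delta>1: "0 < \<delta>1"
    and e1': "\<forall>\<tau>. \<tau> \<noteq> 0 \<and> dist \<tau> 0 < \<delta>1 \<longrightarrow> dist ((E (t + \<tau>) - E t) / \<tau>) (- \<mu> * E t) < \<epsilon>1" by (elim exE conjE)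
  have e1: "\<bar>(E (t + \<tau>) - E t) / \<tau> - (- \<mu> * E t)\<bar> < \<epsilon>1" if "\<tau> \<noteq> 0" "\<bar>\<tau>\<bar> < \<delta>1" for \<tau>
    using e1'[rule_format, of \<tau>] that by (simp only: dist_real_def diff_zero simp_thms)
  have E1: "\<bar>E (t + \<tau>) - E t - (- \<mu> * E t) * \<tau>\<bar> \<le> \<epsilon>1 * \<bar>\<tau>\<bar>" if "\<bar>\<tau>\<bar> < \<delta>1" for \<tau>
  proof (cases "\<tau> = 0")
    case False
    have "E (t + \<tau>) - E t - (- \<mu> * E t) * \<tau> = ((E (t + \<tau>) - E t) / \<tau> - (- \<mu> * E t)) * \<tau>" using False by (simp add: field_simps)
    then show ?thesis using e1[OF False that] by (simp add: abs_mult mult_right_mono)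
  qed simp
  have "isCont G x" unfolding G_def by (intro continuous_intros)
  then obtain \<delta>2 where \<delta>2: "0 < \<delta>2" and e2: "\<And>y. dist y x < \<delta>2 \<Longrightarrow> dist (G y) (G x) < \<epsilon>2"
    using \<epsilon>2 unfolding continuous_at_eps_delta by blast
  have half_cancel: "k * (\<epsilon> / (2 * k)) = \<epsilon> / 2" if "k \<noteq> 0" for k using that by simp
  define c3 where "c3 = E t * \<theta> * K"
  have c3: "0 \<le> c3" using E0 \<theta> K by (simp add: c3_def)
  define \<delta> where "\<delta> = Min {\<delta>1, \<delta>2, 1 / (2 * norm x + 1), \<epsilon> / (2 * (c3 + 1)), \<epsilon> / (2 * (\<bar>\<kappa>\<bar> + 1))}"
  have \<delta>le: "\<delta> \<le> \<delta>1" "\<delta> \<le> \<delta>2" "\<delta> \<le> 1 / (2 * norm x + 1)" "\<delta> \<le> \<epsilon> / (2 * (c3 + 1))" "\<delta> \<le> \<epsilon> / (2 * (\<bar>\<kappa>\<bar> + 1))"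
    unfolding \<delta>_def by (intro Min_le; simp)+
  have \<delta>: "0 < \<delta>" unfolding \<delta>_def using \<delta>1 \<delta>2 \<epsilon> c3 by (simp add: add_nonneg_pos)
  show "\<exists>\<delta>>0. \<forall>\<tau> d. \<bar>\<tau>\<bar> < \<delta> \<longrightarrow> norm d < \<delta> \<longrightarrow>
      barrier \<mu> \<theta> n \<Phi> \<kappa> ts xs (t + \<tau>) (x + d) \<le> barrier \<mu> \<theta> n \<Phi> \<kappa> ts xs t x + barrier_t \<mu> \<theta> n \<Phi> \<kappa> ts xs t x * \<tau>
        + barrier_x \<mu> \<theta> n \<Phi> \<kappa> ts xs t x \<bullet> d + (d \<bullet> (barrier_xx \<mu> \<theta> n \<Phi> \<kappa> ts xs t x *v d)) / 2 + \<epsilon> * (\<bar>\<tau>\<bar> + (norm d)\<^sup>2)"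
  proof (intro exI[of _ \<delta>] conjI \<delta> allI impI)
    fix \<tau> :: real and d :: "real ^ 'a" assume \<tau>: "\<bar>\<tau>\<bar> < \<delta>" and d: "norm d < \<delta>"
    define a where "a = E (t + \<tau>) - E t - (- \<mu> * E t) * \<tau>"
    define g where "g = G (x + d) - G x"
    have a: "\<bar>a\<bar> \<le> \<epsilon>1 * \<bar>\<tau>\<bar>" unfolding a_def by (rule E1) (use \<tau> \<delta>le in linarith)
    have g: "\<bar>g\<bar> \<le> \<epsilon>2" using e2[of "x + d"] d \<delta>le(2) by (simp add: g_def dist_norm)
    have Gd: "\<bar>G (x + d)\<bar> \<le> \<bar>G x\<bar> + 1" using g \<epsilon>2_def unfolding g_def by linarith
    have "\<bar>a * G (x + d)\<bar> \<le> (\<epsilon>1 * \<bar>\<tau>\<bar>) * (\<bar>G x\<bar> + 1)" unfolding abs_mult using a Gd \<epsilon>1 by (intro mult_mono) auto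
    also have "\<dots> = (\<epsilon> / 4) * \<bar>\<tau>\<bar>"
    proof -
      define k where "k = \<bar>G x\<bar> + 1"
      have "k \<noteq> 0" unfolding k_def by linarith
      then show ?thesis unfolding \<epsilon>1_def k_def[symmetric] by simp
    qed
    finally have p1: "a * G (x + d) \<le> (\<epsilon> / 4) * \<bar>\<tau>\<bar>" by linarith
    have "\<bar>(- \<mu> * E t) * \<tau> * g\<bar> = (\<bar>\<mu>\<bar> * E t) * \<bar>\<tau>\<bar> * \<bar>g\<bar>" using E0 by (simp add: abs_mult)
    also have "\<dots> \<le> (\<bar>\<mu>\<bar> * E t + 1) * \<bar>\<tau>\<bar> * (\<epsilon> / (4 * (\<bar>\<mu>\<bar> * E t + 1)))"
      using g \<mu>E \<epsilon>2_def \<epsilon> by (intro mult_mono) auto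
    also have "\<dots> = (\<epsilon> / 4) * \<bar>\<tau>\<bar>"
    proof -
      define k where "k = \<bar>\<mu>\<bar> * E t + 1"
      have "k \<noteq> 0" unfolding k_def using \<mu>E by linarith
      then show ?thesis unfolding k_def[symmetric] by simp
    qed
    finally have p2: "(- \<mu> * E t) * \<tau> * g \<le> (\<epsilon> / 4) * \<bar>\<tau>\<bar>" by linarith
    have mx: "(2 * norm x + 1) * norm d \<le> 1"
    proof -
      have "norm d \<le> 1 / (2 * norm x + 1)" using d \<delta>le(3) by linarith
      moreover have "0 < 2 * norm x + 1" by (simp add: add_nonneg_pos)
      ultimately show ?thesis by (simp add: field_simps)
    qed
    define R where "R = (1 + (x + d) \<bullet> (x + d)) ^ (n + 2) - s ^ (n + 2) - g1 * (x \<bullet> d) - (g1 * (d \<bullet> d) + g2 * (x \<bullet> d)\<^sup>2) / 2"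
    have "E t * \<theta> * R \<le> E t * \<theta> * (K * norm d ^ 3)" using rad[OF mx] E0 \<theta> unfolding R_def by (intro mult_left_mono) auto
    also have "\<dots> = c3 * norm d * (norm d)\<^sup>2" by (simp add: c3_def power2_eq_square power3_eq_cube)
    also have "\<dots> \<le> (\<epsilon> / 2) * (norm d)\<^sup>2"
    proof (rule mult_right_mono)
      have "c3 * norm d \<le> (c3 + 1) * (\<epsilon> / (2 * (c3 + 1)))" using c3 d \<delta>le(4) by (intro mult_mono) auto
      also have "\<dots> = \<epsilon> / 2" by (rule half_cancel) (use c3 in linarith)
      finally show "c3 * norm d \<le> \<epsilon> / 2" .
    qed simp
    finally have p3: "E t * \<theta> * R \<le> (\<epsilon> / 2) * (norm d)\<^sup>2" .
    have p4: "\<kappa> * \<tau>\<^sup>2 \<le> (\<epsilon> / 2) * \<bar>\<tau>\<bar>"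
    proof -
      have "\<kappa> * \<tau>\<^sup>2 \<le> \<bar>\<kappa>\<bar> * \<tau>\<^sup>2" by (intro mult_right_mono) auto
      also have "\<dots> = (\<bar>\<kappa>\<bar> * \<bar>\<tau>\<bar>) * \<bar>\<tau>\<bar>" by (simp add: power2_eq_square mult.assoc)
      also have "\<dots> \<le> (\<epsilon> / 2) * \<bar>\<tau>\<bar>"
      proof (rule mult_right_mono)
        have "\<bar>\<kappa>\<bar> * \<bar>\<tau>\<bar> \<le> (\<bar>\<kappa>\<bar> + 1) * (\<epsilon> / (2 * (\<bar>\<kappa>\<bar> + 1)))" using \<tau> \<delta>le(5) by (intro mult_mono) auto
        also have "\<dots> = \<epsilon> / 2" by (rule half_cancel) linarith
        finally show "\<bar>\<kappa>\<bar> * \<bar>\<tau>\<bar> \<le> \<epsilon> / 2" .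
      qed simp
      finally show ?thesis .
    qed
    have b1: "barrier \<mu> \<theta> n \<Phi> \<kappa> ts xs (t + \<tau>) (x + d) = E (t + \<tau>) * G (x + d)
        + \<kappa> * ((t - ts)\<^sup>2 + 2 * (t - ts) * \<tau> + \<tau>\<^sup>2 + (x - xs) \<bullet> (x - xs) + 2 * ((x - xs) \<bullet> d) + d \<bullet> d)"
      unfolding barrier_def E_def G_def
      by (simp add: power2_eq_square inner_add_left inner_add_right inner_diff_left inner_diff_right inner_commute algebra_simps)
    have b2: "barrier \<mu> \<theta> n \<Phi> \<kappa> ts xs t x = E t * G x + \<kappa> * ((t - ts)\<^sup>2 + (x - xs) \<bullet> (x - xs))"
      by (simp add: barrier_def E_def G_def)
    have b3: "barrier_t \<mu> \<theta> n \<Phi> \<kappa> ts xs t x * \<tau> = (- \<mu> * E t) * \<tau> * G x + 2 * \<kappa> * (t - ts) * \<tau>"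
      by (simp add: barrier_t_def E_def G_def algebra_simps)
    have b4: "barrier_x \<mu> \<theta> n \<Phi> \<kappa> ts xs t x \<bullet> d = E t * \<theta> * (g1 * (x \<bullet> d)) + 2 * \<kappa> * ((x - xs) \<bullet> d)"
      by (simp add: barrier_x_def E_def g1_def s_def inner_add_left)
    have b5: "(d \<bullet> (barrier_xx \<mu> \<theta> n \<Phi> \<kappa> ts xs t x *v d)) / 2 = E t * \<theta> * ((g1 * (d \<bullet> d) + g2 * (x \<bullet> d)\<^sup>2) / 2) + \<kappa> * (d \<bullet> d)"
      unfolding barrier_xx_works E_def[symmetric] s_def[symmetric] g1_def[symmetric] g2_def[symmetric] by (simp add: field_simps)
    have Ea: "E (t + \<tau>) = E t + (- \<mu> * E t) * \<tau> + a" by (simp add: a_def)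
    have "E (t + \<tau>) * G (x + d) = (E t + (- \<mu> * E t) * \<tau> + a) * G (x + d)" by (simp only: Ea)
    also have "\<dots> = E t * G (x + d) + (- \<mu> * E t) * \<tau> * (G x + g) + a * G (x + d)"
      by (simp add: g_def algebra_simps)
    finally have "E (t + \<tau>) * G (x + d) = E t * G (x + d) + (- \<mu> * E t) * \<tau> * (G x + g) + a * G (x + d)" .
    moreover have "E t * G (x + d) = E t * G x + E t * \<theta> * (g1 * (x \<bullet> d)) + E t * \<theta> * ((g1 * (d \<bullet> d) + g2 * (x \<bullet> d)\<^sup>2) / 2) + E t * \<theta> * R"
      unfolding G_def R_def s_def[symmetric] by (simp add: field_simps)
    ultimately have Eeq: "E (t + \<tau>) * G (x + d) = E t * G x + E t * \<theta> * (g1 * (x \<bullet> d)) + E t * \<theta> * ((g1 * (d \<bullet> d) + g2 * (x \<bullet> d)\<^sup>2) / 2) + E t * \<theta> * R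
       + (- \<mu> * E t) * \<tau> * G x + (- \<mu> * E t) * \<tau> * g + a * G (x + d)" by (simp add: distrib_left)
    have \<epsilon>eq: "\<epsilon> * (\<bar>\<tau>\<bar> + (norm d)\<^sup>2) = \<epsilon> * \<bar>\<tau>\<bar> + \<epsilon> * (norm d)\<^sup>2" by (simp add: distrib_left)
    have \<epsilon>d: "0 \<le> \<epsilon> * (norm d)\<^sup>2" using \<epsilon> by simp
    have keq: "\<kappa> * ((t - ts)\<^sup>2 + 2 * (t - ts) * \<tau> + \<tau>\<^sup>2 + (x - xs) \<bullet> (x - xs) + 2 * ((x - xs) \<bullet> d) + d \<bullet> d)
      = \<kappa> * ((t - ts)\<^sup>2 + (x - xs) \<bullet> (x - xs)) + 2 * \<kappa> * (t - ts) * \<tau> + \<kappa> * \<tau>\<^sup>2 + 2 * \<kappa> * ((x - xs) \<bullet> d) + \<kappa> * (d \<bullet> d)"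
      by (simp add: algebra_simps)
    show "barrier \<mu> \<theta> n \<Phi> \<kappa> ts xs (t + \<tau>) (x + d) \<le> barrier \<mu> \<theta> n \<Phi> \<kappa> ts xs t x + barrier_t \<mu> \<theta> n \<Phi> \<kappa> ts xs t x * \<tau>
        + barrier_x \<mu> \<theta> n \<Phi> \<kappa> ts xs t x \<bullet> d + (d \<bullet> (barrier_xx \<mu> \<theta> n \<Phi> \<kappa> ts xs t x *v d)) / 2 + \<epsilon> * (\<bar>\<tau>\<bar> + (norm d)\<^sup>2)"
      unfolding b1 b2 b3 b4 b5 Eeq keq \<epsilon>eq using p1 p2 p3 p4 \<epsilon>d by simp
  qed
qed

section \<open>Doubling of variables\<close>

text \<open>
  Once \<open>\<psi>\<close> is subtracted from \<open>u\<close>, the penalty is a quadratic form of the difference of the two points, and the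
  trace theorem on sums applies with the columns of \<open>\<sigma>\<close> at the two points. The strict obstacle inequalities
  remove the obstacles from the sub- and supersolution inequalities, also for limiting jets.
\<close>

lemma doubled_maximum_inequality:
  fixes u w :: "'i::finite \<Rightarrow> 'j::finite \<Rightarrow> real \<Rightarrow> real ^ 'k \<Rightarrow> real"
    and \<sigma> :: "real \<Rightarrow> real ^ 'k \<Rightarrow> real ^ 'd ^ 'k"
  assumes sub: "viscosity_subsolution T b \<sigma> f gl gu h u" and super: "viscosity_supersolution T b \<sigma> f gl gu h w"
    and \<psi>: "continuous_on UNIV (\<lambda>(t, x). \<psi> t x)" "continuous_on UNIV (\<lambda>(t, x). \<psi>t t x)" 
      "continuous_on UNIV (\<lambda>(t, x). \<psi>x t x)" "continuous_on UNIV (\<lambda>(t, x). \<psi>xx t x)"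
      "\<And>t x. parabolic_expansion \<psi> t x (\<psi>t t x) (\<psi>x t x) (\<psi>xx t x)"
    and D: "D = dom_T T \<inter> cball z 1" and t: "t \<in> {0..<T}" "dist z (t, x) < 1" and s: "s \<in> {0..<T}" "dist z (s, y) < 1"
    and n: "0 \<le> N" "0 \<le> n"
    and max: "\<And>t' x' s' y'. (t', x') \<in> D \<Longrightarrow> (s', y') \<in> D \<Longrightarrow>
      u i j t' x' - \<psi> t' x' - w i j s' y' - (N * (t' - s')\<^sup>2 + n * (norm (x' - y'))\<^sup>2) / 2
      \<le> u i j t x - \<psi> t x - w i j s y - (N * (t - s)\<^sup>2 + n * (norm (x - y))\<^sup>2) / 2"
    and strict: "\<And>k. k \<noteq> i \<Longrightarrow> u k j t x - gl i k t x < u i j t x" "\<And>l. l \<noteq> j \<Longrightarrow> w i j s y < w i l s y + gu j l s y"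
  defines "q \<equiv> n *\<^sub>R (x - y)"
  shows "- \<psi>t t x - b t x \<bullet> \<psi>x t x + (b s y - b t x) \<bullet> q
    - f i j t x (\<chi> m. u (fst m) (snd m) t x) (transpose (\<sigma> t x) *v (q + \<psi>x t x))
    + f i j s y (\<chi> m. w (fst m) (snd m) s y) (transpose (\<sigma> s y) *v q)
    - trace (\<sigma> t x ** transpose (\<sigma> t x) ** \<psi>xx t x) / 2 \<le> n * (norm (\<sigma> t x - \<sigma> s y))\<^sup>2 / 2"
proof -
  define p where "p = N * (t - s)"
  define P where "P = (p, q)"
  define A :: "real \<times> (real ^ 'k) \<Rightarrow> real \<times> (real ^ 'k)" where "A = (\<lambda>(\<tau>, d). (sqrt N * \<tau>, sqrt n *\<^sub>R d))"
  have A_lin: "linear A"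
    by (rule linearI) (auto simp: A_def case_prod_unfold algebra_simps)
  have A_sq: "(norm (A e))\<^sup>2 = N * (fst e)\<^sup>2 + n * (norm (snd e))\<^sup>2" for e
    using n by (simp add: A_def case_prod_unfold norm_Pair power_mult_distrib)
  have A_bound: "norm (A e) \<le> sqrt (N + n) * norm e" for e
  proof (rule power2_le_imp_le)
    have "(norm (A e))\<^sup>2 = N * (fst e)\<^sup>2 + n * (norm (snd e))\<^sup>2" by (rule A_sq)
    also have "\<dots> \<le> (N + n) * (fst e)\<^sup>2 + (N + n) * (norm (snd e))\<^sup>2" using n by (intro add_mono mult_right_mono) auto
    also have "\<dots> = (sqrt (N + n) * norm e)\<^sup>2"
      using n by (simp add: power_mult_distrib norm_prod_def distrib_left)
    finally show "(norm (A e))\<^sup>2 \<le> (sqrt (N + n) * norm e)\<^sup>2" .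
  qed (use n in auto)
  have Dc: "closed D" unfolding D by (intro closed_Int closed_Times) auto
  have X0: "(t, x) \<in> D" and Y0: "(s, y) \<in> D" using t s by (auto simp: D)
  have uscu: "usc_on D (\<lambda>(t, x). u i j t x - \<psi> t x)"
  proof -
    have "usc_on (dom_T T) (\<lambda>(t, x). u i j t x)" using sub by (simp add: viscosity_subsolution_def)
    then have "usc_on D (\<lambda>(t, x). u i j t x)" by (rule usc_on_subset) (auto simp: D)
    from usc_on_diff_continuous[OF this continuous_on_subset[OF \<psi>(1) subset_UNIV]] show ?thesis
      by (simp add: case_prod_unfold)
  qed
  have uscw: "usc_on D (\<lambda>(t, x). - w i j t x - 0)"
  proof -
    have "lsc_on (dom_T T) (\<lambda>(t, x). w i j t x)" using super by (simp add: viscosity_supersolution_def)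
    from usc_on_uminus_lsc[OF this] have "usc_on D (\<lambda>z. - (\<lambda>(t, x). w i j t x) z)" by (rule usc_on_subset) (auto simp: D)
    then show ?thesis by (simp add: case_prod_unfold)
  qed
  define a where "a = (\<lambda>l. (0 :: real, column l (\<sigma> t x)))"
  define c where "c = (\<lambda>l. (0 :: real, column l (\<sigma> s y)))"
  define \<gamma> where "\<gamma> = 2 * (- (p + \<psi>t t x) - b t x \<bullet> (q + \<psi>x t x) - f i j t x (\<chi> m. u (fst m) (snd m) t x) (transpose (\<sigma> t x) *v (q + \<psi>x t x)))"
  define \<beta> where "\<beta> = 2 * (p + b s y \<bullet> q + f i j s y (\<chi> m. w (fst m) (snd m) s y) (transpose (\<sigma> s y) *v q))"
  have 1: "limiting_superjets_bound a D (\<lambda>(t, x). u i j t x - \<psi> t x) (t, x) P (\<gamma> - (\<Sum>l\<in>UNIV. column l (\<sigma> t x) \<bullet> (\<psi>xx t x *v column l (\<sigma> t x))))"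
    unfolding a_def
  proof (rule limiting_superjets_bound_from_closure[OF D _ t(2) \<psi>])
    show "t \<in> {0..T}" using t by auto
    fix M assume "(fst P + \<psi>t t x, snd P + \<psi>x t x, M) \<in> superjet_closure T (u i j) t x"
    then have "system_operator b \<sigma> f gl gu u i j t x (fst P + \<psi>t t x) (snd P + \<psi>x t x) M \<le> 0"
      using sub t(1) unfolding viscosity_subsolution_def by blast
    then have "pde_term b \<sigma> f u i j t x (fst P + \<psi>t t x) (snd P + \<psi>x t x) M \<le> 0"
      unfolding system_operator_le_0_iff using strict(1) by (meson not_le)
    then show "\<gamma> \<le> (\<Sum>l\<in>UNIV. column l (\<sigma> t x) \<bullet> (M *v column l (\<sigma> t x)))"
      unfolding pde_term_def trace_sigma \<gamma>_def P_def by simp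
  qed
  have 2: "limiting_superjets_bound c D (\<lambda>(t, x). - w i j t x - 0) (s, y) (- P) (\<beta> - (\<Sum>l\<in>UNIV. column l (\<sigma> s y) \<bullet> (0 *v column l (\<sigma> s y))))"
    unfolding c_def
  proof (rule limiting_superjets_bound_from_closure[where \<psi>="\<lambda>t x. 0" and v="\<lambda>t x. - w i j t x" and cxx="\<lambda>t x. 0", OF D _ s(2)])
    show "s \<in> {0..T}" using s by auto
    show "parabolic_expansion (\<lambda>t x. 0) t x 0 0 0" for t and x :: "real ^ 'k" by (rule parabolic_expansion_zero)
    fix M assume "(fst (- P) + 0, snd (- P) + 0, M) \<in> superjet_closure T (\<lambda>t x. - w i j t x) s y"
    from superjet_closure_uminus[OF this] have "(p, q, - M) \<in> subjet_closure T (w i j) s y" by (simp add: P_def)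
    then have "0 \<le> system_operator b \<sigma> f gl gu w i j s y p q (- M)"
      using super s(1) unfolding viscosity_supersolution_def by blast
    then have "0 \<le> pde_term b \<sigma> f w i j s y p q (- M)"
      unfolding system_operator_ge_0_iff using strict(2) by (meson not_le)
    moreover have "(\<Sum>l\<in>UNIV. column l (\<sigma> s y) \<bullet> ((- M) *v column l (\<sigma> s y))) = - (\<Sum>l\<in>UNIV. column l (\<sigma> s y) \<bullet> (M *v column l (\<sigma> s y)))"
      by (simp add: uminus_matrix_vector_mult sum_negf)
    ultimately show "\<beta> \<le> (\<Sum>l\<in>UNIV. column l (\<sigma> s y) \<bullet> (M *v column l (\<sigma> s y)))"
      unfolding pde_term_def trace_sigma \<beta>_def by simp
  qed (simp_all add: case_prod_unfold)
  have "(\<gamma> - (\<Sum>l\<in>UNIV. column l (\<sigma> t x) \<bullet> (\<psi>xx t x *v column l (\<sigma> t x)))) + (\<beta> - (\<Sum>l\<in>UNIV. column l (\<sigma> s y) \<bullet> (0 *v column l (\<sigma> s y))))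
     \<le> (\<Sum>l\<in>UNIV. (norm (A (a l - c l)))\<^sup>2)"
  proof (rule trace_theorem_on_sums[OF A_lin A_bound Dc Dc X0 Y0 uscu uscw _ 1 2])
    fix X Y assume X: "X \<in> D" and Y: "Y \<in> D"
    obtain t' x' s' y' where XY: "X = (t', x')" "Y = (s', y')" by (cases X, cases Y)
    define \<tau> d where "\<tau> = (t' - t) - (s' - s)" and "d = (x' - x) - (y' - y)"
    have e: "(X - (t, x)) - (Y - (s, y)) = (\<tau>, d)" by (simp add: XY \<tau>_def d_def)
    have sq1: "(t' - s')\<^sup>2 = (t - s)\<^sup>2 + 2 * ((t - s) * \<tau>) + \<tau>\<^sup>2" by (simp add: \<tau>_def power2_eq_square algebra_simps)
    have "x' - y' = (x - y) + d" by (simp add: d_def)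
    then have sq2: "(norm (x' - y'))\<^sup>2 = (norm (x - y))\<^sup>2 + 2 * ((x - y) \<bullet> d) + (norm d)\<^sup>2"
      unfolding power2_norm_eq_inner by (simp only: inner_add_left inner_add_right) (simp add: inner_commute)
    have "P \<bullet> (X - (t, x)) + (- P) \<bullet> (Y - (s, y)) = P \<bullet> (\<tau>, d)" unfolding e[symmetric] by (simp add: inner_diff_right)
    also have "\<dots> = N * ((t - s) * \<tau>) + n * ((x - y) \<bullet> d)" by (simp add: P_def p_def q_def inner_prod_def)
    finally have Pe: "P \<bullet> (X - (t, x)) + (- P) \<bullet> (Y - (s, y)) = N * ((t - s) * \<tau>) + n * ((x - y) \<bullet> d)" .
    have Ae: "(norm (A (\<tau>, d)))\<^sup>2 / 2 = (N * \<tau>\<^sup>2 + n * (norm d)\<^sup>2) / 2" unfolding A_sq by simp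
    have "(N * (t' - s')\<^sup>2 + n * (norm (x' - y'))\<^sup>2) / 2 = (N * (t - s)\<^sup>2 + n * (norm (x - y))\<^sup>2) / 2
      + (N * ((t - s) * \<tau>) + n * ((x - y) \<bullet> d)) + (N * \<tau>\<^sup>2 + n * (norm d)\<^sup>2) / 2"
      unfolding sq1 sq2 by (simp add: field_simps)
    moreover have "(case X of (t, x) \<Rightarrow> u i j t x - \<psi> t x) = u i j t' x' - \<psi> t' x'" "(case Y of (t, x) \<Rightarrow> - w i j t x - 0) = - w i j s' y'"
      by (simp_all add: XY)
    moreover have "u i j t' x' - \<psi> t' x' - w i j s' y' - (N * (t' - s')\<^sup>2 + n * (norm (x' - y'))\<^sup>2) / 2
      \<le> u i j t x - \<psi> t x - w i j s y - (N * (t - s)\<^sup>2 + n * (norm (x - y))\<^sup>2) / 2"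
      using X Y by (intro max) (simp_all add: XY)
    ultimately show "(case X of (t, x) \<Rightarrow> u i j t x - \<psi> t x) + (case Y of (t, x) \<Rightarrow> - w i j t x - 0)
      \<le> (case (t, x) of (t, x) \<Rightarrow> u i j t x - \<psi> t x) + (case (s, y) of (t, x) \<Rightarrow> - w i j t x - 0)
        + P \<bullet> (X - (t, x)) + (- P) \<bullet> (Y - (s, y)) + (norm (A ((X - (t, x)) - (Y - (s, y)))))\<^sup>2 / 2"
      unfolding e Ae case_prod_conv using Pe by linarith
  qed
  also have "(\<Sum>l\<in>UNIV. (norm (A (a l - c l)))\<^sup>2) = n * (norm (\<sigma> t x - \<sigma> s y))\<^sup>2"
  proof -
    have "column l (\<sigma> t x) - column l (\<sigma> s y) = column l (\<sigma> t x - \<sigma> s y)" for l by (simp add: column_def vec_eq_iff)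
    then show ?thesis unfolding A_sq norm_matrix_sq_columns by (simp add: a_def c_def sum_distrib_left)
  qed
  finally show ?thesis unfolding trace_sigma \<gamma>_def \<beta>_def
    by (simp add: inner_diff_left inner_add_right field_simps)
qed

text \<open>
  Every accumulation point \<open>l\<close> of the two sequences satisfies \<open>U l + V l \<ge> 0\<close> by semicontinuity, hence is \<open>z\<close>.
  Upper bounds for one of \<open>U (X n)\<close> and \<open>V (Y n)\<close> turn into lower bounds for the other.
\<close>

lemma penalized_maxima_converge:
  fixes X Y :: "nat \<Rightarrow> 'a::real_normed_vector"
  assumes D: "compact D" and U: "usc_on D U" and V: "usc_on D V" and z: "z \<in> D" "U z + V z = 0"
    and strict: "\<And>x. x \<in> D \<Longrightarrow> x \<noteq> z \<Longrightarrow> U x + V x < 0"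
    and XY: "\<And>n. X n \<in> D" "\<And>n. Y n \<in> D" "\<And>n. 0 \<le> U (X n) + V (Y n)" "(\<lambda>n. X n - Y n) \<longlonglongrightarrow> 0"
  shows "X \<longlonglongrightarrow> z" "Y \<longlonglongrightarrow> z" "(\<lambda>n. U (X n)) \<longlonglongrightarrow> U z" "(\<lambda>n. V (Y n)) \<longlonglongrightarrow> V z"
proof -
  show X: "X \<longlonglongrightarrow> z"
  proof (rule ccontr)
    assume "\<not> X \<longlonglongrightarrow> z"
    then obtain \<epsilon> where \<epsilon>: "0 < \<epsilon>" "\<And>N. \<exists>n\<ge>N. \<epsilon> \<le> dist (X n) z" unfolding LIMSEQ_def by (meson not_less)
    have inf: "infinite {n. \<epsilon> \<le> dist (X n) z}" unfolding infinite_nat_iff_unbounded_le using \<epsilon>(2) by auto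
    then obtain r :: "nat \<Rightarrow> nat" where r: "strict_mono r" "\<And>n. \<epsilon> \<le> dist (X (r n)) z" using infinite_enumerate[OF inf] by auto
    obtain l r' where l: "l \<in> D" and r': "strict_mono (r' :: nat \<Rightarrow> nat)" and lim: "((\<lambda>n. X (r n)) \<circ> r') \<longlonglongrightarrow> l"
      using D XY(1) unfolding compact_def by meson
    have limX: "(\<lambda>n. X (r (r' n))) \<longlonglongrightarrow> l" using lim by (simp add: comp_def)
    have "(\<lambda>n. X (r (r' n)) - Y (r (r' n))) \<longlonglongrightarrow> 0"
      using LIMSEQ_subseq_LIMSEQ[OF LIMSEQ_subseq_LIMSEQ[OF XY(4) r(1)] r'] by (simp add: comp_def)
    from tendsto_diff[OF limX this] have limY: "(\<lambda>n. Y (r (r' n))) \<longlonglongrightarrow> l" by simp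
    have "\<epsilon> \<le> dist l z" using r(2) by (intro LIMSEQ_le_const[OF tendsto_dist[OF limX tendsto_const]]) auto
    then have "l \<noteq> z" using \<epsilon> by auto
    from strict[OF l this] have neg: "U l + V l < 0" .
    define \<eta> where "\<eta> = - (U l + V l) / 2"
    have \<eta>: "0 < \<eta>" using neg by (simp add: \<eta>_def)
    have "\<forall>\<^sub>F n in sequentially. U (X (r (r' n))) < U l + \<eta>" using \<eta> by (intro usc_on_eventually_less[OF U XY(1) limX l]) simp
    moreover have "\<forall>\<^sub>F n in sequentially. V (Y (r (r' n))) < V l + \<eta>" using \<eta> by (intro usc_on_eventually_less[OF V XY(2) limY l]) simp
    ultimately have "\<forall>\<^sub>F n in sequentially. False"
    proof eventually_elim
      case (elim n)
      have "(U l + \<eta>) + (V l + \<eta>) = 0" by (simp add: \<eta>_def)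
      then show ?case using elim XY(3)[of "r (r' n)"] by linarith
    qed
    then show False by simp
  qed
  from tendsto_diff[OF X XY(4)] show Y: "Y \<longlonglongrightarrow> z" by simp
  have Uu: "\<forall>\<^sub>F n in sequentially. U (X n) < c" if "U z < c" for c by (rule usc_on_eventually_less[OF U XY(1) X z(1) that])
  have Vu: "\<forall>\<^sub>F n in sequentially. V (Y n) < c" if "V z < c" for c by (rule usc_on_eventually_less[OF V XY(2) Y z(1) that])
  show "(\<lambda>n. U (X n)) \<longlonglongrightarrow> U z"
  proof (rule order_tendstoI[OF _ Uu])
    fix a assume "a < U z"
    then have "V z < - a" using z(2) by linarith
    from Vu[OF this] show "\<forall>\<^sub>F n in sequentially. a < U (X n)"
    proof eventually_elim
      case (elim n) then show ?case using XY(3)[of n] by linarith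
    qed
  qed
  show "(\<lambda>n. V (Y n)) \<longlonglongrightarrow> V z"
  proof (rule order_tendstoI[OF _ Vu])
    fix a assume "a < V z"
    then have "U z < - a" using z(2) by linarith
    from Uu[OF this] show "\<forall>\<^sub>F n in sequentially. a < V (Y n)"
    proof eventually_elim
      case (elim n) then show ?case using XY(3)[of n] by linarith
    qed
  qed
qed

text \<open>
  If the strict barrier \<open>\<psi>\<close> touches the maximising difference \<open>u i j - w i j\<close> from above at \<open>(ts, xs)\<close>, then it satisfies
  the inequality that a subsolution of the linearised system would satisfy there. The variables are
  doubled in a ball around \<open>(ts, xs)\<close>. The coefficients are Lipschitz continuous in space but only continuous
  in time, so the penalty \<open>N n\<close> in time is chosen depending on the penalty \<open>m n\<close> in space. In the limit the
  terms with the unbounded slope \<open>q\<close> vanish by the Lipschitz condition. The values of the components other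
  than \<open>(i, j)\<close> at the maximum points need not converge; semicontinuity gives one-sided bounds, which
  are the ones that monotonicity of \<open>f\<close> requires.
\<close>

lemma touching_inequality:
  fixes u w :: "'i::finite \<Rightarrow> 'j::finite \<Rightarrow> real \<Rightarrow> real ^ 'k \<Rightarrow> real"
    and \<sigma> :: "real \<Rightarrow> real ^ 'k \<Rightarrow> real ^ 'd ^ 'k"
    and f :: "'i \<Rightarrow> 'j \<Rightarrow> real \<Rightarrow> real ^ 'k \<Rightarrow> real ^ ('i \<times> 'j) \<Rightarrow> real ^ 'd \<Rightarrow> real"
  assumes sub: "viscosity_subsolution T b \<sigma> f gl gu h u" and super: "viscosity_supersolution T b \<sigma> f gl gu h w"
    and b_cont: "continuous_on (dom_T T) (\<lambda>(t, x). b t x)" and \<sigma>_cont: "continuous_on (dom_T T) (\<lambda>(t, x). \<sigma> t x)"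
    and C: "0 \<le> C" "\<And>t x x'. t \<in> {0..T} \<Longrightarrow> norm (\<sigma> t x - \<sigma> t x') + norm (b t x - b t x') \<le> C * norm (x - x')"
    and f_cont: "continuous_tx_uniformly_yz T (f i j)"
    and L: "0 \<le> L" "\<And>t x y1 y2 z1 z2. t \<in> {0..T} \<Longrightarrow> \<bar>f i j t x y1 z1 - f i j t x y2 z2\<bar> \<le> L * (norm (y1 - y2) + norm (z1 - z2))"
    and mono: "\<And>m t x y y' z. m \<noteq> (i, j) \<Longrightarrow> t \<in> {0..T} \<Longrightarrow> y $ m \<le> y' $ m \<Longrightarrow> (\<And>n. n \<noteq> m \<Longrightarrow> y $ n = y' $ n) \<Longrightarrow> f i j t x y z \<le> f i j t x y' z"
    and gl: "\<And>i k. continuous_on (dom_T T) (\<lambda>(t, x). gl i k t x)" and gu: "\<And>j l. continuous_on (dom_T T) (\<lambda>(t, x). gu j l t x)"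
    and ts: "ts \<in> {0..<T}"
    and \<psi>: "continuous_on UNIV (\<lambda>(t, x). \<psi> t x)" "continuous_on UNIV (\<lambda>(t, x). \<psi>t t x)" 
      "continuous_on UNIV (\<lambda>(t, x). \<psi>x t x)" "continuous_on UNIV (\<lambda>(t, x). \<psi>xx t x)"
      "\<And>t x. parabolic_expansion \<psi> t x (\<psi>t t x) (\<psi>x t x) (\<psi>xx t x)"
    and touch: "\<And>t x. t \<in> {0..T} \<Longrightarrow> (t, x) \<noteq> (ts, xs) \<Longrightarrow> u i j t x - w i j t x < \<psi> t x" "u i j ts xs - w i j ts xs = \<psi> ts xs"
    and all: "\<And>k l. u k l ts xs - w k l ts xs \<le> \<psi> ts xs" and \<psi>0: "0 \<le> \<psi> ts xs"
    and strict: "\<And>k. k \<noteq> i \<Longrightarrow> u k j ts xs - gl i k ts xs < u i j ts xs" "\<And>l. l \<noteq> j \<Longrightarrow> w i j ts xs < w i l ts xs + gu j l ts xs"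
  shows "- \<psi>t ts xs - b ts xs \<bullet> \<psi>x ts xs - L * norm (transpose (\<sigma> ts xs) *v \<psi>x ts xs)
    - trace (\<sigma> ts xs ** transpose (\<sigma> ts xs) ** \<psi>xx ts xs) / 2 \<le> L * (real CARD('i \<times> 'j) * \<psi> ts xs)"
proof -
  define z where "z = (ts, xs)"
  define D where "D = dom_T T \<inter> cball z 1"
  define U where "U = (\<lambda>(t, x). u i j t x - \<psi> t x)"
  define V where "V = (\<lambda>(t, x). - w i j t x)"
  have ts': "ts \<in> {0..T}" using ts by auto
  have zdom: "z \<in> dom_T T" using ts' by (simp add: z_def)
  have zD: "z \<in> D" using zdom by (simp add: D_def)
  have Dc: "compact D" unfolding D_def by (rule compact_dom_cball)
  have Ddom: "D \<subseteq> dom_T T" by (auto simp: D_def)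
  have usc_u: "usc_on (dom_T T) (\<lambda>(t, x). u k l t x)" for k l using sub by (simp add: viscosity_subsolution_def)
  have usc_w: "usc_on (dom_T T) (\<lambda>(t, x). - w k l t x)" for k l
  proof -
    have "lsc_on (dom_T T) (\<lambda>(t, x). w k l t x)" using super by (simp add: viscosity_supersolution_def)
    from usc_on_uminus_lsc[OF this] show ?thesis by (simp add: case_prod_unfold)
  qed
  have uscU: "usc_on D U"
    using usc_on_subset[OF usc_on_diff_continuous[OF usc_u[of i j] continuous_on_subset[OF \<psi>(1) subset_UNIV]] Ddom]
    by (simp add: U_def case_prod_unfold)
  have uscV: "usc_on D V" using usc_on_subset[OF usc_w Ddom] by (simp add: V_def)
  have UVz: "U z + V z = 0" using touch(2) by (simp add: U_def V_def z_def)
  have UVneg: "U X + V X < 0" if X: "X \<in> D" "X \<noteq> z" for X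
  proof -
    obtain t x where tx: "X = (t, x)" by (cases X)
    have "t \<in> {0..T}" "(t, x) \<noteq> (ts, xs)" using X by (auto simp: D_def tx z_def)
    from touch(1)[OF this] show ?thesis by (simp add: U_def V_def tx)
  qed
  have ne: "D \<noteq> {}" using zD by auto
  obtain XU where XU: "XU \<in> D" "\<And>X. X \<in> D \<Longrightarrow> U X \<le> U XU" using usc_on_attains_max[OF Dc ne uscU] by blast
  obtain XV where XV: "XV \<in> D" "\<And>X. X \<in> D \<Longrightarrow> V X \<le> V XV" using usc_on_attains_max[OF Dc ne uscV] by blast
  define B where "B = U XU + V XV"
  have B0: "0 \<le> B" using XU(2)[OF zD] XV(2)[OF zD] UVz by (simp add: B_def)
  define m where "m n = real (Suc n)" for n
  have m: "1 \<le> m n" "0 < m n" for n by (simp_all add: m_def)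
  define K where "K = {0..T} \<times> cball xs 1"
  have K: "compact K" unfolding K_def by (intro compact_Times) auto
  have Kdom: "K \<subseteq> dom_T T" by (auto simp: K_def)
  have ucs: "uniformly_continuous_on K (\<lambda>(t, x). \<sigma> t x)" "uniformly_continuous_on K (\<lambda>(t, x). b t x)"
    by (intro compact_uniformly_continuous[OF continuous_on_subset[OF _ Kdom] K] \<sigma>_cont b_cont)+
  have modex: "\<exists>d>0. \<forall>t\<in>{0..T}. \<forall>s\<in>{0..T}. \<forall>y\<in>cball xs 1. \<bar>t - s\<bar> < d \<longrightarrow> norm (\<sigma> t y - \<sigma> s y) + norm (b t y - b s y) \<le> \<epsilon>" if "0 < \<epsilon>" for \<epsilon>
  proof -
    have \<epsilon>: "0 < \<epsilon> / 2" using that by simp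
    obtain d1 where d1: "0 < d1" "\<And>X Y. X \<in> K \<Longrightarrow> Y \<in> K \<Longrightarrow> dist Y X < d1 \<Longrightarrow> dist ((\<lambda>(t, x). \<sigma> t x) Y) ((\<lambda>(t, x). \<sigma> t x) X) < \<epsilon> / 2"
      using ucs(1) \<epsilon> unfolding uniformly_continuous_on_def by metis
    obtain d2 where d2: "0 < d2" "\<And>X Y. X \<in> K \<Longrightarrow> Y \<in> K \<Longrightarrow> dist Y X < d2 \<Longrightarrow> dist ((\<lambda>(t, x). b t x) Y) ((\<lambda>(t, x). b t x) X) < \<epsilon> / 2"
      using ucs(2) \<epsilon> unfolding uniformly_continuous_on_def by metis
    show ?thesis
    proof (intro exI[of _ "min d1 d2"] conjI ballI impI)
      show "0 < min d1 d2" using d1 d2 by simp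
      fix t s y assume *: "t \<in> {0..T}" "s \<in> {0..T}" "y \<in> cball xs 1" "\<bar>t - s\<bar> < min d1 d2"
      have "dist (t, y) (s, y) = \<bar>t - s\<bar>" by (simp add: dist_Pair_Pair dist_real_def)
      moreover have yK: "(s, y) \<in> K" "(t, y) \<in> K" using *(1-3) by (auto simp: K_def)
      ultimately have "dist (\<sigma> t y) (\<sigma> s y) < \<epsilon> / 2" "dist (b t y) (b s y) < \<epsilon> / 2"
        using d1(2)[OF yK] d2(2)[OF yK] *(4) by simp_all
      then show "norm (\<sigma> t y - \<sigma> s y) + norm (b t y - b s y) \<le> \<epsilon>" by (simp add: dist_norm)
    qed
  qed
  have "\<forall>n. \<exists>d>0. \<forall>t\<in>{0..T}. \<forall>s\<in>{0..T}. \<forall>y\<in>cball xs 1. \<bar>t - s\<bar> < d \<longrightarrow> norm (\<sigma> t y - \<sigma> s y) + norm (b t y - b s y) \<le> 1 / (m n)\<^sup>2"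
    by (intro allI modex) (simp add: m_def)
  then obtain d where d: "\<And>n. 0 < d n" and modulus: "\<And>n t s y. t \<in> {0..T} \<Longrightarrow> s \<in> {0..T} \<Longrightarrow> y \<in> cball xs 1 \<Longrightarrow> \<bar>t - s\<bar> < d n \<Longrightarrow>
     norm (\<sigma> t y - \<sigma> s y) + norm (b t y - b s y) \<le> 1 / (m n)\<^sup>2" by metis
  \<comment> \<open>With this choice the time components of the maximum points are closer than \<open>d n\<close>: the penalty
    is at most \<open>B\<close>.\<close>
  define N where "N n = m n + 2 * B / (d n)\<^sup>2" for n
  have N: "m n \<le> N n" for n using B0 by (simp add: N_def)
  define pen where "pen n Z = (N n * (fst (fst Z) - fst (snd Z))\<^sup>2 + m n * (norm (snd (fst Z) - snd (snd Z)))\<^sup>2) / 2" 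
    for n and Z :: "(real \<times> (real ^ 'k)) \<times> real \<times> (real ^ 'k)"
  have N0: "0 \<le> N n" for n using N[of n] m(2)[of n] by linarith
  have pen0: "0 \<le> pen n Z" for n Z unfolding pen_def using N0[of n] m(2)[of n] by simp
  have "\<exists>Z\<in>D \<times> D. \<forall>Z'\<in>D \<times> D. (U (fst Z') + V (snd Z')) - pen n Z' \<le> (U (fst Z) + V (snd Z)) - pen n Z" for n
  proof (rule usc_on_attains_max)
    show "compact (D \<times> D)" by (intro compact_Times Dc)
    show "D \<times> D \<noteq> {}" using zD by auto
    show "usc_on (D \<times> D) (\<lambda>Z. (U (fst Z) + V (snd Z)) - pen n Z)"
    proof (intro usc_on_diff_continuous usc_on_add)
      show "usc_on (D \<times> D) (\<lambda>Z. U (fst Z))" by (rule usc_on_compose[OF uscU]) (auto intro!: continuous_intros)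
      show "usc_on (D \<times> D) (\<lambda>Z. V (snd Z))" by (rule usc_on_compose[OF uscV]) (auto intro!: continuous_intros)
      show "continuous_on (D \<times> D) (pen n)" unfolding pen_def by (intro continuous_intros) auto
    qed
  qed
  then obtain Z where Z: "\<And>n. Z n \<in> D \<times> D" 
    and Zmax: "\<And>n Z'. Z' \<in> D \<times> D \<Longrightarrow> (U (fst Z') + V (snd Z')) - pen n Z' \<le> (U (fst (Z n)) + V (snd (Z n))) - pen n (Z n)" by metis
  define X Y where "X n = fst (Z n)" and "Y n = snd (Z n)" for n
  define t x s y where "t n = fst (X n)" and "x n = snd (X n)" and "s n = fst (Y n)" and "y n = snd (Y n)" for n
  have XY: "X n = (t n, x n)" "Y n = (s n, y n)" for n by (simp_all add: t_def x_def s_def y_def)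
  have XD: "X n \<in> D" "Y n \<in> D" for n using Z[of n] by (auto simp: X_def Y_def mem_Times_iff)
  have tT: "t n \<in> {0..T}" "s n \<in> {0..T}" for n using XD[of n] by (auto simp: D_def XY)
  define P where "P n = pen n (Z n)" for n
  have P: "P n = (N n * (t n - s n)\<^sup>2 + m n * (norm (x n - y n))\<^sup>2) / 2" for n
    by (simp add: P_def pen_def t_def s_def x_def y_def X_def Y_def)
  have P0: "0 \<le> P n" for n by (simp add: P_def pen0)
  have PUV: "P n \<le> U (X n) + V (Y n)" for n
    using Zmax[of "(z, z)" n] zD UVz by (simp add: P_def X_def Y_def pen_def)
  have PB: "P n \<le> B" for n using PUV[of n] XU(2)[OF XD(1)[of n]] XV(2)[OF XD(2)[of n]] by (simp add: B_def)
  have mxy: "m n * (norm (x n - y n))\<^sup>2 \<le> 2 * P n" "N n * (t n - s n)\<^sup>2 \<le> 2 * P n" for n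
    using N0[of n] m(2)[of n] unfolding P by auto
  have tsd: "\<bar>t n - s n\<bar> < d n" for n
  proof (rule ccontr)
    assume "\<not> \<bar>t n - s n\<bar> < d n"
    then have "(d n)\<^sup>2 \<le> (t n - s n)\<^sup>2" using d[of n] by (metis abs_le_square_iff abs_of_pos not_less)
    then have "N n * (d n)\<^sup>2 \<le> N n * (t n - s n)\<^sup>2" using N0 by (rule mult_left_mono)
    also have "\<dots> \<le> 2 * B" using mxy(2)[of n] PB[of n] by linarith
    finally have "m n * (d n)\<^sup>2 + 2 * B \<le> 2 * B" using d[of n] by (simp add: N_def distrib_right)
    moreover have "0 < m n * (d n)\<^sup>2" using m(2)[of n] d[of n] by simp
    ultimately show False by linarith
  qed
  have minv: "(\<lambda>n. 1 / m n) \<longlonglongrightarrow> 0" unfolding m_def using LIMSEQ_inverse_real_of_nat by (simp add: inverse_eq_divide)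
  have XY0: "(\<lambda>n. X n - Y n) \<longlonglongrightarrow> 0"
  proof -
    have le: "(norm (X n - Y n))\<^sup>2 \<le> 2 * B * (1 / m n)" for n
    proof -
      have "m n * (norm (X n - Y n))\<^sup>2 = m n * (t n - s n)\<^sup>2 + m n * (norm (x n - y n))\<^sup>2"
        by (simp add: XY norm_Pair distrib_left)
      also have "\<dots> \<le> N n * (t n - s n)\<^sup>2 + m n * (norm (x n - y n))\<^sup>2" using N by (intro add_mono mult_right_mono) auto
      also have "\<dots> = 2 * P n" by (simp add: P)
      also have "\<dots> \<le> 2 * B" using PB[of n] by simp
      finally show ?thesis using m(2)[of n] by (simp add: field_simps)
    qed
    have "(\<lambda>n. (norm (X n - Y n))\<^sup>2) \<longlonglongrightarrow> 0"
    proof (rule tendsto_sandwich[OF _ _ tendsto_const])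
      show "(\<lambda>n. 2 * B * (1 / m n)) \<longlonglongrightarrow> 0" using tendsto_mult[OF tendsto_const[of "2 * B"] minv] by simp
    qed (use le in auto)
    then have "(\<lambda>n. sqrt ((norm (X n - Y n))\<^sup>2)) \<longlonglongrightarrow> sqrt 0" by (rule tendsto_real_sqrt)
    then show ?thesis by (simp add: tendsto_norm_zero_iff)
  qed
  have UV0: "0 \<le> U (X n) + V (Y n)" for n using P0[of n] PUV[of n] by linarith
  note conv = penalized_maxima_converge[OF Dc uscU uscV zD UVz UVneg XD UV0 XY0]
  have "(\<lambda>n. U (X n) + V (Y n)) \<longlonglongrightarrow> U z + V z" by (intro tendsto_add conv)
  then have "(\<lambda>n. U (X n) + V (Y n)) \<longlonglongrightarrow> 0" using UVz by simp
  then have Plim: "P \<longlonglongrightarrow> 0"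
    by (rule tendsto_sandwich[OF always_eventually always_eventually tendsto_const, rotated 2]) (simp_all add: P0 PUV)
  have Xdom: "X n \<in> dom_T T" "Y n \<in> dom_T T" for n using XD Ddom by auto
  have contlim: "(\<lambda>n. F (X n)) \<longlonglongrightarrow> F z" if "continuous_on (dom_T T) F" for F :: "real \<times> (real ^ 'k) \<Rightarrow> real"
    by (rule continuous_on_tendsto_compose[OF that conv(1) zdom always_eventually[OF allI[OF Xdom(1)]]])
  define \<delta> where "\<delta> n = norm (\<sigma> (t n) (x n) - \<sigma> (s n) (y n)) + norm (b (t n) (x n) - b (s n) (y n))" for n
  define q where "q n = m n *\<^sub>R (x n - y n)" for n
  have ycb: "y n \<in> cball xs 1" for n
    using XD(2)[of n] dist_snd_le[of z "Y n"] by (auto simp: D_def z_def XY)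
  have \<delta>: "\<delta> n \<le> 1 / (m n)\<^sup>2 + C * norm (x n - y n)" for n
  proof -
    have "norm (\<sigma> (t n) (x n) - \<sigma> (s n) (y n)) \<le> norm (\<sigma> (t n) (x n) - \<sigma> (t n) (y n)) + norm (\<sigma> (t n) (y n) - \<sigma> (s n) (y n))"
      "norm (b (t n) (x n) - b (s n) (y n)) \<le> norm (b (t n) (x n) - b (t n) (y n)) + norm (b (t n) (y n) - b (s n) (y n))"
      using dist_triangle[of "\<sigma> (t n) (x n)" "\<sigma> (s n) (y n)" "\<sigma> (t n) (y n)"] dist_triangle[of "b (t n) (x n)" "b (s n) (y n)" "b (t n) (y n)"]
      by (simp_all add: dist_norm)
    then show ?thesis using C(2)[OF tT(1), of n "x n" "y n"] modulus[OF tT(1)[of n] tT(2)[of n] ycb[of n] tsd[of n]] unfolding \<delta>_def by linarith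
  qed
  have \<delta>0: "0 \<le> \<delta> n" for n by (simp add: \<delta>_def)
  \<comment> \<open>Bounds for the two products in which the difference \<open>\<delta> n\<close> of the coefficients meets the penalty.\<close>
  define r1 where "r1 n = norm (x n - y n) + 2 * C * P n" for n
  define r2 where "r2 n = 2 * (1 / m n) + 4 * C\<^sup>2 * P n" for n
  have r1: "\<delta> n * norm (q n) \<le> r1 n" for n
  proof -
    have "\<delta> n * norm (q n) \<le> (1 / (m n)\<^sup>2 + C * norm (x n - y n)) * (m n * norm (x n - y n))"
      using \<delta>[of n] m(2)[of n] by (auto simp: q_def intro!: mult_right_mono)
    also have "\<dots> = (1 / m n) * norm (x n - y n) + C * (m n * (norm (x n - y n))\<^sup>2)"
      using m(2)[of n] by (simp add: field_simps power2_eq_square)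
    also have "\<dots> \<le> 1 * norm (x n - y n) + C * (2 * P n)"
      using m(1)[of n] mxy(1)[of n] C by (intro add_mono mult_right_mono mult_left_mono) auto
    finally show ?thesis by (simp add: r1_def)
  qed
  have r2: "m n * (\<delta> n)\<^sup>2 \<le> r2 n" for n
  proof -
    have "(\<delta> n)\<^sup>2 \<le> (1 / (m n)\<^sup>2 + C * norm (x n - y n))\<^sup>2" using \<delta> \<delta>0 by (intro power_mono) auto
    also have "\<dots> \<le> 2 * (1 / (m n)\<^sup>2)\<^sup>2 + 2 * (C * norm (x n - y n))\<^sup>2"
      using norm_sq_add_le[of "1 / (m n)\<^sup>2" "C * norm (x n - y n)"] by (simp only: real_norm_def power2_abs)
    finally have "m n * (\<delta> n)\<^sup>2 \<le> m n * (2 * (1 / (m n)\<^sup>2)\<^sup>2 + 2 * (C * norm (x n - y n))\<^sup>2)" using m(2)[of n] by (intro mult_left_mono) auto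
    also have "\<dots> = 2 * (1 / m n) ^ 3 + 2 * C\<^sup>2 * (m n * (norm (x n - y n))\<^sup>2)"
      using m(2)[of n] by (simp add: field_simps power2_eq_square power3_eq_cube)
    also have "\<dots> \<le> 2 * (1 / m n) ^ 1 + 2 * C\<^sup>2 * (2 * P n)"
      using m(1)[of n] mxy(1)[of n] by (intro add_mono mult_left_mono power_decreasing) auto
    finally show ?thesis by (simp add: r2_def)
  qed
  have xy0: "(\<lambda>n. norm (x n - y n)) \<longlonglongrightarrow> 0"
    using tendsto_norm_zero[OF tendsto_snd[OF XY0, unfolded snd_zero]] by (simp add: x_def y_def)
  have r1lim: "r1 \<longlonglongrightarrow> 0" unfolding r1_def
    using tendsto_add[OF xy0 tendsto_mult[OF tendsto_const[of "2 * C"] Plim]] by simp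
  have r2lim: "r2 \<longlonglongrightarrow> 0" unfolding r2_def
    using tendsto_add[OF tendsto_mult[OF tendsto_const[of 2] minv] tendsto_mult[OF tendsto_const[of "4 * C\<^sup>2"] Plim]] by simp
  define H where "H = (\<lambda>(t, x). - \<psi>t t x - b t x \<bullet> \<psi>x t x - L * norm (transpose (\<sigma> t x) *v \<psi>x t x)
    - trace (\<sigma> t x ** transpose (\<sigma> t x) ** \<psi>xx t x) / 2)"
  have Hcont: "continuous_on (dom_T T) H"
  proof -
    have c: "continuous_on (dom_T T) (\<lambda>p. b (fst p) (snd p))" "continuous_on (dom_T T) (\<lambda>p. \<sigma> (fst p) (snd p))"
      "continuous_on (dom_T T) (\<lambda>p. \<psi>t (fst p) (snd p))" "continuous_on (dom_T T) (\<lambda>p. \<psi>x (fst p) (snd p))" "continuous_on (dom_T T) (\<lambda>p. \<psi>xx (fst p) (snd p))"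
      using b_cont \<sigma>_cont continuous_on_subset[OF \<psi>(2) subset_UNIV] continuous_on_subset[OF \<psi>(3) subset_UNIV] continuous_on_subset[OF \<psi>(4) subset_UNIV]
      by (simp_all add: case_prod_unfold)
    show ?thesis
      unfolding H_def trace_def matrix_matrix_mult_def matrix_vector_mult_def transpose_def case_prod_unfold vec_lambda_beta
      by (intro continuous_intros c) simp_all
  qed
  have HX: "(\<lambda>n. H (X n)) \<longlonglongrightarrow> H z" by (rule contlim[OF Hcont])
  define \<Lambda> where "\<Lambda> = real CARD('i \<times> 'j)"
  have key: "H z \<le> L * (\<Lambda> * (\<psi> ts xs + 2 * \<epsilon>)) + 2 * \<epsilon>" if \<epsilon>: "0 < \<epsilon>" for \<epsilon>
  proof -
    have uscX: "\<forall>\<^sub>F n in sequentially. F (X n) < c" if "usc_on (dom_T T) F" "F z < c" for F c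
      by (rule usc_on_eventually_less[OF that(1) Xdom(1) conv(1) zdom that(2)])
    have uscY: "\<forall>\<^sub>F n in sequentially. F (Y n) < c" if "usc_on (dom_T T) F" "F z < c" for F c
      by (rule usc_on_eventually_less[OF that(1) Xdom(2) conv(2) zdom that(2)])
    have psiX: "(\<lambda>n. \<psi> (t n) (x n)) \<longlonglongrightarrow> \<psi> ts xs"
      using contlim[OF continuous_on_subset[OF \<psi>(1) subset_UNIV]] by (simp add: XY z_def)
    have uX: "(\<lambda>n. u i j (t n) (x n)) \<longlonglongrightarrow> u i j ts xs"
      using tendsto_add[OF conv(3) psiX] by (simp add: U_def XY z_def)
    have wY: "(\<lambda>n. w i j (s n) (y n)) \<longlonglongrightarrow> w i j ts xs"
      using tendsto_minus[OF conv(4)] by (simp add: V_def XY z_def)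
    have e1: "\<forall>\<^sub>F n in sequentially. t n < T" "\<forall>\<^sub>F n in sequentially. s n < T"
      using order_tendstoD(2)[OF tendsto_fst[OF conv(1)], of T] order_tendstoD(2)[OF tendsto_fst[OF conv(2)], of T] ts by (simp_all add: z_def t_def s_def)
    have e2: "\<forall>\<^sub>F n in sequentially. dist z (X n) < 1" "\<forall>\<^sub>F n in sequentially. dist z (Y n) < 1"
      using order_tendstoD(2)[OF tendsto_dist[OF tendsto_const[of z] conv(1)], of 1] order_tendstoD(2)[OF tendsto_dist[OF tendsto_const[of z] conv(2)], of 1] by simp_all
    have below: "\<forall>\<^sub>F n in sequentially. F (Xs n) < G n" if F: "\<And>c. F z < c \<Longrightarrow> \<forall>\<^sub>F n in sequentially. F (Xs n) < c" and G: "G \<longlonglongrightarrow> g" "F z < g"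
      for F :: "real \<times> (real ^ 'k) \<Rightarrow> real" and Xs :: "nat \<Rightarrow> real \<times> (real ^ 'k)" and G :: "nat \<Rightarrow> real" and g
    proof -
      obtain c where c: "F z < c" "c < g" using dense[OF G(2)] by blast
      show ?thesis using F[OF c(1)] order_tendstoD(1)[OF G(1) c(2)] by eventually_elim simp
    qed
    have all_ev: "\<forall>\<^sub>F n in sequentially. \<forall>k. k \<noteq> k0 \<longrightarrow> Q k n" if "\<And>k. k \<noteq> k0 \<Longrightarrow> \<forall>\<^sub>F n in sequentially. Q k n" for k0 :: 'i and Q
    proof (intro eventually_all_finite)
      fix k show "\<forall>\<^sub>F n in sequentially. k \<noteq> k0 \<longrightarrow> Q k n"
        by (cases "k = k0") (auto intro: eventually_mono[OF that])
    qed
    have all_ev': "\<forall>\<^sub>F n in sequentially. \<forall>k. k \<noteq> k0 \<longrightarrow> Q k n" if "\<And>k. k \<noteq> k0 \<Longrightarrow> \<forall>\<^sub>F n in sequentially. Q k n" for k0 :: 'j and Q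
    proof (intro eventually_all_finite)
      fix k show "\<forall>\<^sub>F n in sequentially. k \<noteq> k0 \<longrightarrow> Q k n"
        by (cases "k = k0") (auto intro: eventually_mono[OF that])
    qed
    have e3: "\<forall>\<^sub>F n in sequentially. \<forall>k. k \<noteq> i \<longrightarrow> u k j (t n) (x n) - gl i k (t n) (x n) < u i j (t n) (x n)"
    proof (rule all_ev)
      fix k assume "k \<noteq> i"
      with strict(1)[of k] below[OF uscX[OF usc_on_diff_continuous[OF usc_u[of k j] gl[of i k]]] uX]
      show "\<forall>\<^sub>F n in sequentially. u k j (t n) (x n) - gl i k (t n) (x n) < u i j (t n) (x n)" by (simp add: XY z_def)
    qed
    have e4: "\<forall>\<^sub>F n in sequentially. \<forall>l. l \<noteq> j \<longrightarrow> - w i l (s n) (y n) - gu j l (s n) (y n) < - w i j (s n) (y n)"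
    proof (rule all_ev')
      fix l assume "l \<noteq> j"
      with strict(2)[of l] below[OF uscY[OF usc_on_diff_continuous[OF usc_w[of i l] gu[of j l]]] tendsto_minus[OF wY]]
      show "\<forall>\<^sub>F n in sequentially. - w i l (s n) (y n) - gu j l (s n) (y n) < - w i j (s n) (y n)" by (simp add: XY z_def)
    qed
    have e5: "\<forall>\<^sub>F n in sequentially. \<forall>k l. u k l (t n) (x n) < u k l ts xs + \<epsilon>"
      using uscX[OF usc_u] \<epsilon> by (intro eventually_all_finite) (simp add: XY z_def)
    have e6: "\<forall>\<^sub>F n in sequentially. \<forall>k l. - w k l (s n) (y n) < - w k l ts xs + \<epsilon>"
      using uscY[OF usc_w] \<epsilon> by (intro eventually_all_finite) (simp add: XY z_def)
    have e7: "\<forall>\<^sub>F n in sequentially. u i j ts xs - \<epsilon> < u i j (t n) (x n)" using order_tendstoD(1)[OF uX] \<epsilon> by simp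
    have e8: "\<forall>\<^sub>F n in sequentially. w i j (s n) (y n) < w i j ts xs + \<epsilon>" using order_tendstoD(2)[OF wY] \<epsilon> by simp
    obtain \<eta> where \<eta>: "0 < \<eta>" and fc: "\<And>t' x' y z. t' \<in> {0..T} \<Longrightarrow> dist (t', x') (ts, xs) < \<eta> \<Longrightarrow> \<bar>f i j t' x' y z - f i j ts xs y z\<bar> < \<epsilon>"
      using f_cont ts' \<epsilon> unfolding continuous_tx_uniformly_yz_def by meson
    have e9: "\<forall>\<^sub>F n in sequentially. dist (X n) z < \<eta>" "\<forall>\<^sub>F n in sequentially. dist (Y n) z < \<eta>"
      using tendstoD[OF conv(1) \<eta>] tendstoD[OF conv(2) \<eta>] by simp_all
    have "\<forall>\<^sub>F n in sequentially. H (X n) - (L * (\<Lambda> * (\<psi> ts xs + 2 * \<epsilon>)) + 2 * \<epsilon>) \<le> (1 + L) * r1 n + r2 n / 2"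
      using e1 e2 e3 e4 e5 e6 e7 e8 e9
    proof eventually_elim
      case (elim n)
      define u1 where "u1 = (\<chi> m. u (fst m) (snd m) (t n) (x n))"
      define w1 where "w1 = (\<chi> m. w (fst m) (snd m) (s n) (y n))"
      define \<zeta>1 where "\<zeta>1 = transpose (\<sigma> (t n) (x n)) *v (q n + \<psi>x (t n) (x n))"
      define \<zeta>2 where "\<zeta>2 = transpose (\<sigma> (s n) (y n)) *v q n"
      have ineq: "- \<psi>t (t n) (x n) - b (t n) (x n) \<bullet> \<psi>x (t n) (x n) + (b (s n) (y n) - b (t n) (x n)) \<bullet> q n
        - f i j (t n) (x n) u1 \<zeta>1 + f i j (s n) (y n) w1 \<zeta>2
        - trace (\<sigma> (t n) (x n) ** transpose (\<sigma> (t n) (x n)) ** \<psi>xx (t n) (x n)) / 2 \<le> m n * (norm (\<sigma> (t n) (x n) - \<sigma> (s n) (y n)))\<^sup>2 / 2"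
        unfolding u1_def w1_def \<zeta>1_def \<zeta>2_def q_def
      proof (rule doubled_maximum_inequality[OF sub super \<psi> D_def, of "t n" "x n" "s n" "y n" "N n" "m n" i j])
        show "t n \<in> {0..<T}" "s n \<in> {0..<T}" using elim(1,2) tT[of n] by auto
        show "dist z (t n, x n) < 1" "dist z (s n, y n) < 1" using elim(3,4) by (simp_all add: XY)
        show "0 \<le> N n" "0 \<le> m n" using N0 m(2)[of n] by auto
        show "u i j t' x' - \<psi> t' x' - w i j s' y' - (N n * (t' - s')\<^sup>2 + m n * (norm (x' - y'))\<^sup>2) / 2
          \<le> u i j (t n) (x n) - \<psi> (t n) (x n) - w i j (s n) (y n) - (N n * (t n - s n)\<^sup>2 + m n * (norm (x n - y n))\<^sup>2) / 2"
          if "(t', x') \<in> D" "(s', y') \<in> D" for t' x' s' y'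
          using Zmax[of "((t', x'), (s', y'))" n] that unfolding P_def[symmetric] P X_def[symmetric] Y_def[symmetric]
          by (simp add: pen_def U_def V_def XY)
        show "\<And>k. k \<noteq> i \<Longrightarrow> u k j (t n) (x n) - gl i k (t n) (x n) < u i j (t n) (x n)" using elim(5) by blast
        show "w i j (s n) (y n) < w i l (s n) (y n) + gu j l (s n) (y n)" if "l \<noteq> j" for l
          using elim(6)[rule_format, OF that] by linarith
      qed
      have f1: "f i j (t n) (x n) u1 \<zeta>1 \<le> f i j ts xs u1 \<zeta>1 + \<epsilon>" using fc[OF tT(1), of n "x n" u1 \<zeta>1] elim(11) by (simp add: XY z_def abs_less_iff)
      have f2: "f i j ts xs w1 \<zeta>2 \<le> f i j (s n) (y n) w1 \<zeta>2 + \<epsilon>" using fc[OF tT(2), of n "y n" w1 \<zeta>2] elim(12) by (simp add: XY z_def abs_less_iff)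
      have f3: "f i j ts xs u1 \<zeta>1 \<le> f i j ts xs u1 \<zeta>2 + L * norm (\<zeta>1 - \<zeta>2)" using L(2)[OF ts', of xs u1 \<zeta>1 u1 \<zeta>2] by simp
      have f4: "f i j ts xs u1 \<zeta>2 \<le> f i j ts xs w1 \<zeta>2 + L * (\<Lambda> * (\<psi> ts xs + 2 * \<epsilon>))"
        unfolding \<Lambda>_def
      proof (rule quasi_monotone_bound[where ?m0.0="(i, j)"])
        show "f i j ts xs a \<zeta>2 \<le> f i j ts xs a' \<zeta>2" if "m \<noteq> (i, j)" "a $ m \<le> a' $ m" "\<And>n. n \<noteq> m \<Longrightarrow> a $ n = a' $ n" for m a a'
          by (rule mono[OF that(1) ts' that(2,3)])
        show "\<bar>f i j ts xs a \<zeta>2 - f i j ts xs a' \<zeta>2\<bar> \<le> L * norm (a - a')" for a a' using L(2)[OF ts', of xs a \<zeta>2 a' \<zeta>2] by simp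
        show "0 \<le> L" by (rule L)
        show "u1 $ m \<le> w1 $ m + (\<psi> ts xs + 2 * \<epsilon>)" for m
          using elim(7)[rule_format, of "fst m" "snd m"] elim(8)[rule_format, of "fst m" "snd m"] all[of "fst m" "snd m"] by (simp add: u1_def w1_def)
        have "u1 $ (i, j) - w1 $ (i, j) = u i j (t n) (x n) - w i j (s n) (y n)" by (simp add: u1_def w1_def)
        then show "\<bar>u1 $ (i, j) - w1 $ (i, j)\<bar> \<le> \<psi> ts xs + 2 * \<epsilon>"
          using elim(7)[rule_format, of i j] elim(8)[rule_format, of i j] elim(9,10) touch(2) \<psi>0 by linarith
      qed
      have "\<zeta>1 - \<zeta>2 = transpose (\<sigma> (t n) (x n) - \<sigma> (s n) (y n)) *v q n + transpose (\<sigma> (t n) (x n)) *v \<psi>x (t n) (x n)"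
        by (simp add: \<zeta>1_def \<zeta>2_def matrix_vector_mult_def transpose_def vec_eq_iff sum_subtractf sum.distrib algebra_simps)
      then have "norm (\<zeta>1 - \<zeta>2) \<le> norm (\<sigma> (t n) (x n) - \<sigma> (s n) (y n)) * norm (q n) + norm (transpose (\<sigma> (t n) (x n)) *v \<psi>x (t n) (x n))"
        using norm_triangle_le[OF add_right_mono[OF norm_transpose_matrix_vector_le]] by metis
      also have "norm (\<sigma> (t n) (x n) - \<sigma> (s n) (y n)) * norm (q n) \<le> \<delta> n * norm (q n)" by (intro mult_right_mono) (auto simp: \<delta>_def)
      finally have "norm (\<zeta>1 - \<zeta>2) \<le> r1 n + norm (transpose (\<sigma> (t n) (x n)) *v \<psi>x (t n) (x n))" using r1[of n] by linarith
      from mult_left_mono[OF this L(1)] have f5: "L * norm (\<zeta>1 - \<zeta>2) \<le> L * r1 n + L * norm (transpose (\<sigma> (t n) (x n)) *v \<psi>x (t n) (x n))"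
        by (simp add: distrib_left)
      have "- ((b (s n) (y n) - b (t n) (x n)) \<bullet> q n) \<le> norm (b (s n) (y n) - b (t n) (x n)) * norm (q n)"
        using Cauchy_Schwarz_ineq2[of "b (s n) (y n) - b (t n) (x n)" "q n"] by linarith
      also have "\<dots> \<le> \<delta> n * norm (q n)" by (intro mult_right_mono) (auto simp: \<delta>_def norm_minus_commute)
      finally have b1: "- ((b (s n) (y n) - b (t n) (x n)) \<bullet> q n) \<le> r1 n" using r1[of n] by linarith
      have "m n * (norm (\<sigma> (t n) (x n) - \<sigma> (s n) (y n)))\<^sup>2 \<le> m n * (\<delta> n)\<^sup>2"
        using m(2)[of n] by (intro mult_left_mono power_mono) (auto simp: \<delta>_def)
      then have s1: "m n * (norm (\<sigma> (t n) (x n) - \<sigma> (s n) (y n)))\<^sup>2 / 2 \<le> r2 n / 2" using r2[of n] by simp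
      have Hn: "H (X n) = - \<psi>t (t n) (x n) - b (t n) (x n) \<bullet> \<psi>x (t n) (x n) - L * norm (transpose (\<sigma> (t n) (x n)) *v \<psi>x (t n) (x n))
        - trace (\<sigma> (t n) (x n) ** transpose (\<sigma> (t n) (x n)) ** \<psi>xx (t n) (x n)) / 2" by (simp add: H_def XY)
      have "(1 + L) * r1 n = r1 n + L * r1 n" by (simp add: distrib_right)
      then show ?case using ineq f1 f2 f3 f4 f5 b1 s1 unfolding Hn by linarith
    qed
    moreover have "(\<lambda>n. (1 + L) * r1 n + r2 n / 2) \<longlonglongrightarrow> 0"
      using tendsto_add[OF tendsto_mult[OF tendsto_const[of "1 + L"] r1lim] tendsto_divide[OF r2lim tendsto_const[of 2]]] by simp
    ultimately have "H z - (L * (\<Lambda> * (\<psi> ts xs + 2 * \<epsilon>)) + 2 * \<epsilon>) \<le> 0"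
      using tendsto_le[OF sequentially_bot _ tendsto_diff[OF HX tendsto_const]] by blast
    then show ?thesis by simp
  qed
  have "H z \<le> L * (\<Lambda> * \<psi> ts xs)"
  proof (rule field_le_epsilon)
    fix e :: real assume e: "0 < e"
    define c where "c = 2 * (L * \<Lambda>) + 2"
    have c: "0 < c" unfolding c_def using L(1) by (simp add: \<Lambda>_def add_nonneg_pos)
    have "L * (\<Lambda> * (\<psi> ts xs + 2 * g)) + 2 * g = L * (\<Lambda> * \<psi> ts xs) + c * g" for g
      by (simp add: c_def algebra_simps)
    from this[of "e / c"]
    have "L * (\<Lambda> * (\<psi> ts xs + 2 * (e / c))) + 2 * (e / c) = L * (\<Lambda> * \<psi> ts xs) + c * (e / c)" .
    then show "H z \<le> L * (\<Lambda> * \<psi> ts xs) + e" using key[of "e / c"] e c by simp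
  qed
  then show ?thesis by (simp add: H_def z_def \<Lambda>_def)
qed

text \<open>
  Each spatial derivative of \<open>(1 + x \<bullet> x) ^ (n + 2)\<close> gains a factor that compensates the linear growth of one
  coefficient, so every term but the time derivative is bounded by a multiple of the barrier. The rate
  \<open>\<mu>\<close> exceeds the sum of these multiples by one, and \<open>\<kappa>\<close> is so small that it uses up only half of this.
\<close>

lemma barrier_strict_supersolution:
  fixes bv :: "real ^ 'k" and \<sigma>v :: "real ^ 'd ^ 'k"
  assumes C: "0 \<le> C" "norm bv \<le> C * (1 + norm x)" "norm \<sigma>v \<le> C * (1 + norm x)"
    and pos: "0 \<le> \<theta>" "0 < \<Phi>" "0 \<le> L" "0 \<le> \<Lambda>"
    and \<chi>_def: "c = exp (- \<mu> * t) * (\<theta> * (1 + x \<bullet> x) ^ (n + 2) + \<Phi>)"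
    and \<mu>: "\<mu> = 1 + 4 * real (n + 2) * C * (1 + L) + (2 * real (n + 2) + 4 * real (n + 2) * real (n + 1)) * C\<^sup>2 + L * \<Lambda>"
    and \<kappa>: "\<kappa> = c / (2 * (1 + (norm \<sigma>v)\<^sup>2))"
  shows "L * (\<Lambda> * c) < - barrier_t \<mu> \<theta> n \<Phi> \<kappa> t x t x - bv \<bullet> barrier_x \<mu> \<theta> n \<Phi> \<kappa> t x t x
      - L * norm (transpose \<sigma>v *v barrier_x \<mu> \<theta> n \<Phi> \<kappa> t x t x)
      - trace (\<sigma>v ** transpose \<sigma>v ** barrier_xx \<mu> \<theta> n \<Phi> \<kappa> t x t x) / 2"
proof -
  define E where "E = exp (- \<mu> * t)"
  define s where "s = 1 + x \<bullet> x"
  define r where "r = norm x"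
  define g where "g = E * \<theta> * s ^ (n + 2)"
  have E: "0 < E" by (simp add: E_def)
  have s: "s = 1 + r\<^sup>2" "1 \<le> s" by (simp_all add: s_def r_def power2_norm_eq_inner)
  have r0: "0 \<le> r" by (simp add: r_def)
  have rs: "(1 + r) * r \<le> 2 * s" "(1 + r)\<^sup>2 \<le> 2 * s" "r\<^sup>2 \<le> s"
  proof -
    have "0 \<le> (r - 1)\<^sup>2" by simp
    then have "2 * r \<le> 1 + r\<^sup>2" by (simp add: power2_diff)
    then show "(1 + r) * r \<le> 2 * s" "(1 + r)\<^sup>2 \<le> 2 * s" "r\<^sup>2 \<le> s"
      using r0 unfolding s(1) by (simp_all add: power2_eq_square algebra_simps)
  qed
  have g0: "0 \<le> g" using E pos s by (simp add: g_def)
  have c: "c = g + E * \<Phi>" by (simp add: \<chi>_def g_def E_def s_def algebra_simps)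
  have gc: "g \<le> c" "0 < c" using E pos g0 by (auto simp: c add_nonneg_pos)
  define k1 where "k1 = E * \<theta> * (2 * real (n + 2) * s ^ (n + 1))"
  define k2 where "k2 = E * \<theta> * (4 * real (n + 2) * real (n + 1) * s ^ n)"
  have k1: "0 \<le> k1" "k1 * s = 2 * real (n + 2) * g" using E pos s by (simp_all add: k1_def g_def)
  have k2: "0 \<le> k2" "k2 * s * s = 4 * real (n + 2) * real (n + 1) * g" using E pos s by (simp_all add: k2_def g_def)
  have bt: "barrier_t \<mu> \<theta> n \<Phi> \<kappa> t x t x = - \<mu> * c" by (simp add: barrier_t_def \<chi>_def)
  have bx: "barrier_x \<mu> \<theta> n \<Phi> \<kappa> t x t x = k1 *\<^sub>R x" by (simp add: barrier_x_def k1_def E_def s_def)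
  have nbx: "C * (1 + r) * norm (k1 *\<^sub>R x) \<le> 4 * real (n + 2) * C * g"
  proof -
    have "C * (1 + r) * norm (k1 *\<^sub>R x) = C * k1 * ((1 + r) * r)" using k1 by (simp add: r_def)
    also have "\<dots> \<le> C * k1 * (2 * s)" using C k1 rs by (intro mult_left_mono) auto
    also have "\<dots> = 2 * C * (k1 * s)" by simp
    also have "\<dots> = 4 * real (n + 2) * C * g" unfolding k1(2) by simp
    finally show ?thesis .
  qed
  have "bv \<bullet> (k1 *\<^sub>R x) \<le> norm bv * norm (k1 *\<^sub>R x)" by (rule norm_cauchy_schwarz)
  also have "\<dots> \<le> C * (1 + r) * norm (k1 *\<^sub>R x)" using C by (intro mult_right_mono) (auto simp: r_def)
  finally have e1: "bv \<bullet> (k1 *\<^sub>R x) \<le> 4 * real (n + 2) * C * g" using nbx by linarith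
  have "norm (transpose \<sigma>v *v (k1 *\<^sub>R x)) \<le> norm \<sigma>v * norm (k1 *\<^sub>R x)" by (rule norm_transpose_matrix_vector_le)
  also have "\<dots> \<le> C * (1 + r) * norm (k1 *\<^sub>R x)" using C by (intro mult_right_mono) (auto simp: r_def)
  finally have "norm (transpose \<sigma>v *v (k1 *\<^sub>R x)) \<le> 4 * real (n + 2) * C * g" using nbx by linarith
  then have e2: "L * norm (transpose \<sigma>v *v (k1 *\<^sub>R x)) \<le> L * (4 * real (n + 2) * C * g)" using pos by (intro mult_left_mono)
  define S where "S = (norm \<sigma>v)\<^sup>2"
  have S0: "0 \<le> S" by (simp add: S_def)
  have S: "S \<le> C\<^sup>2 * (2 * s)"
  proof -
    have "S \<le> (C * (1 + r))\<^sup>2" unfolding S_def using C by (intro power_mono) (auto simp: r_def)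
    also have "\<dots> \<le> C\<^sup>2 * (2 * s)" unfolding power_mult_distrib using rs by (intro mult_left_mono) auto
    finally show ?thesis .
  qed
  have "trace (\<sigma>v ** transpose \<sigma>v ** barrier_xx \<mu> \<theta> n \<Phi> \<kappa> t x t x)
      = (\<Sum>l\<in>UNIV. (k1 + 2 * \<kappa>) * (norm (column l \<sigma>v))\<^sup>2 + k2 * (x \<bullet> column l \<sigma>v)\<^sup>2)"
    unfolding trace_sigma barrier_xx_works by (simp add: k1_def k2_def E_def s_def power2_norm_eq_inner)
  also have "\<dots> \<le> (\<Sum>l\<in>UNIV. (k1 + 2 * \<kappa>) * (norm (column l \<sigma>v))\<^sup>2 + k2 * (r\<^sup>2 * (norm (column l \<sigma>v))\<^sup>2))"
  proof (intro sum_mono add_left_mono mult_left_mono k2)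
    fix l
    have "\<bar>x \<bullet> column l \<sigma>v\<bar>\<^sup>2 \<le> (norm x * norm (column l \<sigma>v))\<^sup>2" by (intro power_mono Cauchy_Schwarz_ineq2) simp
    then show "(x \<bullet> column l \<sigma>v)\<^sup>2 \<le> r\<^sup>2 * (norm (column l \<sigma>v))\<^sup>2" by (simp add: r_def power_mult_distrib)
  qed
  also have "\<dots> = (k1 + 2 * \<kappa>) * S + k2 * (r\<^sup>2 * S)"
    by (simp add: S_def norm_matrix_sq_columns sum.distrib sum_distrib_left)
  finally have tr: "trace (\<sigma>v ** transpose \<sigma>v ** barrier_xx \<mu> \<theta> n \<Phi> \<kappa> t x t x) \<le> (k1 + 2 * \<kappa>) * S + k2 * (r\<^sup>2 * S)" .
  have "k1 * S \<le> k1 * (C\<^sup>2 * (2 * s))" using S k1 by (intro mult_left_mono)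
  also have "\<dots> = 2 * C\<^sup>2 * (k1 * s)" by simp
  finally have t1: "k1 * S \<le> 4 * real (n + 2) * C\<^sup>2 * g" unfolding k1(2) by (simp add: algebra_simps)
  have "k2 * (r\<^sup>2 * S) \<le> k2 * (s * (C\<^sup>2 * (2 * s)))" using S S0 rs k2 s by (intro mult_left_mono mult_mono) auto
  also have "\<dots> = 2 * C\<^sup>2 * (k2 * s * s)" by simp
  finally have t2: "k2 * (r\<^sup>2 * S) \<le> 8 * real (n + 2) * real (n + 1) * C\<^sup>2 * g" unfolding k2(2) by (simp add: algebra_simps)
  have t3: "2 * \<kappa> * S \<le> c"
  proof -
    have "2 * (c / (2 * k)) * S = c * (S / k)" for k by simp
    then have "2 * \<kappa> * S = c * (S / (1 + S))" unfolding \<kappa> S_def[symmetric] .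
    also have "\<dots> \<le> c * 1" using gc S0 by (intro mult_left_mono) (auto simp: divide_le_eq)
    finally show ?thesis by simp
  qed
  define a where "a = 4 * real (n + 2) * C * (1 + L) + (2 * real (n + 2) + 4 * real (n + 2) * real (n + 1)) * C\<^sup>2"
  have a0: "0 \<le> a" using C pos by (simp add: a_def)
  note tr
  also have "(k1 + 2 * \<kappa>) * S + k2 * (r\<^sup>2 * S) = k1 * S + 2 * \<kappa> * S + k2 * (r\<^sup>2 * S)" by (simp add: distrib_right)
  also have "\<dots> \<le> 4 * real (n + 2) * C\<^sup>2 * g + c + 8 * real (n + 2) * real (n + 1) * C\<^sup>2 * g" by (intro add_mono t1 t2 t3)
  finally have tr2: "trace (\<sigma>v ** transpose \<sigma>v ** barrier_xx \<mu> \<theta> n \<Phi> \<kappa> t x t x) / 2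
     \<le> (4 * real (n + 2) * C\<^sup>2 * g + c + 8 * real (n + 2) * real (n + 1) * C\<^sup>2 * g) / 2" by (rule divide_right_mono) simp
  have "bv \<bullet> (k1 *\<^sub>R x) + L * norm (transpose \<sigma>v *v (k1 *\<^sub>R x)) + trace (\<sigma>v ** transpose \<sigma>v ** barrier_xx \<mu> \<theta> n \<Phi> \<kappa> t x t x) / 2
     \<le> 4 * real (n + 2) * C * g + L * (4 * real (n + 2) * C * g) + (4 * real (n + 2) * C\<^sup>2 * g + c + 8 * real (n + 2) * real (n + 1) * C\<^sup>2 * g) / 2"
    by (intro add_mono e1 e2 tr2)
  also have "\<dots> = a * g + c / 2" by (simp add: a_def algebra_simps)
  also have "\<dots> \<le> a * c + c / 2" using a0 gc by (intro add_right_mono mult_left_mono) auto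
  finally have "bv \<bullet> (k1 *\<^sub>R x) + L * norm (transpose \<sigma>v *v (k1 *\<^sub>R x)) + trace (\<sigma>v ** transpose \<sigma>v ** barrier_xx \<mu> \<theta> n \<Phi> \<kappa> t x t x) / 2
     \<le> a * c + c / 2" .
  moreover have "\<mu> * c = c + a * c + L * (\<Lambda> * c)" unfolding \<mu> a_def by (simp add: algebra_simps)
  ultimately show ?thesis using gc(2) unfolding bt bx by linarith
qed

section \<open>The comparison principle\<close>

text \<open>
  The weight \<open>(1 + x \<bullet> x) ^ (n + 2)\<close> outgrows the difference of \<open>u\<close> and \<open>w\<close>, so positive values occur
  only on a compact set.
\<close>

lemma weighted_difference_attains_max:
  fixes u w :: "'i::finite \<Rightarrow> 'j::finite \<Rightarrow> real \<Rightarrow> real ^ 'k \<Rightarrow> real"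
  assumes usc: "\<And>i j. usc_on (dom_T T) (\<lambda>(t, x). u i j t x)" and lsc: "\<And>i j. lsc_on (dom_T T) (\<lambda>(t, x). w i j t x)"
    and growth: "0 \<le> C" "0 \<le> \<gamma>" "\<gamma> \<le> real n" "\<And>i j t x. t \<in> {0..T} \<Longrightarrow> \<bar>u i j t x\<bar> + \<bar>w i j t x\<bar> \<le> C * (1 + norm x powr \<gamma>)"
    and \<theta>: "0 < \<theta>" and \<mu>: "0 \<le> \<mu>"
    and t1: "t1 \<in> {0..T}" and pos: "0 < exp (\<mu> * t1) * (u i1 j1 t1 x1 - w i1 j1 t1 x1) - \<theta> * (1 + x1 \<bullet> x1) ^ (n + 2)"
  shows "\<exists>i j ts xs. ts \<in> {0..T} \<and> (\<forall>k l. \<forall>t\<in>{0..T}. \<forall>x.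
    exp (\<mu> * t) * (u k l t x - w k l t x) - \<theta> * (1 + x \<bullet> x) ^ (n + 2)
    \<le> exp (\<mu> * ts) * (u i j ts xs - w i j ts xs) - \<theta> * (1 + xs \<bullet> xs) ^ (n + 2))"
proof -
  define F where "F i j X = exp (\<mu> * fst X) * (u i j (fst X) (snd X) - w i j (fst X) (snd X)) - \<theta> * (1 + snd X \<bullet> snd X) ^ (n + 2)" for i j and X :: "real \<times> (real ^ 'k)"
  define R where "R = 2 * C * exp (\<mu> * T) / \<theta>"
  have R0: "0 \<le> R" using growth \<theta> by (simp add: R_def)
  have loc: "(norm x)\<^sup>2 \<le> R" if "t \<in> {0..T}" "0 < F i j (t, x)" for i j t x
  proof -
    define s where "s = 1 + x \<bullet> x"
    have s: "1 \<le> s" "s = 1 + (norm x)\<^sup>2" by (simp_all add: s_def power2_norm_eq_inner)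
    have "norm x \<le> s"
    proof -
      have "0 \<le> (norm x - 1)\<^sup>2" by simp
      then have "2 * norm x \<le> 1 + (norm x)\<^sup>2" by (simp add: power2_diff)
      moreover have "0 \<le> norm x" by simp
      ultimately show ?thesis unfolding s(2) by linarith
    qed
    then have "norm x powr \<gamma> \<le> s powr \<gamma>" using growth by (intro powr_mono2) auto
    also have "\<dots> \<le> s powr real n" using growth s by (intro powr_mono) auto
    also have "\<dots> = s ^ n" using s(1) by (simp add: powr_realpow)
    finally have "norm x powr \<gamma> \<le> s ^ n" .
    moreover have "1 \<le> s ^ n" using s by simp
    ultimately have "C * (1 + norm x powr \<gamma>) \<le> C * (2 * s ^ n)" using growth by (intro mult_left_mono) auto
    then have "u i j t x - w i j t x \<le> 2 * C * s ^ n" using growth(4)[OF that(1), of i j x] by linarith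
    then have "exp (\<mu> * t) * (u i j t x - w i j t x) \<le> exp (\<mu> * t) * (2 * C * s ^ n)" by (intro mult_left_mono) auto
    also have "\<dots> \<le> exp (\<mu> * T) * (2 * C * s ^ n)"
      using that \<mu> growth s by (intro mult_right_mono) (auto intro!: mult_left_mono)
    finally have "\<theta> * s ^ (n + 2) < exp (\<mu> * T) * (2 * C * s ^ n)" using that(2) by (simp add: F_def s_def)
    then have "(\<theta> * s\<^sup>2) * s ^ n < (exp (\<mu> * T) * (2 * C)) * s ^ n" by (simp add: power_add power2_eq_square mult_ac)
    then have "\<theta> * s\<^sup>2 < exp (\<mu> * T) * (2 * C)" by (rule mult_right_less_imp_less) (use s in simp)
    moreover have "\<theta> * (norm x)\<^sup>2 \<le> \<theta> * s\<^sup>2"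
    proof (rule mult_left_mono)
      have "s * 1 \<le> s * s" using s by (intro mult_left_mono) auto
      then show "(norm x)\<^sup>2 \<le> s\<^sup>2" unfolding power2_eq_square[of s] using s(2) by linarith
    qed (use \<theta> in simp)
    ultimately have "\<theta> * (norm x)\<^sup>2 \<le> exp (\<mu> * T) * (2 * C)" by linarith
    then show ?thesis using \<theta> by (simp add: R_def field_simps)
  qed
  define K :: "(real \<times> (real ^ 'k)) set" where "K = dom_T T \<inter> (UNIV \<times> cball 0 (sqrt R + norm x1))"
  have Keq: "K = {0..T} \<times> cball 0 (sqrt R + norm x1)" by (auto simp: K_def)
  have K: "compact K" unfolding Keq by (intro compact_Times) auto
  have X1: "(t1, x1) \<in> K" using t1 R0 by (auto simp: Keq)
  have uscF: "usc_on K (F i j)" for i j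
  proof -
    have "usc_on (dom_T T) (\<lambda>z. (\<lambda>(t, x). u i j t x) z + - (\<lambda>(t, x). w i j t x) z)"
      by (intro usc_on_add usc usc_on_uminus_lsc lsc)
    then have "usc_on K (\<lambda>z. (\<lambda>(t, x). u i j t x) z + - (\<lambda>(t, x). w i j t x) z)" by (rule usc_on_subset) (simp add: K_def)
    then have "usc_on K (\<lambda>X. u i j (fst X) (snd X) - w i j (fst X) (snd X))" by (simp add: case_prod_unfold)
    then have "usc_on K (\<lambda>X. exp (\<mu> * fst X) * (u i j (fst X) (snd X) - w i j (fst X) (snd X)))"
      by (rule usc_on_mult_positive) (auto intro!: continuous_intros)
    then show ?thesis unfolding F_def[abs_def] by (rule usc_on_diff_continuous) (intro continuous_intros)
  qed
  have "\<exists>X\<in>K. \<forall>Y\<in>K. F i j Y \<le> F i j X" for i j using X1 by (intro usc_on_attains_max K uscF) auto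
  then obtain Xm where Xm: "\<And>i j. Xm i j \<in> K" "\<And>i j Y. Y \<in> K \<Longrightarrow> F i j Y \<le> F i j (Xm i j)" by metis
  define M where "M = Max ((\<lambda>(i, j). F i j (Xm i j)) ` UNIV)"
  have "M \<in> (\<lambda>(i, j). F i j (Xm i j)) ` UNIV" unfolding M_def by (intro Max_in) auto
  then obtain i j where ij: "F i j (Xm i j) = M" by auto
  have leM: "F k l (Xm k l) \<le> M" for k l unfolding M_def by (intro Max_ge) (auto intro!: image_eqI[of _ _ "(k, l)"])
  have M0: "0 < M" using pos Xm(2)[OF X1, of i1 j1] leM[of i1 j1] by (simp add: F_def)
  have all: "F k l (t, x) \<le> M" if "t \<in> {0..T}" for k l t x
  proof (cases "0 < F k l (t, x)")
    case True
    have "norm x \<le> sqrt R" using loc[OF that True] by (simp add: real_le_rsqrt)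
    then have "norm x \<le> sqrt R + norm x1" by (simp add: add_increasing2)
    then have "(t, x) \<in> K" using that by (auto simp: Keq)
    from Xm(2)[OF this, of k l] leM[of k l] show ?thesis by linarith
  qed (use M0 in simp)
  show ?thesis
  proof (intro exI conjI allI ballI)
    show "fst (Xm i j) \<in> {0..T}" using Xm(1)[of i j] by (auto simp: Keq mem_Times_iff)
    show "exp (\<mu> * t) * (u k l t x - w k l t x) - \<theta> * (1 + x \<bullet> x) ^ (n + 2)
      \<le> exp (\<mu> * fst (Xm i j)) * (u i j (fst (Xm i j)) (snd (Xm i j)) - w i j (fst (Xm i j)) (snd (Xm i j))) - \<theta> * (1 + snd (Xm i j) \<bullet> snd (Xm i j)) ^ (n + 2)"
      if "t \<in> {0..T}" for k l t x using all[OF that, of k l x] ij by (simp add: F_def)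
  qed
qed

theorem theorem4p2:
  fixes T :: real
    and b :: "real \<Rightarrow> real ^ 'k \<Rightarrow> real ^ 'k"
    and \<sigma> :: "real \<Rightarrow> real ^ 'k \<Rightarrow> real ^ 'd ^ 'k"
    and f :: "'i::finite \<Rightarrow> 'j::finite \<Rightarrow> real \<Rightarrow> real ^ 'k \<Rightarrow> real ^ ('i \<times> 'j) \<Rightarrow> real ^ 'd \<Rightarrow> real"
    and gl :: "'i \<Rightarrow> 'i \<Rightarrow> real \<Rightarrow> real ^ 'k \<Rightarrow> real"
    and gu :: "'j \<Rightarrow> 'j \<Rightarrow> real \<Rightarrow> real ^ 'k \<Rightarrow> real"
    and h :: "'i \<Rightarrow> 'j \<Rightarrow> real ^ 'k \<Rightarrow> real"
    and u w :: "'i \<Rightarrow> 'j \<Rightarrow> real \<Rightarrow> real ^ 'k \<Rightarrow> real"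
  assumes T_pos: "0 < T"
    and gl_diag: "\<forall>i. \<forall>t\<in>{0..T}. \<forall>x. gl i i t x = 0"
    and gu_diag: "\<forall>j. \<forall>t\<in>{0..T}. \<forall>x. gu j j t x = 0"
    and a_cont: "continuous_on (dom_T T) (\<lambda>(t, x). b t x)"
      "continuous_on (dom_T T) (\<lambda>(t, x). \<sigma> t x)"
    and a_growth_lipschitz: "\<exists>C\<ge>0. \<forall>t\<in>{0..T}.
        (\<forall>x. norm (b t x) + norm (\<sigma> t x) \<le> C * (1 + norm x)) \<and>
        (\<forall>x x'. norm (\<sigma> t x - \<sigma> t x') + norm (b t x - b t x') \<le> C * norm (x - x'))"
    and b_cont: "\<forall>i j. continuous_tx_uniformly_yz T (f i j)"
    and b_growth: "\<forall>i j. poly_growth T (\<lambda>t x. f i j t x 0 0)"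
    and b_lipschitz: "\<forall>i j. \<exists>C\<ge>0. \<forall>t\<in>{0..T}. \<forall>x y1 y2 z1 z2.
        \<bar>f i j t x y1 z1 - f i j t x y2 z2\<bar> \<le> C * (norm (y1 - y2) + norm (z1 - z2))"
    and c_mono: "\<forall>i j m. m \<noteq> (i, j) \<longrightarrow> (\<forall>t\<in>{0..T}. \<forall>x y y' z.
        y $ m \<le> y' $ m \<and> (\<forall>n. n \<noteq> m \<longrightarrow> y $ n = y' $ n) \<longrightarrow> f i j t x y z \<le> f i j t x y' z)"
    and d_cont: "\<forall>i j. continuous_on UNIV (h i j)"
    and d_growth: "\<forall>i j. poly_growth_space (h i j)"
    and d_compat: "\<forall>i j x.
        lower_obstacle gl (\<lambda>i j t. h i j) i j T x \<le> ereal (h i j x) \<and>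
        ereal (h i j x) \<le> upper_obstacle gu (\<lambda>i j t. h i j) i j T x"
    and e_gl: "\<forall>i i'. (\<forall>t\<in>{0..T}. \<forall>x. 0 \<le> gl i i' t x) \<and>
        continuous_on (dom_T T) (\<lambda>(t, x). gl i i' t x) \<and> poly_growth T (gl i i')"
    and e_gu: "\<forall>j l. (\<forall>t\<in>{0..T}. \<forall>x. 0 \<le> gu j l t x) \<and>
        continuous_on (dom_T T) (\<lambda>(t, x). gu j l t x) \<and> poly_growth T (gu j l)"
    and e_loop: "no_free_loop T gl gu"
    and sub: "viscosity_subsolution T b \<sigma> f gl gu h u"
    and super: "viscosity_supersolution T b \<sigma> f gl gu h w"
    and growth: "\<exists>C \<gamma>. 0 \<le> C \<and> 0 \<le> \<gamma> \<and> (\<forall>i j. \<forall>t\<in>{0..T}. \<forall>x.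
        \<bar>u i j t x\<bar> + \<bar>w i j t x\<bar> \<le> C * (1 + norm x powr \<gamma>))"
  shows "\<forall>i j. \<forall>t\<in>{0..T}. \<forall>x. u i j t x \<le> w i j t x"
proof (rule ccontr)
  assume "\<not> (\<forall>i j. \<forall>t\<in>{0..T}. \<forall>x. u i j t x \<le> w i j t x)"
  then obtain i1 j1 t1 x1 where t1: "t1 \<in> {0..T}" and uw1: "w i1 j1 t1 x1 < u i1 j1 t1 x1" by (auto simp: not_le)
  obtain C where C: "0 \<le> C" 
    and Cg: "\<And>t x. t \<in> {0..T} \<Longrightarrow> norm (b t x) + norm (\<sigma> t x) \<le> C * (1 + norm x)"
    and Cl: "\<And>t x x'. t \<in> {0..T} \<Longrightarrow> norm (\<sigma> t x - \<sigma> t x') + norm (b t x - b t x') \<le> C * norm (x - x')"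
    using a_growth_lipschitz by blast
  have "\<forall>i j. \<exists>C\<ge>0. \<forall>t\<in>{0..T}. \<forall>x y1 y2 z1 z2. \<bar>f i j t x y1 z1 - f i j t x y2 z2\<bar> \<le> C * (norm (y1 - y2) + norm (z1 - z2))"
    by (rule b_lipschitz)
  then obtain Lf where Lf: "\<And>i j. 0 \<le> Lf i j" 
    and Lf': "\<And>i j t x y1 y2 z1 z2. t \<in> {0..T} \<Longrightarrow> \<bar>f i j t x y1 z1 - f i j t x y2 z2\<bar> \<le> Lf i j * (norm (y1 - y2) + norm (z1 - z2))"
    by metis
  define L where "L = (\<Sum>m\<in>UNIV. Lf (fst m) (snd m))"
  have L0: "0 \<le> L" unfolding L_def by (intro sum_nonneg Lf)
  have LfL: "Lf i j \<le> L" for i j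
    unfolding L_def using member_le_sum[of "(i, j)" UNIV "\<lambda>m. Lf (fst m) (snd m)"] Lf by simp
  have L: "\<bar>f i j t x y1 z1 - f i j t x y2 z2\<bar> \<le> L * (norm (y1 - y2) + norm (z1 - z2))" if "t \<in> {0..T}" for i j t x y1 y2 z1 z2
    using Lf'[OF that] LfL[of i j] by (meson add_nonneg_nonneg mult_right_mono norm_ge_zero order_trans)
  obtain G \<gamma> where G: "0 \<le> G" "0 \<le> \<gamma>" "\<And>i j t x. t \<in> {0..T} \<Longrightarrow> \<bar>u i j t x\<bar> + \<bar>w i j t x\<bar> \<le> G * (1 + norm x powr \<gamma>)"
    using growth by blast
  obtain n :: nat where n: "\<gamma> \<le> real n" using real_arch_simple by blast
  define \<Lambda> where "\<Lambda> = real CARD('i \<times> 'j)"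
  define \<mu> where "\<mu> = 1 + 4 * real (n + 2) * C * (1 + L) + (2 * real (n + 2) + 4 * real (n + 2) * real (n + 1)) * C\<^sup>2 + L * \<Lambda>"
  have \<mu>0: "0 \<le> \<mu>" unfolding \<mu>_def using C L0 by (intro add_nonneg_nonneg mult_nonneg_nonneg) (simp_all add: \<Lambda>_def)
  define v1 where "v1 = exp (\<mu> * t1) * (u i1 j1 t1 x1 - w i1 j1 t1 x1)"
  have v1: "0 < v1" using uw1 by (simp add: v1_def)
  define g1 where "g1 = (1 + x1 \<bullet> x1) ^ (n + 2)"
  have g1: "0 < g1" unfolding g1_def by (intro zero_less_power add_pos_nonneg) auto
  define \<theta> where "\<theta> = v1 / (2 * g1)"
  have \<theta>: "0 < \<theta>" using v1 g1 by (simp add: \<theta>_def)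
  have pos: "0 < exp (\<mu> * t1) * (u i1 j1 t1 x1 - w i1 j1 t1 x1) - \<theta> * (1 + x1 \<bullet> x1) ^ (n + 2)"
    using v1 g1 unfolding v1_def[symmetric] g1_def[symmetric] by (simp add: \<theta>_def)
  have usc: "usc_on (dom_T T) (\<lambda>(t, x). u i j t x)" for i j using sub by (simp add: viscosity_subsolution_def)
  have lsc: "lsc_on (dom_T T) (\<lambda>(t, x). w i j t x)" for i j using super by (simp add: viscosity_supersolution_def)
  obtain i0 j0 ts xs where ts: "ts \<in> {0..T}" and max: "\<And>k l t x. t \<in> {0..T} \<Longrightarrow>
    exp (\<mu> * t) * (u k l t x - w k l t x) - \<theta> * (1 + x \<bullet> x) ^ (n + 2)
    \<le> exp (\<mu> * ts) * (u i0 j0 ts xs - w i0 j0 ts xs) - \<theta> * (1 + xs \<bullet> xs) ^ (n + 2)"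
    using weighted_difference_attains_max[where u=u and w=w, OF usc lsc G(1,2) n G(3) \<theta> \<mu>0 t1 pos] by blast
  define \<Phi> where "\<Phi> = exp (\<mu> * ts) * (u i0 j0 ts xs - w i0 j0 ts xs) - \<theta> * (1 + xs \<bullet> xs) ^ (n + 2)"
  have \<Phi>: "0 < \<Phi>" using max[OF t1, of i1 j1 x1] pos by (simp add: \<Phi>_def)
  define \<phi> where "\<phi> t x = exp (- \<mu> * t) * (\<theta> * (1 + x \<bullet> x) ^ (n + 2) + \<Phi>)" for t and x :: "real ^ 'k"
  have ee: "exp (- \<mu> * t) * (exp (\<mu> * t) * a) = a" for t a :: real
    by (simp add: mult.assoc[symmetric] exp_add[symmetric])
  have below: "u k l t x - w k l t x \<le> \<phi> t x" if "t \<in> {0..T}" for k l t x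
  proof -
    have "exp (- \<mu> * t) * (exp (\<mu> * t) * (u k l t x - w k l t x)) \<le> \<phi> t x"
      unfolding \<phi>_def using max[OF that, of k l x] by (intro mult_left_mono) (auto simp: \<Phi>_def)
    then show ?thesis unfolding ee .
  qed
  have eq0: "u i0 j0 ts xs - w i0 j0 ts xs = \<phi> ts xs"
  proof -
    have "\<phi> ts xs = exp (- \<mu> * ts) * (exp (\<mu> * ts) * (u i0 j0 ts xs - w i0 j0 ts xs))"
      by (simp add: \<phi>_def \<Phi>_def)
    then show ?thesis unfolding ee by simp
  qed
  have \<phi>pos: "0 < \<phi> ts xs"
  proof -
    have "0 \<le> \<theta> * (1 + xs \<bullet> xs) ^ (n + 2)" using \<theta> by (intro mult_nonneg_nonneg zero_le_power add_nonneg_nonneg) auto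
    then show ?thesis unfolding \<phi>_def using \<Phi> by (intro mult_pos_pos add_nonneg_pos) auto
  qed
  have "ts \<noteq> T"
  proof
    assume "ts = T"
    moreover have "u i0 j0 T xs \<le> h i0 j0 xs" "h i0 j0 xs \<le> w i0 j0 T xs"
      using sub super by (auto simp: viscosity_subsolution_def viscosity_supersolution_def)
    ultimately show False using eq0 \<phi>pos by simp
  qed
  then have ts': "ts \<in> {0..<T}" using ts by auto
  have glc: "continuous_on (dom_T T) (\<lambda>(t, x). gl i k t x)" for i k using e_gl by blast
  have guc: "continuous_on (dom_T T) (\<lambda>(t, x). gu j l t x)" for j l using e_gu by blast
  have "\<exists>i j. u i j ts xs - w i j ts xs = \<phi> ts xs \<and> (\<forall>k. k \<noteq> i \<longrightarrow> u k j ts xs - gl i k ts xs < u i j ts xs)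
    \<and> (\<forall>l. l \<noteq> j \<longrightarrow> w i j ts xs < w i l ts xs + gu j l ts xs)"
  proof (rule no_free_loop_selection[where u="\<lambda>i j. u i j ts xs" and w="\<lambda>i j. w i j ts xs" and gl="\<lambda>i k. gl i k ts xs" and gu="\<lambda>j l. gu j l ts xs"])
    fix N and a :: "nat \<Rightarrow> 'i" and c :: "nat \<Rightarrow> 'j"
    assume "3 \<le> N" "(a N, c N) = (a 1, c 1)" "card ((\<lambda>q. (a q, c q)) ` {1..N}) = N - 1"
      "\<forall>q\<in>{1..N - 1}. a (q + 1) = a q \<or> c (q + 1) = c q"
    then show "(\<Sum>q = 1..N - 1. - gl (a q) (a (q + 1)) ts xs * of_bool (a q \<noteq> a (q + 1)) + gu (c q) (c (q + 1)) ts xs * of_bool (c q \<noteq> c (q + 1))) \<noteq> 0"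
      using e_loop[unfolded no_free_loop_def, rule_format, of N a c, OF _ _ ts] by blast
  next
    show "w k j ts xs - gl i k ts xs \<le> w i j ts xs" if "k \<noteq> i" for i j k
      by (rule supersolution_lower_obstacle[OF super ts' glc that])
    show "(\<exists>k. k \<noteq> i \<and> u i j ts xs \<le> u k j ts xs - gl i k ts xs) \<or> (\<forall>l. l \<noteq> j \<longrightarrow> u i j ts xs \<le> u i l ts xs + gu j l ts xs)" for i j
      by (rule subsolution_obstacle_alternative[OF sub ts' glc guc])
    show "u i j ts xs - w i j ts xs \<le> \<phi> ts xs" for i j by (rule below[OF ts])
    show "u i0 j0 ts xs - w i0 j0 ts xs = \<phi> ts xs" by (rule eq0)
  qed
  then obtain i j where ij: "u i j ts xs - w i j ts xs = \<phi> ts xs" and strict: "\<And>k. k \<noteq> i \<Longrightarrow> u k j ts xs - gl i k ts xs < u i j ts xs"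
    "\<And>l. l \<noteq> j \<Longrightarrow> w i j ts xs < w i l ts xs + gu j l ts xs" by blast
  define \<kappa> where "\<kappa> = \<phi> ts xs / (2 * (1 + (norm (\<sigma> ts xs))\<^sup>2))"
  have \<kappa>: "0 < \<kappa>" unfolding \<kappa>_def using \<phi>pos by (intro divide_pos_pos mult_pos_pos add_pos_nonneg) auto
  have b\<phi>: "barrier \<mu> \<theta> n \<Phi> \<kappa> ts xs t x = \<phi> t x + \<kappa> * ((t - ts)\<^sup>2 + (x - xs) \<bullet> (x - xs))" for t x
    by (simp add: barrier_def \<phi>_def)
  have b\<phi>s: "barrier \<mu> \<theta> n \<Phi> \<kappa> ts xs ts xs = \<phi> ts xs" by (simp add: b\<phi>)
  have fc: "continuous_tx_uniformly_yz T (f i j)" using b_cont by blast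
  have \<theta>': "0 \<le> \<theta>" using \<theta> by simp
  have "- barrier_t \<mu> \<theta> n \<Phi> \<kappa> ts xs ts xs - b ts xs \<bullet> barrier_x \<mu> \<theta> n \<Phi> \<kappa> ts xs ts xs
      - L * norm (transpose (\<sigma> ts xs) *v barrier_x \<mu> \<theta> n \<Phi> \<kappa> ts xs ts xs)
      - trace (\<sigma> ts xs ** transpose (\<sigma> ts xs) ** barrier_xx \<mu> \<theta> n \<Phi> \<kappa> ts xs ts xs) / 2
      \<le> L * (real CARD('i \<times> 'j) * barrier \<mu> \<theta> n \<Phi> \<kappa> ts xs ts xs)"
  proof (rule touching_inequality[OF sub super a_cont C Cl fc L0 L _ glc guc ts' barrier_continuous barrier_expansion[OF \<theta>']])
    show "f i j t x y z \<le> f i j t x y' z" if "m \<noteq> (i, j)" "t \<in> {0..T}" "y $ m \<le> y' $ m" "\<And>n. n \<noteq> m \<Longrightarrow> y $ n = y' $ n" for m t x y y' z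
      using c_mono that by blast
    show "u i j t x - w i j t x < barrier \<mu> \<theta> n \<Phi> \<kappa> ts xs t x" if "t \<in> {0..T}" "(t, x) \<noteq> (ts, xs)" for t x
    proof -
      have "0 < (t - ts)\<^sup>2 + (x - xs) \<bullet> (x - xs)"
      proof (cases "t = ts")
        case True then show ?thesis using that(2) by simp
      qed (simp add: add_pos_nonneg)
      then have "0 < \<kappa> * ((t - ts)\<^sup>2 + (x - xs) \<bullet> (x - xs))" using \<kappa> by simp
      then show ?thesis using below[OF that(1), of i j x] unfolding b\<phi> by linarith
    qed
    show "u i j ts xs - w i j ts xs = barrier \<mu> \<theta> n \<Phi> \<kappa> ts xs ts xs" unfolding b\<phi>s by (rule ij)
    show "u k l ts xs - w k l ts xs \<le> barrier \<mu> \<theta> n \<Phi> \<kappa> ts xs ts xs" for k l unfolding b\<phi>s by (rule below[OF ts])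
    show "0 \<le> barrier \<mu> \<theta> n \<Phi> \<kappa> ts xs ts xs" unfolding b\<phi>s using \<phi>pos by simp
  qed (use strict in auto)
  moreover have "L * (\<Lambda> * \<phi> ts xs) < - barrier_t \<mu> \<theta> n \<Phi> \<kappa> ts xs ts xs - b ts xs \<bullet> barrier_x \<mu> \<theta> n \<Phi> \<kappa> ts xs ts xs
      - L * norm (transpose (\<sigma> ts xs) *v barrier_x \<mu> \<theta> n \<Phi> \<kappa> ts xs ts xs)
      - trace (\<sigma> ts xs ** transpose (\<sigma> ts xs) ** barrier_xx \<mu> \<theta> n \<Phi> \<kappa> ts xs ts xs) / 2"
  proof (rule barrier_strict_supersolution[OF C _ _ \<theta>' \<Phi> L0 _ \<phi>_def \<mu>_def \<kappa>_def])
    show "norm (b ts xs) \<le> C * (1 + norm xs)" "norm (\<sigma> ts xs) \<le> C * (1 + norm xs)"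
      using Cg[OF ts, of xs] norm_ge_zero[of "b ts xs"] norm_ge_zero[of "\<sigma> ts xs"] by linarith+
  qed (simp add: \<Lambda>_def)
  ultimately show False unfolding b\<phi>s \<Lambda>_def by linarith
qed

end
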